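(* Let $1\le p<\infty$, let $\rho$ be an admissible weight function on $[0,\infty[$, and let $\mathcal{T}=(T_t)_{t\ge0}$ be the translation semigroup on $L_p^\rho([0,\infty[)$. The following assertions are equivalent: (1) $\mathcal{T}$ is frequently hypercyclic on $L_p^\rho([0,\infty[)$. (2) $\sum_{k\in\mathbb{N}}\rho(k)<\infty$. (3) $\int_0^\infty\rho(t)\,dt<\infty$. (4) $\mathcal{T}$ is chaotic on $L_p^\rho([0,\infty[)$. (5) $\mathcal{T}$ satisfies the Frequent Hypercyclicity Criterion.
   Context: An admissible weight function on $[0,\infty[$ is a measurable function $\rho:[0,\infty[\,\to\,]0,\infty[$ for which there exist $M\ge1$ and $\omega\in\mathbb{R}$ such that $\rho(\tau)\le Me^{\omega t}\rho(\tau+t)$ for all $\tau\ge0$ and $t>0$. $L_p^\rho([0,\infty[)$ is the Banach space of (classes of a.e. equal) measurable $u:[0,\infty[\,\to\mathbb{R}$ with $\|u\|_p^\rho=\left(\int_0^\infty|u(t)|^p\rho(t)\,dt\right)^{1/p}<\infty$. The translation semigroup on it is $T_tf(x)=f(x+t)$, $t\ge0$, $x\ge0$; it is a $C_0$-semigroup. Let $(T_t)_{t\ge0}$ be a $C_0$-semigroup on a separable Banach space $X$. The lower density of a measurable $S\subseteq\mathbb{R}_+$ is $\underline{\mathrm{Dens}}(S)=\liminf_{N\to\infty}\mu(S\cap[0,N])/N$, with $\mu$ Lebesgue measure. The semigroup is frequently hypercyclic if there exists $x\in X$ such that $\underline{\mathrm{Dens}}(\{t\in\mathbb{R}_+:T_tx\in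 U\})>0$ for every non-empty open $U\subseteq X$. It is hypercyclic if there exists $x\in X$ with $\{T_tx:t\ge0\}$ dense in $X$. A point $x\in X$ is periodic if $T_tx=x$ for some $t>0$. The semigroup is chaotic if it is hypercyclic and its set of periodic points is dense in $X$. The semigroup satisfies the Frequent Hypercyclicity Criterion (for $C_0$-semigroups) if there exist a dense subset $X_0\subseteq X$ and maps $S_t:X_0\to X_0$, $t>0$, such that: (i) $T_tS_tx=x$ and $T_tS_rx=S_{r-t}x$ for all $x\in X_0$ and $r>t>0$; (ii) $t\mapsto T_tx$ is Pettis integrable on $[0,\infty[$ for all $x\in X_0$; (iii) $t\mapsto S_tx$ is Pettis integrable on $[0,\infty[$ for all $x\in X_0$. *)

theory Defs
  imports "HOL-Analysis.Analysis"
begin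

section \<open>Classes of measurable functions on the half-line\<close>

text \<open>
  The weights below are strictly positive, so ``almost everywhere'' means the same for
  \<open>\<rho>(t) dt\<close> as for \<open>dt\<close>, and all spaces \<open>L\<^sub>p\<^sup>\<rho>\<close> are linear subspaces of the one space of
  classes of measurable functions introduced here.  Values of representatives at negative
  arguments are irrelevant.
\<close>

definition ae_eq :: "(real \<Rightarrow> real) \<Rightarrow> (real \<Rightarrow> real) \<Rightarrow> bool" where
  "ae_eq f g \<longleftrightarrow>
     f \<in> borel_measurable (lebesgue_on {0..}) \<and> g \<in> borel_measurable (lebesgue_on {0..}) \<and>
     (AE x in lebesgue_on {0..}. f x = g x)"

lemma part_equivp_ae_eq: "part_equivp ae_eq"
proof (rule part_equivpI)
  show "\<exists>f. ae_eq f f"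
    by (rule exI[of _ "\<lambda>_. 0"]) (simp add: ae_eq_def)
  show "symp ae_eq"
    by (rule sympI) (auto simp: ae_eq_def eq_commute)
  show "transp ae_eq"
  proof (rule transpI)
    fix f g h assume "ae_eq f g" "ae_eq g h"
    then show "ae_eq f h"
      unfolding ae_eq_def by auto
  qed
qed

quotient_type fclass = "real \<Rightarrow> real" / partial: ae_eq
  by (rule part_equivp_ae_eq)

instantiation fclass :: real_vector
begin

lift_definition zero_fclass :: fclass is "\<lambda>_. 0"
  by (simp add: ae_eq_def)

lift_definition plus_fclass :: "fclass \<Rightarrow> fclass \<Rightarrow> fclass" is "\<lambda>f g x. f x + g x"
  unfolding ae_eq_def by auto

lift_definition minus_fclass :: "fclass \<Rightarrow> fclass \<Rightarrow> fclass" is "\<lambda>f g x. f x - g x"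
  unfolding ae_eq_def by auto

lift_definition uminus_fclass :: "fclass \<Rightarrow> fclass" is "\<lambda>f x. - f x"
  unfolding ae_eq_def by auto

lift_definition scaleR_fclass :: "real \<Rightarrow> fclass \<Rightarrow> fclass" is "\<lambda>c f x. c * f x"
  unfolding ae_eq_def by auto

instance
  by standard (transfer; auto simp: ae_eq_def algebra_simps)+

end


section \<open>Weighted \<open>L\<^sub>p\<close>-spaces and the translation semigroup\<close>

definition admissible_weight :: "(real \<Rightarrow> real) \<Rightarrow> bool" where
  "admissible_weight \<rho> \<longleftrightarrow>
     \<rho> \<in> borel_measurable (lebesgue_on {0..}) \<and>
     (\<forall>t\<ge>0. \<rho> t > 0) \<and>
     (\<exists>M\<ge>1. \<exists>\<omega>. \<forall>\<tau>\<ge>0. \<forall>t>0. \<rho> \<tau> \<le> M * exp (\<omega> * t) * \<rho> (\<tau> + t))"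

lift_definition Lp_integral :: "real \<Rightarrow> (real \<Rightarrow> real) \<Rightarrow> fclass \<Rightarrow> ennreal"
  is "\<lambda>p \<rho> u. \<integral>\<^sup>+t. ennreal (\<bar>u t\<bar> powr p * \<rho> t) \<partial>lebesgue_on {0..}"
  unfolding ae_eq_def by (auto intro!: nn_integral_cong_AE)

definition Lp_space :: "real \<Rightarrow> (real \<Rightarrow> real) \<Rightarrow> fclass set" where
  "Lp_space p \<rho> = {u. Lp_integral p \<rho> u < \<infinity>}"

definition Lp_norm :: "real \<Rightarrow> (real \<Rightarrow> real) \<Rightarrow> fclass \<Rightarrow> real" where
  "Lp_norm p \<rho> u = enn2real (Lp_integral p \<rho> u) powr (1 / p)"

text \<open>The following facts lead up to the norm axioms for \<open>L\<^sub>p\<^sup>\<rho>\<close>, which show that the metric topology used below is meaningful.\<close>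

lemma powr_convex_nonneg:
  assumes "1 \<le> (p::real)" shows "convex_on {0..} (\<lambda>x. x powr p)"
proof (rule convex_onI)
  fix t x y :: real assume t: "0 < t" "t < 1" and xy: "x \<in> {0..}" "y \<in> {0..}"
  have le: "s powr p \<le> s" if "0 < s" "s < 1" for s :: real
    using powr_mono'[of 1 p s] that assms by simp
  consider "x = 0" | "y = 0" | "x > 0" "y > 0" using xy by fastforce
  then show "((1 - t) *\<^sub>R x + t *\<^sub>R y) powr p \<le> (1 - t) * x powr p + t * y powr p"
  proof cases
    case 1
    then show ?thesis using t xy le[of t] by (simp add: powr_mult mult_right_mono)
  next
    case 2
    then show ?thesis using t xy le[of "1-t"] by (simp add: powr_mult mult_right_mono)
  next
    case 3
    then show ?thesis
      using convex_onD[OF powr_convex[OF assms], of t x y] t by simp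
  qed
qed simp

lemma powr_add_convex:
  fixes a b A B p :: real
  assumes p: "1 \<le> p" and "0 \<le> a" "0 \<le> b" "0 < A" "0 < B"
  shows "(a + b) powr p \<le> (A + B) powr p * (A / (A + B) * (a powr p / A powr p) + B / (A + B) * (b powr p / B powr p))"
proof -
  have e: "1 - B / (A + B) = A / (A + B)" using assms by (simp add: field_simps)
  have "(A / (A + B) * (a / A) + B / (A + B) * (b / B)) powr p
      \<le> A / (A + B) * (a / A) powr p + B / (A + B) * (b / B) powr p"
    using convex_onD[OF powr_convex_nonneg[OF p], of "B / (A+B)" "a/A" "b/B"] assms
    by (simp add: e del: times_divide_eq_left times_divide_eq_right)
  moreover have "A / (A + B) * (a / A) + B / (A + B) * (b / B) = (a + b) / (A + B)"
    using assms by (simp add: add_divide_distrib)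
  ultimately have "((a + b) / (A + B)) powr p \<le> A / (A + B) * (a / A) powr p + B / (A + B) * (b / B) powr p"
    by simp
  then have "(A + B) powr p * ((a + b) / (A + B)) powr p \<le> (A + B) powr p * (A / (A + B) * (a / A) powr p + B / (A + B) * (b / B) powr p)"
    by (rule mult_left_mono) simp
  then show ?thesis using assms by (simp add: powr_divide)
qed

context
  fixes p :: real and \<rho> :: "real \<Rightarrow> real"
  assumes p: "1 \<le> p" and \<rho>: "admissible_weight \<rho>"
begin

lemma rho_meas [measurable]: "\<rho> \<in> borel_measurable (lebesgue_on {0..})"
  using \<rho> by (simp add: admissible_weight_def)

lemma rho_pos: "0 \<le> t \<Longrightarrow> 0 < \<rho> t"
  using \<rho> by (simp add: admissible_weight_def)

lemma Lp_integral_minus: "Lp_integral p \<rho> (x - y) = Lp_integral p \<rho> (y - x)"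
  by (transfer fixing: p \<rho>) (simp add: abs_minus_commute)

lemma Lp_integral_eq_0: "Lp_integral p \<rho> x = 0 \<longleftrightarrow> x = 0"
proof (transfer fixing: p \<rho>)
  fix u assume "ae_eq u u"
  then have [measurable]: "u \<in> borel_measurable (lebesgue_on {0..})" by (simp add: ae_eq_def)
  have "(\<integral>\<^sup>+t. ennreal (\<bar>u t\<bar> powr p * \<rho> t) \<partial>lebesgue_on {0..}) = 0 \<longleftrightarrow>
     (AE t in lebesgue_on {0..}. ennreal (\<bar>u t\<bar> powr p * \<rho> t) = 0)"
    by (intro nn_integral_0_iff_AE) simp
  also have "\<dots> \<longleftrightarrow> (AE t in lebesgue_on {0..}. u t = 0)"
  proof (rule AE_cong)
    fix t assume "t \<in> space (lebesgue_on {0::real..})"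
    then have "\<rho> t > 0" by (intro rho_pos) simp
    then show "(ennreal (\<bar>u t\<bar> powr p * \<rho> t) = 0) = (u t = 0)"
      by (auto simp: ennreal_eq_0_iff mult_le_0_iff)
  qed
  finally show "((\<integral>\<^sup>+t. ennreal (\<bar>u t\<bar> powr p * \<rho> t) \<partial>lebesgue_on {0..}) = 0) = ae_eq u (\<lambda>_. 0)"
    by (simp add: ae_eq_def)
qed

lemma Lp_integral_add:
  assumes "0 < A" "0 < B"
  shows "Lp_integral p \<rho> (x + y) \<le> ennreal ((A + B) powr p) *
    (ennreal (A / (A + B) / A powr p) * Lp_integral p \<rho> x + ennreal (B / (A + B) / B powr p) * Lp_integral p \<rho> y)"
proof (transfer fixing: p \<rho> A B)
  fix u v assume "ae_eq u u" "ae_eq v v"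
  then have [measurable]: "u \<in> borel_measurable (lebesgue_on {0..})"
     "v \<in> borel_measurable (lebesgue_on {0..})" by (auto simp: ae_eq_def)
  let ?a = "A / (A + B) / A powr p" and ?b = "B / (A + B) / B powr p"
  have "(\<integral>\<^sup>+t. ennreal (\<bar>u t + v t\<bar> powr p * \<rho> t) \<partial>lebesgue_on {0..})
    \<le> (\<integral>\<^sup>+t. ennreal ((A + B) powr p) * (ennreal ?a * ennreal (\<bar>u t\<bar> powr p * \<rho> t) + ennreal ?b * ennreal (\<bar>v t\<bar> powr p * \<rho> t)) \<partial>lebesgue_on {0..})"
  proof (rule nn_integral_mono)
    fix t assume "t \<in> space (lebesgue_on {0::real..})"
    then have r: "\<rho> t > 0" by (intro rho_pos) simp
    have "\<bar>u t + v t\<bar> powr p \<le> (\<bar>u t\<bar> + \<bar>v t\<bar>) powr p"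
      using p by (intro powr_mono2) auto
    also have "\<dots> \<le> (A + B) powr p * (?a * \<bar>u t\<bar> powr p + ?b * \<bar>v t\<bar> powr p)"
      using powr_add_convex[OF p _ _ assms, of "\<bar>u t\<bar>" "\<bar>v t\<bar>"] by simp
    finally have "\<bar>u t + v t\<bar> powr p * \<rho> t \<le> (A + B) powr p * (?a * \<bar>u t\<bar> powr p + ?b * \<bar>v t\<bar> powr p) * \<rho> t"
      using r by (intro mult_right_mono) auto
    also have "\<dots> = (A + B) powr p * (?a * (\<bar>u t\<bar> powr p * \<rho> t) + ?b * (\<bar>v t\<bar> powr p * \<rho> t))"
      by (simp add: algebra_simps)
    finally show "ennreal (\<bar>u t + v t\<bar> powr p * \<rho> t) \<le> ennreal ((A + B) powr p) * (ennreal ?a * ennreal (\<bar>u t\<bar> powr p * \<rho> t) + ennreal ?b * ennreal (\<bar>v t\<bar> powr p * \<rho> t))"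
      using r assms by (simp add: ennreal_mult'[symmetric] ennreal_plus[symmetric] del: ennreal_plus)
  qed
  also have "\<dots> = ennreal ((A + B) powr p) *
    (ennreal ?a * (\<integral>\<^sup>+t. ennreal (\<bar>u t\<bar> powr p * \<rho> t) \<partial>lebesgue_on {0..}) + ennreal ?b * (\<integral>\<^sup>+t. ennreal (\<bar>v t\<bar> powr p * \<rho> t) \<partial>lebesgue_on {0..}))"
    by (simp add: nn_integral_cmult nn_integral_add)
  finally show "(\<integral>\<^sup>+t. ennreal (\<bar>u t + v t\<bar> powr p * \<rho> t) \<partial>lebesgue_on {0..}) \<le> \<dots>" .
qed

lemma Lp_norm_eq_0: "x \<in> Lp_space p \<rho> \<Longrightarrow> Lp_norm p \<rho> x = 0 \<longleftrightarrow> x = 0"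
  using Lp_integral_eq_0[of x] by (auto simp: Lp_norm_def Lp_space_def enn2real_eq_0_iff)

lemma Lp_integral_norm: "x \<in> Lp_space p \<rho> \<Longrightarrow> Lp_integral p \<rho> x = ennreal (Lp_norm p \<rho> x powr p)"
  using p by (simp add: Lp_norm_def Lp_space_def powr_powr)

lemma Lp_add:
  assumes x: "x \<in> Lp_space p \<rho>" and y: "y \<in> Lp_space p \<rho>"
  shows "x + y \<in> Lp_space p \<rho> \<and> Lp_norm p \<rho> (x + y) \<le> Lp_norm p \<rho> x + Lp_norm p \<rho> y"
proof (cases "x = 0 \<or> y = 0")
  case True
  then show ?thesis using assms by (auto simp: Lp_norm_def)
next
  case False
  define A B where "A = Lp_norm p \<rho> x" and "B = Lp_norm p \<rho> y"
  have AB: "A > 0" "B > 0"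
    using False Lp_norm_eq_0[OF x] Lp_norm_eq_0[OF y] by (auto simp: A_def B_def Lp_norm_def less_le)
  have "Lp_integral p \<rho> (x + y) \<le> ennreal ((A + B) powr p) *
    (ennreal (A / (A + B) / A powr p) * ennreal (A powr p) + ennreal (B / (A + B) / B powr p) * ennreal (B powr p))"
    using Lp_integral_add[OF AB, of x y] Lp_integral_norm[OF x] Lp_integral_norm[OF y] by (simp add: A_def B_def)
  also have "\<dots> = ennreal ((A + B) powr p * (A / (A + B) + B / (A + B)))"
    using AB by (simp add: ennreal_mult'[symmetric] ennreal_plus[symmetric] del: ennreal_plus)
  also have "A / (A + B) + B / (A + B) = 1" using AB by (simp add: add_divide_distrib[symmetric])
  finally have I: "Lp_integral p \<rho> (x + y) \<le> ennreal ((A + B) powr p)" by simp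
  then have "enn2real (Lp_integral p \<rho> (x + y)) \<le> (A + B) powr p"
    by (simp add: enn2real_leI)
  then have "Lp_norm p \<rho> (x + y) \<le> ((A + B) powr p) powr (1 / p)"
    unfolding Lp_norm_def using p by (intro powr_mono2) auto
  also have "\<dots> = A + B" using p AB by (simp add: powr_powr)
  finally show ?thesis
    using I by (auto simp: Lp_space_def A_def B_def intro: le_less_trans)
qed

lemma Lp_scaleR:
  assumes "x \<in> Lp_space p \<rho>"
  shows "c *\<^sub>R x \<in> Lp_space p \<rho> \<and> Lp_norm p \<rho> (c *\<^sub>R x) = \<bar>c\<bar> * Lp_norm p \<rho> x"
proof -
  have *: "Lp_integral p \<rho> (c *\<^sub>R x) = ennreal (\<bar>c\<bar> powr p) * Lp_integral p \<rho> x"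
  proof (transfer fixing: p \<rho> c)
    fix u assume "ae_eq u u"
    then have [measurable]: "u \<in> borel_measurable (lebesgue_on {0..})" by (simp add: ae_eq_def)
    have "(\<lambda>t. ennreal (\<bar>c * u t\<bar> powr p * \<rho> t)) = (\<lambda>t. ennreal (\<bar>c\<bar> powr p) * ennreal (\<bar>u t\<bar> powr p * \<rho> t))"
      by (simp add: abs_mult powr_mult mult.assoc ennreal_mult')
    then show "(\<integral>\<^sup>+t. ennreal (\<bar>c * u t\<bar> powr p * \<rho> t) \<partial>lebesgue_on {0..}) =
       ennreal (\<bar>c\<bar> powr p) * (\<integral>\<^sup>+t. ennreal (\<bar>u t\<bar> powr p * \<rho> t) \<partial>lebesgue_on {0..})"
      by (simp add: nn_integral_cmult)
  qed
  then show ?thesis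
    using assms p by (auto simp: Lp_space_def Lp_norm_def ennreal_mult_less_top enn2real_mult powr_mult powr_powr)
qed

lemma subspace_Lp_space: "subspace (Lp_space p \<rho>)"
  unfolding subspace_def
proof (intro conjI ballI allI)
  show "0 \<in> Lp_space p \<rho>" using Lp_integral_eq_0[of 0] by (simp add: Lp_space_def)
qed (use Lp_add Lp_scaleR in auto)

lemma Metric_space_Lp: "Metric_space (Lp_space p \<rho>) (\<lambda>x y. Lp_norm p \<rho> (x - y))"
proof
  fix x y show "0 \<le> Lp_norm p \<rho> (x - y)" by (simp add: Lp_norm_def)
  show "Lp_norm p \<rho> (x - y) = Lp_norm p \<rho> (y - x)"
    by (simp add: Lp_norm_def Lp_integral_minus[of x y])
next
  fix x y assume "x \<in> Lp_space p \<rho>" "y \<in> Lp_space p \<rho>"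
  then show "(Lp_norm p \<rho> (x - y) = 0) = (x = y)"
    using Lp_norm_eq_0[of "x - y"] subspace_diff[OF subspace_Lp_space] by simp
next
  fix x y z assume "x \<in> Lp_space p \<rho>" "y \<in> Lp_space p \<rho>" "z \<in> Lp_space p \<rho>"
  then show "Lp_norm p \<rho> (x - z) \<le> Lp_norm p \<rho> (x - y) + Lp_norm p \<rho> (y - z)"
    using Lp_add[of "x - y" "y - z"] subspace_diff[OF subspace_Lp_space] by simp
qed

end

lemma shift_lebesgue_measurable:
  "(\<lambda>x::real. x + t) \<in> lebesgue \<rightarrow>\<^sub>M lebesgue"
  using lebesgue_affine_measurable[of "\<lambda>_. 1" t] by (simp add: add.commute)

lemma shift_measurable_half_line:
  assumes "0 \<le> (t::real)"
  shows "(\<lambda>x. x + t) \<in> lebesgue_on {0..} \<rightarrow>\<^sub>M lebesgue_on {0..}"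
  using assms
  by (intro measurable_restrict_space3 shift_lebesgue_measurable) auto

lemma AE_shift_half_line:
  assumes "0 \<le> (t::real)" and "AE x in lebesgue_on {0..}. P x"
  shows "AE x in lebesgue_on {0..}. P (x + t)"
proof -
  have "AE x in lebesgue. x \<in> {0..} \<longrightarrow> P x"
    using assms(2) by (simp add: AE_restrict_space_iff)
  then obtain N where N: "N \<in> null_sets lborel" "{x. \<not> (x \<in> {0..} \<longrightarrow> P x)} \<subseteq> N"
    unfolding completion.AE_iff_null_sets[symmetric] AE_completion_iff
    by (auto simp: eventually_ae_filter)
  have "{x. x - (-t) \<in> N} \<in> null_sets lborel"
    by (rule null_sets_translation[OF N(1)])
  then have "AE x in lborel. x \<in> {0..} \<longrightarrow> P (x + t)"
    using N(2) assms(1) by (elim AE_I') auto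
  then show ?thesis
    by (simp add: AE_restrict_space_iff AE_completion)
qed

text \<open>The identity for \<open>t < 0\<close> is a dummy value: only \<open>t \<ge> 0\<close> is ever used.\<close>

lift_definition translation :: "real \<Rightarrow> fclass \<Rightarrow> fclass"
  is "\<lambda>t f. if 0 \<le> t then (\<lambda>x. f (x + t)) else f"
proof -
  fix t f g assume "ae_eq f g"
  then have m: "f \<in> borel_measurable (lebesgue_on {0..})" "g \<in> borel_measurable (lebesgue_on {0..})"
    and ae: "AE x in lebesgue_on {0..}. f x = g x"
    by (auto simp: ae_eq_def)
  show "ae_eq (if 0 \<le> t then (\<lambda>x. f (x + t)) else f) (if 0 \<le> t then (\<lambda>x. g (x + t)) else g)"
  proof (cases "0 \<le> t")
    case True
    then show ?thesis
      using AE_shift_half_line[OF True ae] m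
      by (simp add: ae_eq_def measurable_compose[OF shift_measurable_half_line])
  qed (use m ae in \<open>simp add: ae_eq_def\<close>)
qed


section \<open>Semigroups of operators\<close>

text \<open>
  Throughout, a normed space is given by a linear subspace \<open>X\<close> of some real vector space and a
  norm \<open>N\<close> on \<open>X\<close>; a semigroup on it is a family \<open>T\<close> indexed by real numbers, of which only
  the members \<open>T t\<close> with \<open>t \<ge> 0\<close> matter.
\<close>

definition norm_topology :: "'v::real_vector set \<Rightarrow> ('v \<Rightarrow> real) \<Rightarrow> 'v topology" where
  "norm_topology X N = Metric_space.mtopology X (\<lambda>x y. N (x - y))"

definition dense_in_space :: "'v::real_vector set \<Rightarrow> ('v \<Rightarrow> real) \<Rightarrow> 'v set \<Rightarrow> bool" where
  "dense_in_space X N D \<longleftrightarrow> D \<subseteq> X \<and> norm_topology X N closure_of D = X"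

definition lower_density :: "real set \<Rightarrow> ereal" where
  "lower_density S = Liminf at_top (\<lambda>r::real. ereal (measure lebesgue (S \<inter> {0..r}) / r))"

definition frequently_hypercyclic ::
  "'v::real_vector set \<Rightarrow> ('v \<Rightarrow> real) \<Rightarrow> (real \<Rightarrow> 'v \<Rightarrow> 'v) \<Rightarrow> bool" where
  "frequently_hypercyclic X N T \<longleftrightarrow>
     (\<exists>x\<in>X. \<forall>U. openin (norm_topology X N) U \<and> U \<noteq> {} \<longrightarrow>
        lower_density {t. 0 \<le> t \<and> T t x \<in> U} > 0)"

definition hypercyclic ::
  "'v::real_vector set \<Rightarrow> ('v \<Rightarrow> real) \<Rightarrow> (real \<Rightarrow> 'v \<Rightarrow> 'v) \<Rightarrow> bool" where
  "hypercyclic X N T \<longleftrightarrow> (\<exists>x\<in>X. dense_in_space X N {T t x | t. 0 \<le> t})"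

definition periodic_points :: "'v set \<Rightarrow> (real \<Rightarrow> 'v \<Rightarrow> 'v) \<Rightarrow> 'v set" where
  "periodic_points X T = {x \<in> X. \<exists>t>0. T t x = x}"

definition chaotic ::
  "'v::real_vector set \<Rightarrow> ('v \<Rightarrow> real) \<Rightarrow> (real \<Rightarrow> 'v \<Rightarrow> 'v) \<Rightarrow> bool" where
  "chaotic X N T \<longleftrightarrow> hypercyclic X N T \<and> dense_in_space X N (periodic_points X T)"

text \<open>
  Continuous linear functionals on \<open>X\<close>; their values outside \<open>X\<close> are unconstrained.
\<close>

definition dual_space :: "'v::real_vector set \<Rightarrow> ('v \<Rightarrow> real) \<Rightarrow> ('v \<Rightarrow> real) set" where
  "dual_space X N = {\<phi>.
     (\<forall>x\<in>X. \<forall>y\<in>X. \<phi> (x + y) = \<phi> x + \<phi> y) \<and>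
     (\<forall>c. \<forall>x\<in>X. \<phi> (c *\<^sub>R x) = c * \<phi> x) \<and>
     (\<exists>C. \<forall>x\<in>X. \<bar>\<phi> x\<bar> \<le> C * N x)}"

definition Pettis_integrable_on ::
  "'v::real_vector set \<Rightarrow> ('v \<Rightarrow> real) \<Rightarrow> (real \<Rightarrow> 'v) \<Rightarrow> real set \<Rightarrow> bool" where
  "Pettis_integrable_on X N F A \<longleftrightarrow>
     F ` A \<subseteq> X \<and>
     (\<forall>\<phi>\<in>dual_space X N. integrable (lebesgue_on A) (\<lambda>t. \<phi> (F t))) \<and>
     (\<forall>E\<in>sets lebesgue. E \<subseteq> A \<longrightarrow>
        (\<exists>z\<in>X. \<forall>\<phi>\<in>dual_space X N. \<phi> z = (\<integral>t. \<phi> (F t) \<partial>lebesgue_on E)))"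

text \<open>
  The maps \<open>S t\<close> exist only for \<open>t > 0\<close>, so integrability of \<open>t \<mapsto> S t x\<close> on the half-line is
  expressed on \<open>{0<..}\<close>, which differs from it by a null set.
\<close>

definition frequent_hypercyclicity_criterion ::
  "'v::real_vector set \<Rightarrow> ('v \<Rightarrow> real) \<Rightarrow> (real \<Rightarrow> 'v \<Rightarrow> 'v) \<Rightarrow> bool" where
  "frequent_hypercyclicity_criterion X N T \<longleftrightarrow>
     (\<exists>X0 S. dense_in_space X N X0 \<and>
        (\<forall>t>0. \<forall>x\<in>X0. S t x \<in> X0) \<and>
        (\<forall>x\<in>X0. \<forall>t>0. T t (S t x) = x) \<and>
        (\<forall>x\<in>X0. \<forall>t>0. \<forall>r>t. T t (S r x) = S (r - t) x) \<and>
        (\<forall>x\<in>X0. Pettis_integrable_on X N (\<lambda>t. T t x) {0..}) \<and>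
        (\<forall>x\<in>X0. Pettis_integrable_on X N (\<lambda>t. S t x) {0<..}))"

end

theory Submission
  imports Defs "HOL-Complex_Analysis.Great_Picard"
begin

text \<open>
  Admissibility gives \<open>\<rho> \<tau> \<le> K * \<rho> (\<tau> + t)\<close> for bounded \<open>t\<close>, so the sum and the integral of \<open>\<rho>\<close>
  are comparable, and a nonzero periodic point forces both to be finite.

  If \<open>x\<close> is frequently hypercyclic, let \<open>B\<close> be the set of integers near times at which the orbit
  is close to the indicator of \<open>[0, 2]\<close>.  At such a time \<open>k\<close>, all later ones \<open>j\<close> contribute about
  \<open>\<rho> (j - k)\<close> to the small distance, so the sums of \<open>\<rho>\<close> over \<open>(B - k) \<inter> [2, \<infinity>)\<close> are bounded uniformly
  in \<open>k \<in> B\<close>; averaging over \<open>k\<close> bounds the sum of \<open>\<rho>\<close> over the frequent differences of \<open>B\<close>,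
  which have bounded gaps.

  Conversely, if \<open>\<rho>\<close> is integrable, there is an increasing unbounded \<open>h\<close> with \<open>h * \<rho>\<close> integrable.
  Copies of a dense sequence of step functions, enumerated so slowly that they are controlled by \<open>h\<close>,
  are laid out along the half-line at positions governed by the ruler sequence.  The resulting function is
  frequently hypercyclic because everything to the right of a copy is dominated by the tail of \<open>h * \<rho>\<close>.
  Periodizing continuous functions of compact support gives density of the periodic points.
  These functions, with right shifts as \<open>S t\<close>, also satisfy the criterion: the Pettis integral is
  the pointwise integral, because \<open>\<phi> (\<integral> F) - \<integral> \<phi> F\<close> has derivative zero in the upper limit
  of integration, and bounding it uniformly gives integrability on the whole line.

  Finally, the criterion yields periodic points: glue \<open>T t x\<close> and \<open>S t x\<close> to a two-sided orbit \<open>F\<close>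
  of some \<open>x \<noteq> 0\<close> and integrate it over a periodic set of times.  If every such integral vanished, letting the
  period tend to infinity would give \<open>\<phi> x = 0\<close> for all integration functionals \<open>\<phi>\<close>.
\<close>

section \<open>Differences of sets of positive lower density\<close>

text \<open>Admissibility controls \<rho> from one side only: the weight may jump up at any time,
  but within bounded time it drops by at most a bounded factor. Hence all comparisons go from an
  earlier point to a later one, and a bound at a sparse set of points becomes a bound everywhere
  only if the next such point is never far away. This is why the implication from frequent
  hypercyclicity must produce bounded gaps: the visits of one orbit say something about \<rho> only
  at differences of visiting times. In the reverse direction, a dense family of step functions has
  unbounded heights, so a concatenation of its members need not lie in the space unless large
  heights are postponed; an integrable majorant that outgrows \<rho> by an unbounded factor says how
  far. For the criterion, integrals over compact intervals suffice as test functionals: they are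
  continuous because \<rho> is bounded below by a positive constant on compact intervals, they
  separate points, and translation only moves the interval. Hence the periodicity of an integral
  over a periodic set of times can be read off from them.\<close>

lemma sum_card_le_card_UN_plus_pairs:
  fixes S :: "nat \<Rightarrow> 'a set"
  assumes "\<And>i. finite (S i)"
  shows "(\<Sum>i<m. card (S i)) \<le> card (\<Union>i<m. S i) + (\<Sum>i<m. \<Sum>j<i. card (S i \<inter> S j))"
proof (induction m)
  case (Suc m)
  have "card (S m) + card (\<Union>i<m. S i) = card (S m \<union> (\<Union>i<m. S i)) + card (S m \<inter> (\<Union>i<m. S i))"
    using assms by (intro card_Un_Int) auto
  moreover have "card (S m \<inter> (\<Union>i<m. S i)) \<le> (\<Sum>j<m. card (S m \<inter> S j))"
  proof -
    have "S m \<inter> (\<Union>i<m. S i) = (\<Union>j<m. S m \<inter> S j)" by auto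
    then show ?thesis by (metis card_UN_le finite_lessThan)
  qed
  moreover have "S m \<union> (\<Union>i<m. S i) = (\<Union>i<Suc m. S i)" by (auto simp: lessThan_Suc)
  ultimately show ?case using Suc by simp
qed simp

text \<open>Only \<open>k\<close> is restricted to be below \<open>N\<close>; \<open>k + d\<close>
  may exceed it. Dividing by \<open>N\<close> gives the frequency with which \<open>d\<close> occurs
  as a difference in \<open>B\<close>.\<close>

definition diff_count :: "nat set \<Rightarrow> nat \<Rightarrow> nat \<Rightarrow> nat" where
  "diff_count B N d = card {k. k < N \<and> k \<in> B \<and> k + d \<in> B}"

lemma diff_count_le: "diff_count B N d \<le> N"
proof -
  have "card {k. k < N \<and> k \<in> B \<and> k + d \<in> B} \<le> card {..<N}" by (intro card_mono) auto
  then show ?thesis by (simp add: diff_count_def)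
qed

text \<open>The translates of \<open>B \<inter> {..<N}\<close> by the \<open>k i\<close> all fit
  into an interval of \<open>N + K\<close> integers, so their total size in excess of that is paid
  for by pairwise overlaps (second Bonferroni inequality). An element common to the translates by
  \<open>k i\<close> and \<open>k j\<close> exhibits \<open>k i - k j\<close> as a difference of
  elements of \<open>B\<close>.\<close>

lemma shifts_overlap_bound:
  assumes mono: "\<And>i j. j \<le> i \<Longrightarrow> i < m \<Longrightarrow> k j \<le> k i" and K: "\<And>i. i < m \<Longrightarrow> k i \<le> K"
  shows "m * card (B \<inter> {..<N}) \<le> N + K + (\<Sum>i<m. \<Sum>j<i. diff_count B N (k i - k j))"
proof -
  define S where "S i = (\<lambda>b. b + k i) ` (B \<inter> {..<N})" for i
  have cS: "card (S i) = card (B \<inter> {..<N})" for i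
    unfolding S_def by (intro card_image) (auto simp: inj_on_def)
  have int: "card (S i \<inter> S j) \<le> diff_count B N (k i - k j)" if "j < i" "i < m" for i j
  proof -
    have le: "k j \<le> k i" using mono that by simp
    have "S i \<inter> S j \<subseteq> (\<lambda>b. b + k i) ` {b. b < N \<and> b \<in> B \<and> b + (k i - k j) \<in> B}"
    proof
      fix x assume "x \<in> S i \<inter> S j"
      then obtain b b' where b: "b \<in> B" "b < N" "x = b + k i" "b' \<in> B" "x = b' + k j"
        by (auto simp: S_def)
      then have "b' = b + (k i - k j)" using le by simp
      then show "x \<in> (\<lambda>b. b + k i) ` {b. b < N \<and> b \<in> B \<and> b + (k i - k j) \<in> B}" using b by auto
    qed
    then have "card (S i \<inter> S j) \<le> card ((\<lambda>b. b + k i) ` {b. b < N \<and> b \<in> B \<and> b + (k i - k j) \<in> B})"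
      by (intro card_mono) auto
    also have "\<dots> \<le> diff_count B N (k i - k j)"
      unfolding diff_count_def by (intro card_image_le) auto
    finally show ?thesis .
  qed
  have "m * card (B \<inter> {..<N}) = (\<Sum>i<m. card (S i))" by (simp add: cS)
  also have "\<dots> \<le> card (\<Union>i<m. S i) + (\<Sum>i<m. \<Sum>j<i. card (S i \<inter> S j))"
    by (rule sum_card_le_card_UN_plus_pairs) (simp add: S_def)
  also have "card (\<Union>i<m. S i) \<le> card {..<N + K}"
    by (intro card_mono) (auto simp: S_def dest!: K)
  also have "(\<Sum>i<m. \<Sum>j<i. card (S i \<inter> S j)) \<le> (\<Sum>i<m. \<Sum>j<i. diff_count B N (k i - k j))"
    by (intro sum_mono int) auto
  finally show ?thesis by simp
qed

text \<open>With unbounded gaps one could pick m shifts whose pairwise differences are all rare,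
  each new shift being placed by means of a sufficiently long gap. The translates by them would be
  nearly disjoint, although m sets of density \<delta> with \<open>m * \<delta> > 2\<close> do not
  fit side by side into the integers.\<close>

lemma popular_differences_syndetic:
  fixes \<delta> :: real
  assumes \<delta>: "\<delta> > 0" and dens: "\<And>N. N \<ge> N0 \<Longrightarrow> \<delta> * real N \<le> real (card (B \<inter> {..<N}))"
    and \<kappa>: "strict_mono \<kappa>"
    and D: "\<And>d. (\<lambda>i. real (diff_count B (\<kappa> i) d) / real (\<kappa> i)) \<longlonglongrightarrow> D d"
  shows "\<exists>\<epsilon>>0. \<exists>G. \<forall>n. \<exists>d\<in>{n..n+G}. D d \<ge> \<epsilon>"
proof -
  obtain m where m: "real m * \<delta> > 2"
    using reals_Archimedean3[OF \<delta>] by blast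
  then have "m > 0" by (cases m) auto
  note m = m this
  \<comment> \<open>There are fewer than \<open>m\<^sup>2\<close> pairs of shifts, so their overlaps
    have density at most 1 in total, and \<open>m * \<delta> \<le> 1 + 1\<close> contradicts the
    choice of \<open>m\<close>.\<close>
  define \<epsilon> where "\<epsilon> = 1 / (real m)\<^sup>2"
  have e: "\<epsilon> > 0" using m by (simp add: \<epsilon>_def)
  have "\<exists>G. \<forall>n. \<exists>d\<in>{n..n+G}. D d \<ge> \<epsilon>"
  proof (rule ccontr)
    assume "\<not> ?thesis"
    then have gap: "\<exists>n. \<forall>d\<in>{n..n+G}. D d < \<epsilon>" for G by (force simp: not_le)
    have ex_k: "\<exists>k. \<forall>i<l. \<forall>j\<le>i. k j \<le> k i \<and> (j < i \<longrightarrow> D (k i - k j) < \<epsilon>)" for l :: nat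
    proof (induction l)
      case (Suc l)
      then obtain k :: "nat \<Rightarrow> nat" where k: "\<And>i j. i < l \<Longrightarrow> j \<le> i \<Longrightarrow> k j \<le> k i \<and> (j < i \<longrightarrow> D (k i - k j) < \<epsilon>)"
        by blast
      define g where "g = Max (insert 0 (k ` {..<l}))"
      have g: "k j \<le> g" if "j < l" for j unfolding g_def using that by (intro Max_ge) auto
      obtain n where n: "\<forall>d\<in>{n..n+g}. D d < \<epsilon>" using gap by blast
      \<comment> \<open>Every earlier \<open>k j\<close> is at most \<open>g\<close>, so the
        difference \<open>n + g - k j\<close> lies in the gap \<open>{n..n+g}\<close>.\<close>
      let ?k = "k(l := n + g)"
      have "?k j \<le> ?k i \<and> (j < i \<longrightarrow> D (?k i - ?k j) < \<epsilon>)" if "i < Suc l" "j \<le> i" for i j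
      proof (cases "i = l")
        case True
        then show ?thesis using that g[of j] by (auto intro!: n[rule_format])
      next
        case False
        then show ?thesis using that k[of i j] by auto
      qed
      then show ?case by blast
    qed auto
    obtain k where "\<forall>i<m. \<forall>j\<le>i. k j \<le> k i \<and> (j < i \<longrightarrow> D (k i - k j) < \<epsilon>)"
      using ex_k[of m] by (elim exE)
    then have k: "k j \<le> k i \<and> (j < i \<longrightarrow> D (k i - k j) < \<epsilon>)" if "i < m" "j \<le> i" for i j
      using that by simp
    define K where "K = Max (k ` {..<m})"
    have K: "k i \<le> K" if "i < m" for i unfolding K_def using that by (intro Max_ge) auto
    have bound: "real m * (\<delta> * real N) \<le> real N + real K + (\<Sum>i<m. \<Sum>j<i. real (diff_count B N (k i - k j)))"
      if "N \<ge> N0" for N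
    proof -
      have "real m * (\<delta> * real N) \<le> real m * real (card (B \<inter> {..<N}))"
        using dens[OF that] by (intro mult_left_mono) auto
      also have "\<dots> = real (m * card (B \<inter> {..<N}))" by simp
      also have "\<dots> \<le> real (N + K + (\<Sum>i<m. \<Sum>j<i. diff_count B N (k i - k j)))"
        unfolding of_nat_le_iff by (rule shifts_overlap_bound) (use k K in auto)
      finally show ?thesis by simp
    qed
    have \<kappa>_top: "filterlim \<kappa> at_top sequentially" by (rule filterlim_subseq[OF \<kappa>])
    have r_top: "filterlim (\<lambda>i. real (\<kappa> i)) at_top sequentially"
      by (rule filterlim_compose[OF filterlim_real_sequentially \<kappa>_top])
    have lim: "(\<lambda>i. 1 + real K / real (\<kappa> i) + (\<Sum>i'<m. \<Sum>j<i'. real (diff_count B (\<kappa> i) (k i' - k j)) / real (\<kappa> i)))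
        \<longlonglongrightarrow> 1 + 0 + (\<Sum>i'<m. \<Sum>j<i'. D (k i' - k j))"
      by (intro tendsto_intros D real_tendsto_divide_at_top[OF tendsto_const r_top])
    have "\<forall>\<^sub>F i in sequentially. \<kappa> i \<ge> max 1 N0"
      using \<kappa>_top unfolding filterlim_at_top by blast
    then have ev: "\<forall>\<^sub>F i in sequentially. real m * \<delta> \<le> 1 + real K / real (\<kappa> i) + (\<Sum>i'<m. \<Sum>j<i'. real (diff_count B (\<kappa> i) (k i' - k j)) / real (\<kappa> i))"
    proof eventually_elim
      case (elim i)
      have "real m * \<delta> = real m * (\<delta> * real (\<kappa> i)) / real (\<kappa> i)" using elim by simp
      also have "\<dots> \<le> (real (\<kappa> i) + real K + (\<Sum>i'<m. \<Sum>j<i'. real (diff_count B (\<kappa> i) (k i' - k j)))) / real (\<kappa> i)"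
        using elim bound[of "\<kappa> i"] by (intro divide_right_mono) auto
      also have "\<dots> = 1 + real K / real (\<kappa> i) + (\<Sum>i'<m. \<Sum>j<i'. real (diff_count B (\<kappa> i) (k i' - k j)) / real (\<kappa> i))"
        using elim by (simp add: add_divide_distrib sum_divide_distrib)
      finally show ?case .
    qed
    have "real m * \<delta> \<le> 1 + 0 + (\<Sum>i'<m. \<Sum>j<i'. D (k i' - k j))"
      by (rule tendsto_lowerbound[OF lim ev]) simp
    also have "(\<Sum>i'<m. \<Sum>j<i'. D (k i' - k j)) \<le> (\<Sum>i'<m. \<Sum>j<i'. \<epsilon>)"
      using k by (intro sum_mono) (simp add: less_imp_le)
    also have "\<dots> \<le> (\<Sum>i'<m. real m * \<epsilon>)"
      using e by (intro sum_mono) (simp add: mult_right_mono)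
    also have "\<dots> = 1" using m by (simp add: \<epsilon>_def power2_eq_square)
    finally show False using m by simp
  qed
  with e show ?thesis by blast
qed

text \<open>Double counting: the pairs \<open>(k, k + d)\<close> of elements of \<open>B\<close> are
  grouped by \<open>k\<close> instead of by \<open>d\<close>.\<close>

lemma sum_mult_diff_count_le:
  fixes r :: "nat \<Rightarrow> real"
  assumes "\<And>k. k \<in> B \<Longrightarrow> (\<Sum>d | 2 \<le> d \<and> d < L \<and> k + d \<in> B. r d) \<le> C" and "0 \<le> C"
  shows "(\<Sum>d=2..<L. r d * real (diff_count B N d)) \<le> C * real N"
proof -
  have "(\<Sum>d=2..<L. r d * real (diff_count B N d)) = (\<Sum>d=2..<L. \<Sum>k\<in>{k\<in>B \<inter> {..<N}. k + d \<in> B}. r d)"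
    by (simp add: diff_count_def conj_ac Int_def mult.commute)
  also have "\<dots> = (\<Sum>k\<in>B \<inter> {..<N}. \<Sum>d\<in>{d\<in>{2..<L}. k + d \<in> B}. r d)"
    by (rule sum.swap_restrict) auto
  also have "\<dots> \<le> (\<Sum>k\<in>B \<inter> {..<N}. C)"
    using assms(1) by (intro sum_mono) (simp add: conj_ac)
  also have "\<dots> \<le> C * real N"
  proof -
    have "card (B \<inter> {..<N}) \<le> card {..<N}" by (intro card_mono) auto
    then show ?thesis using assms(2) by (simp add: mult.commute mult_left_mono)
  qed
  finally show ?thesis .
qed

text \<open>
  Bayart and Ruzsa's idea: averaging the hypothesis over \<open>k\<close> bounds the sum of \<open>r d\<close> weighted by the
  frequency \<open>D d\<close> of the difference \<open>d\<close>; a diagonal subsequence makes all these frequencies converge.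
\<close>

lemma summable_of_bounded_difference_sums:
  fixes r :: "nat \<Rightarrow> real"
  assumes \<delta>: "\<delta> > 0" and dens: "\<And>N. N \<ge> N0 \<Longrightarrow> \<delta> * real N \<le> real (card (B \<inter> {..<N}))"
    and r0: "\<And>n. 0 \<le> r n" and r: "\<And>m. \<exists>K. \<forall>n. \<forall>i\<le>m. r n \<le> K * r (n + i)"
    and bd: "\<And>k L. k \<in> B \<Longrightarrow> (\<Sum>d | 2 \<le> d \<and> d < L \<and> k + d \<in> B. r d) \<le> C"
  shows "summable r"
proof -
  have C0: "0 \<le> max 0 C" by simp
  have bd': "(\<Sum>d | 2 \<le> d \<and> d < L \<and> k + d \<in> B. r d) \<le> max 0 C" if "k \<in> B" for k L
    using bd[OF that, of L] by simp
  have "norm (real (diff_count B N d) / real N) \<le> 1" for N d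
    using diff_count_le[of B N d] by (cases "N = 0") auto
  then obtain \<kappa> where \<kappa>: "strict_mono (\<kappa> :: nat \<Rightarrow> nat)"
    and "\<And>d. d \<in> UNIV \<Longrightarrow> \<exists>l. (\<lambda>i. real (diff_count B (\<kappa> i) d) / real (\<kappa> i)) \<longlonglongrightarrow> l"
    using function_convergent_subsequence[of UNIV "\<lambda>N d. real (diff_count B N d) / real N" 1] by blast
  then obtain D where D: "\<And>d. (\<lambda>i. real (diff_count B (\<kappa> i) d) / real (\<kappa> i)) \<longlonglongrightarrow> D d"
    by (metis UNIV_I)
  have D0: "0 \<le> D d" for d
    by (rule tendsto_lowerbound[OF D]) auto
  obtain \<epsilon> G where e: "\<epsilon> > 0" and G: "\<And>n. \<exists>d\<in>{n..n+G}. D d \<ge> \<epsilon>"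
    using popular_differences_syndetic[OF \<delta> dens \<kappa> D] by blast
  have rD: "(\<Sum>d=2..<L. r d * D d) \<le> max 0 C" for L
  proof (rule tendsto_upperbound)
    show "(\<lambda>i. \<Sum>d=2..<L. r d * (real (diff_count B (\<kappa> i) d) / real (\<kappa> i))) \<longlonglongrightarrow> (\<Sum>d=2..<L. r d * D d)"
      by (intro tendsto_intros D)
    have "(\<Sum>d=2..<L. r d * (real (diff_count B N d) / real N)) \<le> max 0 C" for N
    proof (cases "N = 0")
      case False
      have "(\<Sum>d=2..<L. r d * (real (diff_count B N d) / real N)) = (\<Sum>d=2..<L. r d * real (diff_count B N d)) / real N"
        by (simp add: sum_divide_distrib)
      also have "\<dots> \<le> max 0 C * real N / real N"
        by (intro divide_right_mono sum_mult_diff_count_le[OF bd' C0]) auto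
      finally show ?thesis using False by simp
    qed simp
    then show "\<forall>\<^sub>F i in sequentially. (\<Sum>d=2..<L. r d * (real (diff_count B (\<kappa> i) d) / real (\<kappa> i))) \<le> max 0 C"
      by simp
  qed simp
  obtain K0 where K0: "\<And>n i. i \<le> G \<Longrightarrow> r n \<le> K0 * r (n + i)" using r by blast
  \<comment> \<open>The constant is raised to at least 1, since inequalities will be multiplied by
    \<open>K / \<epsilon>\<close>.\<close>
  define K where "K = max 1 K0"
  have K_pos: "K > 0" by (simp add: K_def)
  have K: "r n \<le> K * r (n + i)" if "i \<le> G" for n i
    using K0[OF that, of n] mult_right_mono[of K0 K "r (n + i)"] r0[of "n + i"] by (simp add: K_def)
  \<comment> \<open>Some \<open>d\<close> at most \<open>G\<close> places after \<open>n\<close> is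
    a frequent difference, whence
    \<open>r n \<le> K * r d \<le> K / \<epsilon> * (r d * D d)\<close>; the sum over the window
    removes the dependence on the choice of \<open>d\<close>.\<close>
  have step: "r n \<le> K / \<epsilon> * (\<Sum>i\<le>G. r (n + i) * D (n + i))" for n
  proof -
    obtain d where d: "d \<in> {n..n+G}" "D d \<ge> \<epsilon>" using G by blast
    define i where "i = d - n"
    have i: "i \<le> G" "d = n + i" using d by (auto simp: i_def)
    have "r n \<le> K * r (n + i)" using K i by blast
    also have "\<dots> \<le> K / \<epsilon> * (r (n + i) * D (n + i))"
    proof -
      have "K * r (n + i) = K / \<epsilon> * (r (n + i) * \<epsilon>)" using e by simp
      also have "\<dots> \<le> K / \<epsilon> * (r (n + i) * D (n + i))"
        using d i e K_pos r0 by (intro mult_left_mono) auto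
      finally show ?thesis .
    qed
    also have "\<dots> \<le> K / \<epsilon> * (\<Sum>i\<le>G. r (n + i) * D (n + i))"
      using i e K_pos r0 D0 by (intro mult_left_mono member_le_sum) auto
    finally show ?thesis .
  qed
  \<comment> \<open>Each of the \<open>G + 1\<close> shifted sums is at most \<open>max 0 C\<close>.
    The index starts at 2, below which the hypothesis on differences says nothing.\<close>
  have "(\<Sum>n<L. norm (r (n + 2))) \<le> K / \<epsilon> * (real (Suc G) * max 0 C)" for L
  proof -
    have "(\<Sum>n<L. norm (r (n + 2))) \<le> (\<Sum>n<L. K / \<epsilon> * (\<Sum>i\<le>G. r (n + 2 + i) * D (n + 2 + i)))"
      by (intro sum_mono) (simp only: real_norm_def abs_of_nonneg[OF r0] step)
    also have "\<dots> = K / \<epsilon> * (\<Sum>i\<le>G. \<Sum>n<L. r (n + 2 + i) * D (n + 2 + i))"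
      by (subst sum.swap) (simp add: sum_distrib_left)
    also have "\<dots> \<le> K / \<epsilon> * (\<Sum>i\<le>G. max 0 C)"
    proof (intro mult_left_mono sum_mono)
      fix i
      have "(\<Sum>n<L. r (n + 2 + i) * D (n + 2 + i)) = (\<Sum>d\<in>(\<lambda>n. n + 2 + i) ` {..<L}. r d * D d)"
        by (subst sum.reindex) (auto simp: inj_on_def)
      also have "\<dots> \<le> (\<Sum>d=2..<L + 2 + i. r d * D d)"
        using r0 D0 by (intro sum_mono2) auto
      also have "\<dots> \<le> max 0 C" by (rule rD)
      finally show "(\<Sum>n<L. r (n + 2 + i) * D (n + 2 + i)) \<le> max 0 C" .
    qed (use e K_pos in auto)
    also have "\<dots> = K / \<epsilon> * (real (Suc G) * max 0 C)" by simp
    finally show ?thesis .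
  qed
  then have "summable (\<lambda>n. norm (r (n + 2)))"
    by (intro bounded_imp_summable[where B = "K / \<epsilon> * (real (Suc G) * max 0 C)"])
      (simp_all only: norm_ge_zero lessThan_Suc_atMost[symmetric])
  then have "summable (\<lambda>n. r (n + 2))" by (rule summable_norm_cancel)
  then show ?thesis by (simp only: summable_iff_shift)
qed

section \<open>Weights and periodic points\<close>

abbreviation half_line :: "real measure" where
  "half_line \<equiv> lebesgue_on {0..}"

text \<open>As a measurability rule, this fact would try to solve every goal by proving an arbitrary weight admissible.\<close>

declare rho_meas [measurable del]

lemma ident_measurable_lebesgue [measurable]: "(\<lambda>x::real. x) \<in> borel_measurable lebesgue"
  by (rule measurable_completion) simp

lemma ident_measurable_half_line [measurable]: "(\<lambda>x. x) \<in> borel_measurable half_line"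
  by (intro measurable_restrict_space1 ident_measurable_lebesgue)

lemma borel_imp_half_line: "u \<in> borel_measurable borel \<Longrightarrow> u \<in> borel_measurable half_line"
  by (intro measurable_restrict_space1 measurable_completion) simp

lemma floor_fun_measurable: "(\<lambda>t. h (nat \<lfloor>t\<rfloor>) :: real) \<in> borel_measurable half_line"
proof -
  have "(\<lambda>t::real. nat \<lfloor>t\<rfloor>) \<in> borel \<rightarrow>\<^sub>M count_space UNIV" by measurable
  then have "(\<lambda>t::real. h (nat \<lfloor>t\<rfloor>)) \<in> borel_measurable borel"
    by (rule measurable_compose) simp
  then show ?thesis by (rule borel_imp_half_line)
qed

section \<open>Calculus of function classes through representatives\<close>

lemma ae_eq_refl_iff: "ae_eq u u \<longleftrightarrow> u \<in> borel_measurable half_line"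
  by (auto simp: ae_eq_def)

lemma fclass_cases:
  obtains u where "u \<in> borel_measurable half_line" "x = abs_fclass u"
  using Quotient3_abs_rep[OF Quotient3_fclass, of x] Quotient3_rep_reflp[OF Quotient3_fclass, of x]
  by (metis ae_eq_refl_iff)

lemma abs_fclass_eq_iff:
  assumes "u \<in> borel_measurable half_line" "v \<in> borel_measurable half_line"
  shows "abs_fclass u = abs_fclass v \<longleftrightarrow> (AE x in half_line. u x = v x)"
  using assms Quotient3_rel[OF Quotient3_fclass, of u v] by (auto simp: ae_eq_def)

lemma Lp_integral_abs:
  "u \<in> borel_measurable half_line \<Longrightarrow>
   Lp_integral p \<rho> (abs_fclass u) = (\<integral>\<^sup>+t. ennreal (\<bar>u t\<bar> powr p * \<rho> t) \<partial>half_line)"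
  by (simp add: Lp_integral.abs_eq ae_eq_refl_iff)

lemma translation_abs:
  "u \<in> borel_measurable half_line \<Longrightarrow> 0 \<le> t \<Longrightarrow>
   translation t (abs_fclass u) = abs_fclass (\<lambda>x. u (x + t))"
  by (simp add: translation.abs_eq ae_eq_refl_iff)

lemma minus_abs:
  "u \<in> borel_measurable half_line \<Longrightarrow> v \<in> borel_measurable half_line \<Longrightarrow>
   abs_fclass u - abs_fclass v = abs_fclass (\<lambda>x. u x - v x)"
  by (simp add: minus_fclass.abs_eq ae_eq_refl_iff)

lemma plus_abs:
  "u \<in> borel_measurable half_line \<Longrightarrow> v \<in> borel_measurable half_line \<Longrightarrow>
   abs_fclass u + abs_fclass v = abs_fclass (\<lambda>x. u x + v x)"
  by (simp add: plus_fclass.abs_eq ae_eq_refl_iff)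

lemma scaleR_abs:
  "u \<in> borel_measurable half_line \<Longrightarrow> c *\<^sub>R abs_fclass u = abs_fclass (\<lambda>x. c * u x)"
  by (simp add: scaleR_fclass.abs_eq ae_eq_refl_iff)

lemma Lp_integral_diff_abs:
  assumes [measurable]: "u \<in> borel_measurable half_line" "v \<in> borel_measurable half_line"
  shows "Lp_integral p \<rho> (abs_fclass u - abs_fclass v) = (\<integral>\<^sup>+t. ennreal (\<bar>u t - v t\<bar> powr p * \<rho> t) \<partial>half_line)"
  by (simp add: minus_abs Lp_integral_abs)

lemma zero_abs: "0 = abs_fclass (\<lambda>_. 0)"
  by (simp add: zero_fclass.abs_eq)

lemma shift_measurable:
  "u \<in> borel_measurable half_line \<Longrightarrow> 0 \<le> t \<Longrightarrow> (\<lambda>x. u (x + t)) \<in> borel_measurable half_line"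
  by (rule measurable_compose[OF shift_measurable_half_line])

lemma translation_0 [simp]: "translation 0 x = x"
  by (cases x rule: fclass_cases) (simp add: translation_abs)

lemma translation_translation:
  "0 \<le> s \<Longrightarrow> 0 \<le> t \<Longrightarrow> translation s (translation t x) = translation (s + t) x"
  by (cases x rule: fclass_cases) (simp add: translation_abs shift_measurable add_ac)

lemma translation_diff: "0 \<le> t \<Longrightarrow> translation t (x - y) = translation t x - translation t y"
  by (cases x rule: fclass_cases, cases y rule: fclass_cases) (simp add: translation_abs shift_measurable minus_abs)

section \<open>Integrals over the half-line: shifting and slicing\<close>

lemma lebesgue_shift_distr: "distr lebesgue lebesgue (\<lambda>x::real. x + a) = lebesgue"
  using lebesgue_real_affine[of 1 a] by (simp add: density_1 add.commute)

text \<open>Cut off to \<open>{a..}\<close> and extended by zero, \<open>f\<close> becomes a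
  function on the whole line, where Lebesgue measure is translation invariant.\<close>

lemma nn_integral_half_line_shift:
  assumes f: "f \<in> borel_measurable half_line" and a: "0 \<le> a"
  shows "(\<integral>\<^sup>+x. f (x + a) \<partial>half_line) = (\<integral>\<^sup>+x. f x * indicator {a..} x \<partial>half_line)"
proof -
  define g where "g x = f x * indicator {a..} x" for x
  have g: "g \<in> borel_measurable lebesgue"
  proof -
    have "(\<lambda>x. f x * indicator {0..} x) \<in> borel_measurable lebesgue"
      using f by (subst (asm) borel_measurable_restrict_space_iff_ennreal) auto
    then have "(\<lambda>x. f x * indicator {0..} x * indicator {a..} x) \<in> borel_measurable lebesgue"
      by measurable
    moreover have "(\<lambda>x. f x * indicator {0..} x * indicator {a..} x) = g"
      using a by (auto simp: g_def indicator_def)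
    ultimately show ?thesis by simp
  qed
  have "(\<integral>\<^sup>+x. f (x + a) \<partial>half_line) = (\<integral>\<^sup>+x. g (x + a) \<partial>lebesgue)"
    by (subst nn_integral_restrict_space) (auto intro!: nn_integral_cong simp: g_def indicator_def)
  also have "\<dots> = (\<integral>\<^sup>+x. g x \<partial>distr lebesgue lebesgue (\<lambda>x. x + a))"
    using g by (subst nn_integral_distr) (auto intro: shift_lebesgue_measurable)
  also have "\<dots> = (\<integral>\<^sup>+x. g x \<partial>lebesgue)" by (simp add: lebesgue_shift_distr)
  also have "\<dots> = (\<integral>\<^sup>+x. f x * indicator {a..} x \<partial>half_line)"
    using a by (subst nn_integral_restrict_space) (auto intro!: nn_integral_cong simp: g_def indicator_def)
  finally show ?thesis .
qed

text \<open>The slices from \<open>n P\<close> to \<open>(n + 1) P\<close> are half-open, so that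
  each point \<open>x\<close> lies in exactly one of them, with index the floor of
  \<open>x / P\<close>. This turns integrals against \<rho> into series.\<close>

lemma nn_integral_half_line_slices:
  assumes f [measurable]: "f \<in> borel_measurable half_line" and P: "0 < P"
  shows "(\<integral>\<^sup>+x. f x \<partial>half_line) = (\<Sum>n. \<integral>\<^sup>+x. f (x + real n * P) * indicator {0..<P} x \<partial>half_line)"
proof -
  have "(\<Sum>n. f x * indicator {real n * P..<real (Suc n) * P} x) = f x" if "x \<ge> 0" for x
  proof -
    define k where "k = nat \<lfloor>x / P\<rfloor>"
    have k: "x \<in> {real n * P..<real (Suc n) * P} \<longleftrightarrow> n = k" for n
    proof -
      have "x \<in> {real n * P..<real (Suc n) * P} \<longleftrightarrow> real n \<le> x / P \<and> x / P < real n + 1"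
        using P by (auto simp: field_simps)
      also have "\<dots> \<longleftrightarrow> \<lfloor>x / P\<rfloor> = int n" by (simp add: floor_eq_iff)
      also have "\<dots> \<longleftrightarrow> n = k" using that P by (auto simp: k_def)
      finally show ?thesis .
    qed
    have "(\<lambda>n. f x * indicator {real n * P..<real (Suc n) * P} x) sums
        (f x * indicator {real k * P..<real (Suc k) * P} x)"
      using k by (intro sums_finite[of "{k}", simplified]) (simp add: indicator_def)
    then show ?thesis using k[of k] by (simp add: sums_iff indicator_def)
  qed
  then have "(\<integral>\<^sup>+x. f x \<partial>half_line) = (\<integral>\<^sup>+x. (\<Sum>n. f x * indicator {real n * P..<real (Suc n) * P} x) \<partial>half_line)"
    by (intro nn_integral_cong) simp
  also have "\<dots> = (\<Sum>n. \<integral>\<^sup>+x. f x * indicator {real n * P..<real (Suc n) * P} x \<partial>half_line)"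
    by (intro nn_integral_suminf) measurable
  also have "(\<lambda>n. \<integral>\<^sup>+x. f x * indicator {real n * P..<real (Suc n) * P} x \<partial>half_line) =
      (\<lambda>n. \<integral>\<^sup>+x. f (x + real n * P) * indicator {0..<P} x \<partial>half_line)"
  proof
    fix n
    let ?g = "\<lambda>x. f x * indicator {real n * P..<real (Suc n) * P} x"
    have "(\<integral>\<^sup>+x. f (x + real n * P) * indicator {0..<P} x \<partial>half_line) = (\<integral>\<^sup>+x. ?g (x + real n * P) \<partial>half_line)"
      by (intro nn_integral_cong) (auto simp: indicator_def algebra_simps)
    also have "\<dots> = (\<integral>\<^sup>+x. ?g x * indicator {real n * P..} x \<partial>half_line)"
      using P by (intro nn_integral_half_line_shift) simp_all
    also have "\<dots> = (\<integral>\<^sup>+x. ?g x \<partial>half_line)"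
      by (intro nn_integral_cong) (auto simp: indicator_def)
    finally show "(\<integral>\<^sup>+x. ?g x \<partial>half_line) = (\<integral>\<^sup>+x. f (x + real n * P) * indicator {0..<P} x \<partial>half_line)" ..
  qed
  finally show ?thesis .
qed

lemma nn_integral_half_line_const_Ico:
  assumes "0 \<le> a" "a \<le> b"
  shows "(\<integral>\<^sup>+x. c * indicator {a..<b} x \<partial>half_line) = c * ennreal (b - a)"
proof -
  have "emeasure half_line {a..<b} = emeasure lebesgue {a..<b}"
    using assms by (intro emeasure_restrict_space) auto
  then show ?thesis
    using assms by (subst nn_integral_cmult_indicator) (auto simp: sets_restrict_space_iff)
qed

section \<open>The weighted space: topology, one-sided comparison of weights, translations\<close>

locale weighted_Lp =
  fixes p :: real and \<rho> :: "real \<Rightarrow> real"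
  assumes p: "1 \<le> p" and \<rho>: "admissible_weight \<rho>"
begin

abbreviation X :: "fclass set" where "X \<equiv> Lp_space p \<rho>"
abbreviation N :: "fclass \<Rightarrow> real" where "N \<equiv> Lp_norm p \<rho>"
abbreviation I :: "fclass \<Rightarrow> ennreal" where "I \<equiv> Lp_integral p \<rho>"

lemmas weight_measurable [measurable] = rho_meas[OF p \<rho>]
lemmas weight_pos = rho_pos[OF p \<rho>]
lemmas weight_nonneg = less_imp_le[OF weight_pos]

sublocale Metric_space X "\<lambda>x y. N (x - y)"
  by (rule Metric_space_Lp[OF p \<rho>])

lemma subspace_X: "subspace X"
  by (rule subspace_Lp_space[OF p \<rho>])

lemmas X_diff = subspace_diff[OF subspace_X]
lemmas X_add = subspace_add[OF subspace_X]
lemmas X_scale = subspace_scale[OF subspace_X]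
lemmas X_0 [simp] = subspace_0[OF subspace_X]

lemma N_nonneg [simp]: "0 \<le> N x" by (simp add: Lp_norm_def)

lemma N_triangle: "x \<in> X \<Longrightarrow> y \<in> X \<Longrightarrow> N (x + y) \<le> N x + N y"
  using Lp_add[OF p \<rho>] by blast

lemma N_minus_commute: "N (x - y) = N (y - x)"
  by (simp add: Lp_norm_def Lp_integral_minus[OF p \<rho>, of x y])

lemma I_eq_N: "x \<in> X \<Longrightarrow> I x = ennreal (N x powr p)"
  by (rule Lp_integral_norm[OF p \<rho>])

lemma X_iff: "x \<in> X \<longleftrightarrow> I x < \<infinity>" by (simp add: Lp_space_def)

lemma N_le_iff:
  assumes "x \<in> X" "0 \<le> e" shows "N x \<le> e \<longleftrightarrow> I x \<le> ennreal (e powr p)"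
proof -
  have "N x \<le> e \<longleftrightarrow> N x powr p \<le> e powr p"
    using p assms powr_less_mono2[of p e "N x"] powr_mono2[of p "N x" e] by (auto simp: not_le[symmetric])
  then show ?thesis using assms by (simp add: I_eq_N)
qed

lemma N_less_iff:
  assumes "x \<in> X" "0 \<le> e" shows "N x < e \<longleftrightarrow> I x < ennreal (e powr p)"
proof -
  have "N x < e \<longleftrightarrow> N x powr p < e powr p"
    using p assms powr_less_mono2[of p "N x" e] powr_mono2[of p e "N x"] by (auto simp: not_le[symmetric])
  then show ?thesis using assms by (simp add: I_eq_N ennreal_less_iff)
qed

lemma openin_X_iff:
  "openin (norm_topology X N) U \<longleftrightarrow> U \<subseteq> X \<and> (\<forall>x\<in>U. \<exists>e>0. \<forall>y\<in>X. N (x - y) < e \<longrightarrow> y \<in> U)"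
proof -
  have "mball x e \<subseteq> U \<longleftrightarrow> (\<forall>y\<in>X. N (x - y) < e \<longrightarrow> y \<in> U)" if "x \<in> X" for x e
    using that by (auto simp: mball_def)
  then show ?thesis
    unfolding norm_topology_def openin_mtopology by (metis subsetD)
qed

lemma openin_ball:
  assumes "x \<in> X" shows "openin (norm_topology X N) {y\<in>X. N (x - y) < e}"
proof -
  have "{y\<in>X. N (x - y) < e} = mball x e" using assms by (auto simp: in_mball)
  then show ?thesis by (simp add: norm_topology_def)
qed

lemma dense_iff:
  "dense_in_space X N D \<longleftrightarrow> D \<subseteq> X \<and> (\<forall>x\<in>X. \<forall>e>0. \<exists>y\<in>D. N (x - y) < e)"
proof -
  have "norm_topology X N closure_of D = {x \<in> X. \<forall>e>0. \<exists>y\<in>D. y \<in> X \<and> N (x - y) < e}"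
    by (auto simp: norm_topology_def metric_closure_of mball_def)
  then show ?thesis unfolding dense_in_space_def by blast
qed

text \<open>\<open>M * exp (\<bar>\<omega>\<bar> * T)\<close> majorises all factors
  \<open>M * exp (\<omega> * t)\<close>, whatever the sign of \<omega>. Admissibility concerns
  \<open>t > 0\<close>; the case \<open>t = 0\<close> is covered because the constant is at least
  1.\<close>

lemma weight_step:
  assumes "0 \<le> T"
  obtains K where "K > 0" "\<And>\<tau> t. 0 \<le> \<tau> \<Longrightarrow> 0 \<le> t \<Longrightarrow> t \<le> T \<Longrightarrow> \<rho> \<tau> \<le> K * \<rho> (\<tau> + t)"
proof -
  obtain M \<omega> where M: "M \<ge> 1" and adm: "\<And>\<tau> t. 0 \<le> \<tau> \<Longrightarrow> 0 < t \<Longrightarrow> \<rho> \<tau> \<le> M * exp (\<omega> * t) * \<rho> (\<tau> + t)"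
    using \<rho> unfolding admissible_weight_def by blast
  define K where "K = M * exp (\<bar>\<omega>\<bar> * T)"
  have K1: "K \<ge> 1" using M assms mult_mono[of 1 M 1 "exp (\<bar>\<omega>\<bar> * T)"] by (simp add: K_def)
  show thesis
  proof (rule that)
    show "K > 0" using K1 by simp
    fix \<tau> t :: real assume t: "0 \<le> \<tau>" "0 \<le> t" "t \<le> T"
    show "\<rho> \<tau> \<le> K * \<rho> (\<tau> + t)"
    proof (cases "t = 0")
      case True
      then show ?thesis using K1 weight_pos[OF t(1)] mult_right_mono[of 1 K "\<rho> \<tau>"] by simp
    next
      case False
      have "\<omega> * t \<le> \<bar>\<omega>\<bar> * T" using t by (meson abs_ge_self abs_ge_zero mult_mono order_trans)
      then have "M * exp (\<omega> * t) * \<rho> (\<tau> + t) \<le> K * \<rho> (\<tau> + t)"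
        unfolding K_def using M t weight_pos[of "\<tau> + t"] by (intro mult_right_mono mult_left_mono) auto
      then show ?thesis using adm[of \<tau> t] t False by simp
    qed
  qed
qed

text \<open>On the slice from \<open>n P\<close> to \<open>(n + 1) P\<close> the weight lies between
  \<open>\<rho> (n P) / K\<close> and \<open>K * \<rho> ((n + 1) P)\<close>: comparison with the
  left end gives the lower bound, with the right end the upper one. The step \<open>P\<close> is
  arbitrary because it will also be the period of a periodic point.\<close>

lemma summable_weight_iff:
  assumes P: "0 < P"
  shows "summable (\<lambda>n. \<rho> (real n * P)) \<longleftrightarrow> (\<integral>\<^sup>+t. ennreal (\<rho> t) \<partial>half_line) < \<infinity>"
proof -
  obtain K where K: "K > 0" "\<And>\<tau> t. 0 \<le> \<tau> \<Longrightarrow> 0 \<le> t \<Longrightarrow> t \<le> P \<Longrightarrow> \<rho> \<tau> \<le> K * \<rho> (\<tau> + t)"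
    using weight_step[OF less_imp_le[OF P]] by blast
  define sl where "sl n = (\<integral>\<^sup>+x. ennreal (\<rho> (x + real n * P)) * indicator {0..<P} x \<partial>half_line)" for n :: nat
  have sum: "(\<integral>\<^sup>+t. ennreal (\<rho> t) \<partial>half_line) = (\<Sum>n. sl n)"
    unfolding sl_def by (rule nn_integral_half_line_slices[OF _ P]) measurable
  have upper: "sl n \<le> ennreal (K * P * \<rho> (real (Suc n) * P))" for n
  proof -
    have "sl n \<le> (\<integral>\<^sup>+x. ennreal (K * \<rho> (real (Suc n) * P)) * indicator {0..<P} x \<partial>half_line)"
      unfolding sl_def
    proof (intro nn_integral_mono)
      fix x
      show "ennreal (\<rho> (x + real n * P)) * indicator {0..<P} x \<le> ennreal (K * \<rho> (real (Suc n) * P)) * indicator {0..<P} x"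
        using K(2)[of "x + real n * P" "P - x"] P by (auto simp: indicator_def algebra_simps intro!: ennreal_leI)
    qed
    also have "\<dots> = ennreal (K * \<rho> (real (Suc n) * P)) * ennreal P"
      using P by (subst nn_integral_half_line_const_Ico) auto
    also have "\<dots> = ennreal (K * P * \<rho> (real (Suc n) * P))"
      using P by (subst ennreal_mult''[symmetric]) (auto simp: mult_ac)
    finally show ?thesis .
  qed
  have lower: "ennreal (P / K * \<rho> (real n * P)) \<le> sl n" for n
  proof -
    have "ennreal (P / K * \<rho> (real n * P)) = ennreal (\<rho> (real n * P) / K) * ennreal P"
      using P by (subst ennreal_mult''[symmetric]) (auto simp: mult_ac)
    also have "\<dots> = (\<integral>\<^sup>+x. ennreal (\<rho> (real n * P) / K) * indicator {0..<P} x \<partial>half_line)"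
      using P by (subst nn_integral_half_line_const_Ico) auto
    also have "\<dots> \<le> sl n"
      unfolding sl_def
    proof (intro nn_integral_mono)
      fix x
      show "ennreal (\<rho> (real n * P) / K) * indicator {0..<P} x \<le> ennreal (\<rho> (x + real n * P)) * indicator {0..<P} x"
        using K(2)[of "real n * P" x] K(1) P by (auto simp: indicator_def field_simps intro!: ennreal_leI)
    qed
    finally show ?thesis .
  qed
  show ?thesis
  proof
    assume "summable (\<lambda>n. \<rho> (real n * P))"
    then have "summable (\<lambda>n. \<rho> (real (Suc n) * P))"
      by (subst summable_Suc_iff[of "\<lambda>n. \<rho> (real n * P)"])
    then have s: "summable (\<lambda>n. K * P * \<rho> (real (Suc n) * P))" by (rule summable_mult)
    have "(\<Sum>n. sl n) \<le> (\<Sum>n. ennreal (K * P * \<rho> (real (Suc n) * P)))"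
      by (intro suminf_le upper) auto
    also have "\<dots> < \<infinity>"
      using s K(1) P weight_nonneg by (subst suminf_ennreal2) auto
    finally show "(\<integral>\<^sup>+t. ennreal (\<rho> t) \<partial>half_line) < \<infinity>" by (simp add: sum)
  next
    assume "(\<integral>\<^sup>+t. ennreal (\<rho> t) \<partial>half_line) < \<infinity>"
    moreover have "(\<Sum>n. ennreal (P / K * \<rho> (real n * P))) \<le> (\<Sum>n. sl n)"
      by (intro suminf_le lower) auto
    ultimately have "(\<Sum>n. ennreal (P / K * \<rho> (real n * P))) \<noteq> top"
      by (auto simp: sum top_unique)
    then have "summable (\<lambda>n. P / K * \<rho> (real n * P))"
      using K(1) P weight_nonneg by (intro summable_suminf_not_top) auto
    then show "summable (\<lambda>n. \<rho> (real n * P))" using K(1) P by (simp add: summable_cmult_iff)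
  qed
qed

text \<open>\<open>\<rho> s\<close> is replaced by \<open>K * \<rho> (s + t)\<close>, and the change
  of variables loses only the mass on \<open>[0, t)\<close>.\<close>

lemma translation_bounded:
  assumes "0 \<le> T"
  obtains C where "C > 0" "\<And>t x. 0 \<le> t \<Longrightarrow> t \<le> T \<Longrightarrow> x \<in> X \<Longrightarrow> translation t x \<in> X \<and> N (translation t x) \<le> C * N x"
proof -
  obtain K where K: "K > 0" "\<And>\<tau> t. 0 \<le> \<tau> \<Longrightarrow> 0 \<le> t \<Longrightarrow> t \<le> T \<Longrightarrow> \<rho> \<tau> \<le> K * \<rho> (\<tau> + t)"
    using weight_step[OF assms] by blast
  show thesis
  proof (rule that)
    show "K powr (1 / p) > 0" using K by simp
    fix t x assume t: "0 \<le> t" "t \<le> T" and x: "x \<in> X"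
    obtain u where u [measurable]: "u \<in> borel_measurable half_line" and xu: "x = abs_fclass u"
      by (rule fclass_cases)
    have ut [measurable]: "(\<lambda>s. u (s + t)) \<in> borel_measurable half_line" "(\<lambda>s. \<rho> (s + t)) \<in> borel_measurable half_line"
      using t by (auto intro: shift_measurable)
    have "I (translation t x) = (\<integral>\<^sup>+s. ennreal (\<bar>u (s + t)\<bar> powr p * \<rho> s) \<partial>half_line)"
      using t by (simp add: xu translation_abs Lp_integral_abs)
    also have "\<dots> \<le> (\<integral>\<^sup>+s. ennreal K * ennreal (\<bar>u (s + t)\<bar> powr p * \<rho> (s + t)) \<partial>half_line)"
    proof (intro nn_integral_mono)
      fix s assume "s \<in> space half_line"
      then have "\<bar>u (s + t)\<bar> powr p * \<rho> s \<le> \<bar>u (s + t)\<bar> powr p * (K * \<rho> (s + t))"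
        using K t by (intro mult_left_mono) auto
      then show "ennreal (\<bar>u (s + t)\<bar> powr p * \<rho> s) \<le> ennreal K * ennreal (\<bar>u (s + t)\<bar> powr p * \<rho> (s + t))"
        using K by (subst ennreal_mult'[symmetric]) (auto intro!: ennreal_leI simp: mult_ac)
    qed
    also have "\<dots> = ennreal K * (\<integral>\<^sup>+s. ennreal (\<bar>u (s + t)\<bar> powr p * \<rho> (s + t)) \<partial>half_line)"
      by (intro nn_integral_cmult) measurable
    also have "(\<integral>\<^sup>+s. ennreal (\<bar>u (s + t)\<bar> powr p * \<rho> (s + t)) \<partial>half_line) =
        (\<integral>\<^sup>+s. ennreal (\<bar>u s\<bar> powr p * \<rho> s) * indicator {t..} s \<partial>half_line)"
      using t by (intro nn_integral_half_line_shift) measurable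
    also have "\<dots> \<le> I x"
      unfolding xu Lp_integral_abs[OF u] by (intro nn_integral_mono) (auto simp: indicator_def)
    finally have le: "I (translation t x) \<le> ennreal K * I x" by (simp add: mult_left_mono)
    also have "\<dots> < \<infinity>" using x by (simp add: X_iff ennreal_mult_less_top)
    finally have tX: "translation t x \<in> X" by (simp add: X_iff)
    have "N (translation t x) \<le> K powr (1 / p) * N x"
      using le K(1) p x tX by (subst N_le_iff) (auto simp: I_eq_N powr_mult powr_powr ennreal_mult')
    with tX show "translation t x \<in> X \<and> N (translation t x) \<le> K powr (1 / p) * N x" ..
  qed
qed

lemma translation_in_X: "0 \<le> t \<Longrightarrow> x \<in> X \<Longrightarrow> translation t x \<in> X"
  using translation_bounded[of t] by (metis order_refl)

text \<open>The n-th slice of the integral repeats the values of \<open>u\<close> on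
  \<open>[0, P)\<close> against a weight of at least \<open>\<rho> (n P) / K\<close>, so the finite
  integral of \<open>x\<close> dominates \<open>J\<close> times the series of these bounds. The
  factor \<open>J\<close> is not 0, since otherwise all slices vanish and
  \<open>x = 0\<close>.\<close>

lemma nontrivial_periodic_imp_integrable_weight:
  assumes x: "x \<in> X" "x \<noteq> 0" and P: "0 < P" and per: "translation P x = x"
  shows "(\<integral>\<^sup>+t. ennreal (\<rho> t) \<partial>half_line) < \<infinity>"
proof -
  obtain u where u [measurable]: "u \<in> borel_measurable half_line" and xu: "x = abs_fclass u"
    by (rule fclass_cases)
  have per_n: "translation (real n * P) x = x" for n
  proof (induction n)
    case (Suc n)
    have "translation (real (Suc n) * P) x = translation P (translation (real n * P) x)"
      using P by (simp add: translation_translation algebra_simps)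
    then show ?case using Suc per by simp
  qed simp
  have nP: "0 \<le> real n * P" for n using P by simp
  have u_per: "AE s in half_line. u (s + real n * P) = u s" for n
    using per_n[of n] P shift_measurable[OF u nP[of n]] by (simp add: xu translation_abs abs_fclass_eq_iff u)
  have [measurable]: "(\<lambda>s. u (s + real n * P)) \<in> borel_measurable half_line"
      "(\<lambda>s. \<rho> (s + real n * P)) \<in> borel_measurable half_line" for n
    using nP by (auto intro: shift_measurable)
  define J where "J = (\<integral>\<^sup>+s. ennreal (\<bar>u s\<bar> powr p) * indicator {0..<P} s \<partial>half_line)"
  define sl where "sl n = (\<integral>\<^sup>+s. ennreal (\<bar>u (s + real n * P)\<bar> powr p * \<rho> (s + real n * P)) * indicator {0..<P} s \<partial>half_line)" for n
  have Isum: "I x = (\<Sum>n. sl n)"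
    unfolding xu Lp_integral_abs[OF u] sl_def by (rule nn_integral_half_line_slices[OF _ P]) measurable
  have sl_eq: "sl n = (\<integral>\<^sup>+s. ennreal (\<bar>u s\<bar> powr p * \<rho> (s + real n * P)) * indicator {0..<P} s \<partial>half_line)" for n
    unfolding sl_def using u_per[of n] by (intro nn_integral_cong_AE) auto
  have "J \<noteq> 0"
  proof
    assume J0: "J = 0"
    have m: "(\<lambda>s. ennreal (\<bar>u s\<bar> powr p) * indicator {0..<P} s) \<in> borel_measurable half_line"
      by measurable
    have ae: "AE s in half_line. ennreal (\<bar>u s\<bar> powr p) * indicator {0..<P} s = 0"
      using J0 nn_integral_0_iff_AE[OF m] by (simp only: J_def)
    have "sl n = 0" for n
    proof -
      have "sl n = (\<integral>\<^sup>+s. 0 \<partial>half_line)"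
        unfolding sl_eq using ae
        by (intro nn_integral_cong_AE, elim AE_mp) (auto simp: indicator_def intro!: AE_I2)
      then show ?thesis by simp
    qed
    then have "I x = 0" by (simp add: Isum)
    then show False using x Lp_integral_eq_0[OF p \<rho>, of x] by simp
  qed
  obtain K where K: "K > 0" "\<And>\<tau> t. 0 \<le> \<tau> \<Longrightarrow> 0 \<le> t \<Longrightarrow> t \<le> P \<Longrightarrow> \<rho> \<tau> \<le> K * \<rho> (\<tau> + t)"
    using weight_step[OF less_imp_le[OF P]] by blast
  have lower: "ennreal (\<rho> (real n * P) / K) * J \<le> sl n" for n
  proof -
    have "ennreal (\<rho> (real n * P) / K) * J = (\<integral>\<^sup>+s. ennreal (\<rho> (real n * P) / K) * (ennreal (\<bar>u s\<bar> powr p) * indicator {0..<P} s) \<partial>half_line)"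
      unfolding J_def by (intro nn_integral_cmult[symmetric]) measurable
    also have "\<dots> \<le> sl n"
      unfolding sl_eq
    proof (intro nn_integral_mono)
      fix s
      have "\<rho> (real n * P) / K * \<bar>u s\<bar> powr p \<le> \<bar>u s\<bar> powr p * \<rho> (s + real n * P)" if "s \<in> {0..<P}"
      proof -
        have "\<rho> (real n * P) / K \<le> \<rho> (s + real n * P)"
          using K(2)[of "real n * P" s] K(1) P that by (simp add: field_simps)
        then show ?thesis by (metis mult.commute mult_right_mono powr_ge_zero)
      qed
      moreover have "0 \<le> \<rho> (real n * P) / K" using K(1) weight_nonneg[OF nP[of n]] by simp
      ultimately show "ennreal (\<rho> (real n * P) / K) * (ennreal (\<bar>u s\<bar> powr p) * indicator {0..<P} s) \<le> ennreal (\<bar>u s\<bar> powr p * \<rho> (s + real n * P)) * indicator {0..<P} s"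
        by (auto simp: indicator_def ennreal_mult'[symmetric] intro!: ennreal_leI)
    qed
    finally show ?thesis .
  qed
  have "(\<Sum>n. ennreal (\<rho> (real n * P) / K)) * J = (\<Sum>n. ennreal (\<rho> (real n * P) / K) * J)"
    by (rule ennreal_suminf_multc[symmetric])
  also have "\<dots> \<le> I x" unfolding Isum by (intro suminf_le lower) auto
  also have "\<dots> < \<infinity>" using x by (simp add: X_iff)
  finally have "(\<Sum>n. ennreal (\<rho> (real n * P) / K)) \<noteq> top"
    using \<open>J \<noteq> 0\<close> by (auto simp: ennreal_top_mult)
  then have "summable (\<lambda>n. \<rho> (real n * P) / K)"
    using K(1) nP weight_nonneg by (intro summable_suminf_not_top) auto
  then have "summable (\<lambda>n. \<rho> (real n * P))" using K(1) by (simp add: summable_divide_iff)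
  then show ?thesis using summable_weight_iff[OF P] by simp
qed

end

section \<open>Frequent hypercyclicity forces summability\<close>

text \<open>Except for the point \<open>n\<close>, the set is covered by the unit cells that it
  meets. If it is not measurable, its \<open>measure\<close> is 0 by default.\<close>

lemma measure_le_card_unit_cells:
  "measure lebesgue (A \<inter> {0..real n}) \<le> real (card ({k. \<exists>t\<in>A. real k \<le> t \<and> t < real k + 1} \<inter> {..<n}))"
proof (cases "A \<inter> {0..real n} \<in> sets lebesgue")
  case True
  define B where "B = {k. \<exists>t\<in>A. real k \<le> t \<and> t < real k + 1} \<inter> {..<n}"
  have fin: "finite B" by (simp add: B_def)
  have sub: "A \<inter> {0..real n} \<subseteq> (\<Union>k\<in>B. {real k..real k + 1}) \<union> {real n}"
  proof
    fix t assume t: "t \<in> A \<inter> {0..real n}"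
    show "t \<in> (\<Union>k\<in>B. {real k..real k + 1}) \<union> {real n}"
    proof (cases "t = real n")
      case False
      define k where "k = nat \<lfloor>t\<rfloor>"
      have k: "real k \<le> t" "t < real k + 1" using t by (auto simp: k_def)
      then have "k < n" using t False by simp
      then have "k \<in> B" using k t by (auto simp: B_def)
      then show ?thesis using k by force
    qed simp
  qed
  have "(\<Union>k\<in>B. {real k..real k + 1}) \<in> lmeasurable"
    by (rule fmeasurable.finite_UN[OF fin]) simp
  then have fm: "(\<Union>k\<in>B. {real k..real k + 1}) \<union> {real n} \<in> lmeasurable"
    by (rule fmeasurable.Un) (auto intro!: fmeasurableI)
  have "measure lebesgue (A \<inter> {0..real n}) \<le> measure lebesgue ((\<Union>k\<in>B. {real k..real k + 1}) \<union> {real n})"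
    using True fm by (intro measure_mono_fmeasurable[OF sub])
  also have "\<dots> \<le> measure lebesgue (\<Union>k\<in>B. {real k..real k + 1}) + measure lebesgue {real n}"
    using fin by (intro measure_Un_le) auto
  also have "measure lebesgue (\<Union>k\<in>B. {real k..real k + 1}) \<le> (\<Sum>k\<in>B. measure lebesgue {real k..real k + 1})"
    using fin by (intro measure_UNION_le) auto
  also have "\<dots> = real (card B)" by simp
  finally show ?thesis by (simp add: B_def)
next
  case False
  then show ?thesis by (simp add: measure_notin_sets)
qed

lemma positive_lower_densityD:
  assumes "lower_density A > 0"
  obtains \<delta> n0 where "\<delta> > 0" "\<And>n. n \<ge> n0 \<Longrightarrow> \<delta> * real n \<le> measure lebesgue (A \<inter> {0..real n})"
proof -
  obtain e where e: "0 < e" "e < lower_density A" using dense[OF assms] by blast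
  obtain \<delta> where d: "0 < ereal \<delta>" "ereal \<delta> < e" using ereal_dense2[OF e(1)] by blast
  have "\<forall>\<^sub>F r in at_top. ereal \<delta> < ereal (measure lebesgue (A \<inter> {0..r}) / r)"
    using less_trans[OF d(2) e(2)] unfolding lower_density_def by (rule less_LiminfD)
  then obtain R where R: "\<And>r. r \<ge> R \<Longrightarrow> \<delta> < measure lebesgue (A \<inter> {0..r}) / r"
    by (auto simp: eventually_at_top_linorder)
  show thesis
  proof (rule that)
    show "\<delta> > 0" using d by simp
    fix n :: nat assume n: "Suc (nat \<lceil>R\<rceil>) \<le> n"
    then have "R \<le> real n" "real n > 0" by linarith+
    then show "\<delta> * real n \<le> measure lebesgue (A \<inter> {0..real n})"
      using R[of "real n"] by (simp add: field_simps)
  qed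
qed

context weighted_Lp
begin

text \<open>Comparison with the right end \<open>m'\<close> bounds the weight on
  \<open>[0, m')\<close> by \<open>K * \<rho> m'\<close>. This puts indicators of intervals into the
  space for every admissible weight.\<close>

lemma bounded_support_in_X:
  assumes v [measurable]: "v \<in> borel_measurable half_line" and C: "\<And>t. 0 \<le> t \<Longrightarrow> \<bar>v t\<bar> \<le> C"
    and m: "\<And>t. m \<le> t \<Longrightarrow> v t = 0"
  shows "abs_fclass v \<in> X"
proof -
  define m' where "m' = max m 1"
  have m': "m' \<ge> 0" "m' \<ge> m" by (auto simp: m'_def)
  obtain K where K: "K > 0" "\<And>\<tau> t. 0 \<le> \<tau> \<Longrightarrow> 0 \<le> t \<Longrightarrow> t \<le> m' \<Longrightarrow> \<rho> \<tau> \<le> K * \<rho> (\<tau> + t)"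
    using weight_step[OF m'(1)] by blast
  have C0: "0 \<le> C" using C[of 0] by simp
  have "I (abs_fclass v) = (\<integral>\<^sup>+t. ennreal (\<bar>v t\<bar> powr p * \<rho> t) \<partial>half_line)"
    by (rule Lp_integral_abs[OF v])
  also have "\<dots> \<le> (\<integral>\<^sup>+t. ennreal (C powr p * (K * \<rho> m')) * indicator {0..<m'} t \<partial>half_line)"
  proof (intro nn_integral_mono)
    fix t assume "t \<in> space half_line"
    then have t: "t \<ge> 0" by simp
    show "ennreal (\<bar>v t\<bar> powr p * \<rho> t) \<le> ennreal (C powr p * (K * \<rho> m')) * indicator {0..<m'} t"
    proof (cases "t < m'")
      case True
      have "\<bar>v t\<bar> powr p \<le> C powr p" using C[OF t] p by (intro powr_mono2) auto
      moreover have "\<rho> t \<le> K * \<rho> m'" using K(2)[of t "m' - t"] t True by simp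
      ultimately have "\<bar>v t\<bar> powr p * \<rho> t \<le> C powr p * (K * \<rho> m')"
        using weight_nonneg[OF t] by (intro mult_mono) auto
      then show ?thesis using True t by (simp add: ennreal_leI)
    next
      case False
      then have "v t = 0" using m' by (intro m) simp
      then show ?thesis by simp
    qed
  qed
  also have "\<dots> < \<infinity>"
    using m' by (subst nn_integral_half_line_const_Ico) (auto simp: ennreal_mult_less_top)
  finally show ?thesis by (simp add: X_iff)
qed

text \<open>A visit near the integer k is a time a in \<open>[k, k + 1)\<close>. There v is close to
  1 in mean on \<open>[a, a + 2]\<close>, which contains the cell \<open>[k + 1, k + 2)\<close>, so
  this cell carries mass at least \<open>b\<close>. The cells of the visits \<open>k + d\<close>
  with \<open>d \<ge> 2\<close> lie beyond \<open>a + 2\<close>, where the target is 0; hence their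
  mass, with weight at least \<open>\<rho> d / K\<close>, belongs to the error at time a, which is
  below \<open>c * b\<close>. Dividing by \<open>b / K\<close> gives the bound
  \<open>K * c\<close>.\<close>

lemma frequently_hypercyclic_imp_summable:
  assumes "frequently_hypercyclic X N translation"
  shows "summable (\<lambda>k::nat. \<rho> (real k))"
proof -
  obtain x where x: "x \<in> X" and fhc: "\<And>U. openin (norm_topology X N) U \<Longrightarrow> U \<noteq> {} \<Longrightarrow>
      lower_density {t. 0 \<le> t \<and> translation t x \<in> U} > 0"
    using assms unfolding frequently_hypercyclic_def by blast
  obtain v where v [measurable]: "v \<in> borel_measurable half_line" and xv: "x = abs_fclass v"
    by (rule fclass_cases)
  define w :: "real \<Rightarrow> real" where "w = indicator {0..2}"
  have w [measurable]: "w \<in> borel_measurable half_line" unfolding w_def by measurable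
  define y where "y = abs_fclass w"
  have y: "y \<in> X"
    unfolding y_def using w by (rule bounded_support_in_X[of _ 1 3]) (auto simp: w_def indicator_def)
  obtain K where K: "K > 0" "\<And>\<tau> t. 0 \<le> \<tau> \<Longrightarrow> 0 \<le> t \<Longrightarrow> t \<le> 2 \<Longrightarrow> \<rho> \<tau> \<le> K * \<rho> (\<tau> + t)"
    using weight_step[of 2] by auto
  define c where "c = \<rho> 0 / K"
  have c: "c > 0" using K weight_pos by (simp add: c_def)
  have c_le: "c \<le> \<rho> s" if "0 \<le> s" "s \<le> 2" for s
    using K(2)[of 0 s] K(1) that by (simp add: c_def field_simps)
  \<comment> \<open>At every point \<open>\<bar>v\<bar>\<close> or \<open>\<bar>1 - v\<bar>\<close>
    is at least 1/2, so over a unit cell their p-th powers together integrate to at least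
    \<open>2 * b\<close>. The choice of \<open>\<epsilon>\<close> keeps the share of
    \<open>1 - v\<close> below \<open>b\<close>, since \<rho> is at least \<open>c\<close> on
    \<open>[0, 2]\<close>.\<close>
  define b where "b = (1/2) powr p / 2"
  have b: "b > 0" by (simp add: b_def)
  define \<epsilon> where "\<epsilon> = (c * b) powr (1 / p)"
  have e: "\<epsilon> > 0" "\<epsilon> powr p = c * b" using p b c by (auto simp: \<epsilon>_def powr_powr)
  define U where "U = {z\<in>X. N (y - z) < \<epsilon>}"
  define A where "A = {t. 0 \<le> t \<and> translation t x \<in> U}"
  define B where "B = {k. \<exists>t\<in>A. real k \<le> t \<and> t < real k + 1}"
  have "y \<in> U" using y e by (simp add: U_def Lp_norm_eq_0[OF p \<rho> X_0, simplified])
  then have "lower_density A > 0"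
    unfolding A_def by (intro fhc) (auto simp: U_def intro!: openin_ball y)
  then obtain \<delta> n0 where \<delta>: "\<delta> > 0" and "\<And>n. n \<ge> n0 \<Longrightarrow> \<delta> * real n \<le> measure lebesgue (A \<inter> {0..real n})"
    by (rule positive_lower_densityD) blast
  then have dens: "\<delta> * real n \<le> real (card (B \<inter> {..<n}))" if "n \<ge> n0" for n
    using measure_le_card_unit_cells[of A n] that unfolding B_def by fastforce
  let ?cell = "\<lambda>j::nat. {real j + 1..<real j + 2}"
  define E where "E j = (\<integral>\<^sup>+s. ennreal (\<bar>v s\<bar> powr p) * indicator (?cell j) s \<partial>half_line)" for j
  have close: "\<exists>a. real k \<le> a \<and> a < real k + 1 \<and>
      (\<integral>\<^sup>+s. ennreal (\<bar>w s - v (s + a)\<bar> powr p * \<rho> s) \<partial>half_line) < ennreal (c * b)" if kB: "k \<in> B" for k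
  proof -
    obtain a where a: "a \<in> A" "real k \<le> a" "a < real k + 1" using kB by (auto simp: B_def)
    then have a0: "0 \<le> a" and aU: "translation a x \<in> U" by (auto simp: A_def)
    have "I (y - translation a x) < ennreal (\<epsilon> powr p)"
      using aU y e X_diff by (subst N_less_iff[symmetric]) (auto simp: U_def)
    also have "I (y - translation a x) = (\<integral>\<^sup>+s. ennreal (\<bar>w s - v (s + a)\<bar> powr p * \<rho> s) \<partial>half_line)"
      using a0 by (simp add: y_def xv translation_abs shift_measurable Lp_integral_diff_abs)
    finally show ?thesis using a e by auto
  qed
  have shifted_cell: "(\<integral>\<^sup>+s. f (s + a) * indicator (?cell j) (s + a) \<partial>half_line) =
      (\<integral>\<^sup>+s. f s * indicator (?cell j) s \<partial>half_line)"
    if f [measurable]: "f \<in> borel_measurable half_line" and a: "0 \<le> a" "a < real j + 1" for f :: "real \<Rightarrow> ennreal" and a j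
  proof -
    let ?g = "\<lambda>s. f s * indicator (?cell j) s"
    have "(\<integral>\<^sup>+s. ?g (s + a) \<partial>half_line) = (\<integral>\<^sup>+s. ?g s * indicator {a..} s \<partial>half_line)"
      using a by (intro nn_integral_half_line_shift) simp_all
    also have "\<dots> = (\<integral>\<^sup>+s. ?g s \<partial>half_line)"
      using a by (intro nn_integral_cong) (auto simp: indicator_def)
    finally show ?thesis .
  qed
  have E_lower: "ennreal b \<le> E k" if k: "k \<in> B" for k
  proof -
    obtain a where a: "real k \<le> a" "a < real k + 1"
      and I: "(\<integral>\<^sup>+s. ennreal (\<bar>w s - v (s + a)\<bar> powr p * \<rho> s) \<partial>half_line) < ennreal (c * b)"
      using close[OF k] by blast
    have a0: "0 \<le> a" using a by linarith
    define Q where "Q = (\<integral>\<^sup>+s. ennreal (\<bar>1 - v s\<bar> powr p) * indicator (?cell k) s \<partial>half_line)"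
    have "ennreal c * Q = ennreal c * (\<integral>\<^sup>+s. ennreal (\<bar>1 - v (s + a)\<bar> powr p) * indicator (?cell k) (s + a) \<partial>half_line)"
      unfolding Q_def using a a0 by (subst shifted_cell[of "\<lambda>s. ennreal (\<bar>1 - v s\<bar> powr p)"]) simp_all
    also have "\<dots> = (\<integral>\<^sup>+s. ennreal c * (ennreal (\<bar>1 - v (s + a)\<bar> powr p) * indicator (?cell k) (s + a)) \<partial>half_line)"
    proof (rule nn_integral_cmult[symmetric])
      have [measurable]: "(\<lambda>s. v (s + a)) \<in> borel_measurable half_line" using a0 by (intro shift_measurable) simp_all
      show "(\<lambda>s. ennreal (\<bar>1 - v (s + a)\<bar> powr p) * indicator (?cell k) (s + a)) \<in> borel_measurable half_line"
        by measurable
    qed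
    also have "\<dots> \<le> (\<integral>\<^sup>+s. ennreal (\<bar>w s - v (s + a)\<bar> powr p * \<rho> s) \<partial>half_line)"
    proof (intro nn_integral_mono)
      fix s assume "s \<in> space half_line"
      then have s: "0 \<le> s" by simp
      show "ennreal c * (ennreal (\<bar>1 - v (s + a)\<bar> powr p) * indicator (?cell k) (s + a))
          \<le> ennreal (\<bar>w s - v (s + a)\<bar> powr p * \<rho> s)"
      proof (cases "s + a \<in> ?cell k")
        case True
        then have s2: "s \<le> 2" using a by simp
        then have "w s = 1" using s by (simp add: w_def)
        moreover have "c * \<bar>1 - v (s + a)\<bar> powr p \<le> \<rho> s * \<bar>1 - v (s + a)\<bar> powr p"
          using c_le[OF s s2] by (intro mult_right_mono) auto
        ultimately show ?thesis
          using True c by (simp add: ennreal_mult'[symmetric] mult.commute ennreal_leI)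
      qed simp
    qed
    also have "\<dots> < ennreal (c * b)" by (rule I)
    also have "\<dots> = ennreal c * ennreal b" using c by (simp add: ennreal_mult')
    finally have Q: "Q < ennreal b"
      by (metis mult_left_mono not_le zero_le)
    have "ennreal (2 * b) = (\<integral>\<^sup>+s. ennreal (2 * b) * indicator (?cell k) s \<partial>half_line)"
      by (subst nn_integral_half_line_const_Ico) auto
    also have "\<dots> \<le> (\<integral>\<^sup>+s. ennreal (\<bar>v s\<bar> powr p) * indicator (?cell k) s +
        ennreal (\<bar>1 - v s\<bar> powr p) * indicator (?cell k) s \<partial>half_line)"
    proof (intro nn_integral_mono)
      fix s
      have "(1/2) powr p \<le> \<bar>v s\<bar> powr p \<or> (1/2) powr p \<le> \<bar>1 - v s\<bar> powr p"
      proof (cases "\<bar>v s\<bar> \<ge> 1/2")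
        case True
        then show ?thesis using p by (intro disjI1 powr_mono2) auto
      next
        case False
        then show ?thesis using p by (intro disjI2 powr_mono2) auto
      qed
      then have "2 * b \<le> \<bar>v s\<bar> powr p + \<bar>1 - v s\<bar> powr p"
        unfolding b_def by (auto intro: add_increasing add_increasing2)
      then show "ennreal (2 * b) * indicator (?cell k) s \<le> ennreal (\<bar>v s\<bar> powr p) * indicator (?cell k) s +
        ennreal (\<bar>1 - v s\<bar> powr p) * indicator (?cell k) s"
        by (auto simp: indicator_def ennreal_plus[symmetric] simp del: ennreal_plus intro!: ennreal_leI)
    qed
    also have "\<dots> = E k + Q"
      unfolding E_def Q_def by (rule nn_integral_add) measurable
    finally have "ennreal (2 * b) \<le> E k + Q" .
    show ?thesis
    proof (rule ccontr)
      assume "\<not> ?thesis"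
      then have "E k < ennreal b" by simp
      then obtain e' q where "E k = ennreal e'" "0 \<le> e'" "e' < b" "Q = ennreal q" "0 \<le> q" "q < b"
        using Q by (cases "E k"; cases Q) (auto simp: ennreal_less_iff)
      then show False using \<open>ennreal (2 * b) \<le> E k + Q\<close>
        by (simp add: ennreal_plus[symmetric] del: ennreal_plus)
    qed
  qed
  have bd: "(\<Sum>d | 2 \<le> d \<and> d < L \<and> k + d \<in> B. \<rho> (real d)) \<le> K * c" if k: "k \<in> B" for k L
  proof -
    obtain a where a: "real k \<le> a" "a < real k + 1"
      and I: "(\<integral>\<^sup>+s. ennreal (\<bar>w s - v (s + a)\<bar> powr p * \<rho> s) \<partial>half_line) < ennreal (c * b)"
      using close[OF k] by blast
    have a0: "0 \<le> a" using a by linarith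
    have [measurable]: "(\<lambda>s. v (s + a)) \<in> borel_measurable half_line" using a0 by (intro shift_measurable) simp_all
    define D where "D = {d. 2 \<le> d \<and> d < L \<and> k + d \<in> B}"
    have fin: "finite D" by (rule finite_subset[of _ "{..<L}"]) (auto simp: D_def)
    define J where "J d = {real (k + d) + 1..<real (k + d) + 2}" for d
    \<comment> \<open>Disjointness of the cells lets the contributions of all \<open>d\<close> be
      added under a single error integral.\<close>
    have disj: "disjoint_family_on J D"
    proof (unfold disjoint_family_on_def, intro ballI impI)
      fix d d' :: nat assume "d \<noteq> d'"
      then show "J d \<inter> J d' = {}" by (cases "d < d'") (auto simp: J_def)
    qed
    have "ennreal (\<Sum>d\<in>D. \<rho> (real d) / K * b) = (\<Sum>d\<in>D. ennreal (\<rho> (real d) / K) * ennreal b)"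
    proof -
      have nn: "0 \<le> \<rho> (real d) / K" for d using K(1) weight_nonneg[of "real d"] by simp
      have "(\<Sum>d\<in>D. ennreal (\<rho> (real d) / K) * ennreal b) = (\<Sum>d\<in>D. ennreal (\<rho> (real d) / K * b))"
        by (intro sum.cong refl ennreal_mult[symmetric] nn less_imp_le[OF b])
      also have "\<dots> = ennreal (\<Sum>d\<in>D. \<rho> (real d) / K * b)"
        by (rule sum_ennreal) (rule mult_nonneg_nonneg[OF nn less_imp_le[OF b]])
      finally show ?thesis ..
    qed
    also have "\<dots> \<le> (\<Sum>d\<in>D. ennreal (\<rho> (real d) / K) * E (k + d))"
      by (intro sum_mono mult_left_mono E_lower) (auto simp: D_def)
    also have "\<dots> = (\<Sum>d\<in>D. ennreal (\<rho> (real d) / K) * (\<integral>\<^sup>+s. ennreal (\<bar>v (s + a)\<bar> powr p) * indicator (J d) (s + a) \<partial>half_line))"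
      unfolding E_def J_def using a a0
      by (intro sum.cong refl) (subst shifted_cell[of "\<lambda>s. ennreal (\<bar>v s\<bar> powr p)"], simp_all)
    also have "\<dots> = (\<Sum>d\<in>D. \<integral>\<^sup>+s. ennreal (\<rho> (real d) / K) * (ennreal (\<bar>v (s + a)\<bar> powr p) * indicator (J d) (s + a)) \<partial>half_line)"
      unfolding J_def by (intro sum.cong refl nn_integral_cmult[symmetric]) measurable
    also have "\<dots> = (\<integral>\<^sup>+s. (\<Sum>d\<in>D. ennreal (\<rho> (real d) / K) * (ennreal (\<bar>v (s + a)\<bar> powr p) * indicator (J d) (s + a))) \<partial>half_line)"
      unfolding J_def by (intro nn_integral_sum[symmetric]) measurable
    also have "\<dots> \<le> (\<integral>\<^sup>+s. ennreal (\<bar>w s - v (s + a)\<bar> powr p * \<rho> s) \<partial>half_line)"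
    proof (intro nn_integral_mono)
      fix s
      let ?f = "ennreal (\<bar>w s - v (s + a)\<bar> powr p * \<rho> s)"
      have "(\<Sum>d\<in>D. ennreal (\<rho> (real d) / K) * (ennreal (\<bar>v (s + a)\<bar> powr p) * indicator (J d) (s + a)))
          \<le> (\<Sum>d\<in>D. ?f * indicator (J d) (s + a))"
      proof (intro sum_mono)
        fix d assume d: "d \<in> D"
        show "ennreal (\<rho> (real d) / K) * (ennreal (\<bar>v (s + a)\<bar> powr p) * indicator (J d) (s + a)) \<le> ?f * indicator (J d) (s + a)"
        proof (cases "s + a \<in> J d")
          case True
          then have s: "real d < s" "s \<le> real d + 2" using a by (auto simp: J_def)
          then have "w s = 0" using d by (simp add: w_def D_def)
          moreover have "\<rho> (real d) / K \<le> \<rho> s"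
            using K(2)[of "real d" "s - real d"] K(1) s by (simp add: field_simps)
          then have "\<rho> (real d) / K * \<bar>v (s + a)\<bar> powr p \<le> \<rho> s * \<bar>v (s + a)\<bar> powr p"
            by (intro mult_right_mono) auto
          ultimately show ?thesis
            using True K(1) weight_nonneg[of "real d"] by (simp add: ennreal_mult'[symmetric] mult.commute ennreal_leI)
        qed simp
      qed
      also have "\<dots> = ?f * (\<Sum>d\<in>D. indicator (J d) (s + a))" by (simp add: sum_distrib_left)
      also have "(\<Sum>d\<in>D. indicator (J d) (s + a)) = (indicator (\<Union>d\<in>D. J d) (s + a) :: ennreal)"
        by (rule indicator_UN_disjoint[OF fin disj, symmetric])
      also have "?f * \<dots> \<le> ?f" by (simp add: indicator_def)
      finally show "(\<Sum>d\<in>D. ennreal (\<rho> (real d) / K) * (ennreal (\<bar>v (s + a)\<bar> powr p) * indicator (J d) (s + a))) \<le> ?f" .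
    qed
    also have "\<dots> \<le> ennreal (c * b)" using I by simp
    finally have "(\<Sum>d\<in>D. \<rho> (real d) / K * b) \<le> c * b" using b c by simp
    also have "(\<Sum>d\<in>D. \<rho> (real d) / K * b) = (\<Sum>d\<in>D. \<rho> (real d)) / K * b"
      by (simp add: sum_divide_distrib sum_distrib_right)
    finally have "(\<Sum>d\<in>D. \<rho> (real d)) \<le> K * c" using b K(1) by (simp add: field_simps)
    then show ?thesis by (simp add: D_def)
  qed
  show ?thesis
  proof (rule summable_of_bounded_difference_sums[OF \<delta> dens _ _ bd])
    show "0 \<le> \<rho> (real n)" for n by (simp add: weight_nonneg)
    show "\<exists>K. \<forall>n. \<forall>i\<le>m. \<rho> (real n) \<le> K * \<rho> (real (n + i))" for m
      using weight_step[of "real m"] by (metis of_nat_0_le_iff of_nat_add of_nat_le_iff)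
  qed
qed

end

section \<open>Dense classes and strong continuity\<close>

text \<open>Functions on the whole line that vanish also for t \<le> 0, so that right shifts,
  extended by zero, are again continuous; the maps \<open>S t\<close> of the criterion will preserve
  this class.\<close>

definition test_functions :: "(real \<Rightarrow> real) set" where
  "test_functions = {f. continuous_on UNIV f \<and> (\<exists>m. \<forall>t. t \<le> 0 \<or> m \<le> t \<longrightarrow> f t = 0)}"

lemma test_functionsE:
  assumes "f \<in> test_functions"
  obtains m C where "m > 0" "\<And>t. t \<le> 0 \<Longrightarrow> f t = 0" "\<And>t. m \<le> t \<Longrightarrow> f t = 0"
    "C > 0" "\<And>t. \<bar>f t\<bar> \<le> C"
proof -
  obtain m0 where f: "continuous_on UNIV f" and m0: "\<And>t. t \<le> 0 \<or> m0 \<le> t \<Longrightarrow> f t = 0"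
    using assms by (auto simp: test_functions_def)
  define m where "m = max m0 1"
  have "compact (f ` {0..m})"
    using f by (intro compact_continuous_image compact_Icc) (auto intro: continuous_on_subset)
  then have "bounded (f ` {0..m})" by (rule compact_imp_bounded)
  then obtain C where "\<forall>y\<in>f ` {0..m}. norm y \<le> C" unfolding bounded_iff by blast
  then have C: "\<bar>f t\<bar> \<le> C" if "t \<in> {0..m}" for t using that by auto
  have C': "\<bar>f t\<bar> \<le> max C 1" for t
  proof (cases "t \<in> {0..m}")
    case True
    then show ?thesis using C[OF True] by simp
  next
    case False
    then have "f t = 0" by (intro m0) (auto simp: m_def)
    then show ?thesis by simp
  qed
  show thesis
    by (rule that[of m "max C 1"]) (use m0 C' in \<open>auto simp: m_def\<close>)
qed

text \<open>Uniform continuity on a compact interval with margin 1 suffices: two points at distance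
  less than 1 that are not both in it lie on the same side of the support.\<close>

lemma test_functions_uniformly_continuous:
  assumes "f \<in> test_functions" "0 < e"
  obtains d where "d > 0" "\<And>s t. \<bar>s - t\<bar> < d \<Longrightarrow> \<bar>f s - f t\<bar> < e"
proof -
  obtain m C where m: "m > 0" "\<And>t. t \<le> 0 \<Longrightarrow> f t = 0" "\<And>t. m \<le> t \<Longrightarrow> f t = 0"
    using test_functionsE[OF assms(1)] by metis
  have "uniformly_continuous_on {-1..m+1} f"
    using assms(1) by (intro compact_uniformly_continuous) (auto simp: test_functions_def intro: continuous_on_subset)
  then obtain d where d: "d > 0" "\<And>s t. s \<in> {-1..m+1} \<Longrightarrow> t \<in> {-1..m+1} \<Longrightarrow> \<bar>s - t\<bar> < d \<Longrightarrow> \<bar>f s - f t\<bar> < e"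
    using assms(2) unfolding uniformly_continuous_on_def dist_real_def by (metis abs_minus_commute)
  show thesis
  proof (rule that[of "min d 1"])
    fix s t :: real assume st: "\<bar>s - t\<bar> < min d 1"
    show "\<bar>f s - f t\<bar> < e"
    proof (cases "s \<in> {-1..m+1} \<and> t \<in> {-1..m+1}")
      case True
      then show ?thesis using d(2) st by simp
    next
      case False
      then have "s \<le> 0 \<and> t \<le> 0 \<or> m \<le> s \<and> m \<le> t" using st by auto
      then have "f s = 0 \<and> f t = 0" using m by blast
      then show ?thesis using assms(2) by simp
    qed
  qed (use d in auto)
qed

lemma test_functions_measurable: "f \<in> test_functions \<Longrightarrow> f \<in> borel_measurable borel"
  by (rule borel_measurable_continuous_onI) (simp add: test_functions_def)

lemma test_functions_measurable_half_line: "f \<in> test_functions \<Longrightarrow> f \<in> borel_measurable half_line"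
  by (intro borel_imp_half_line test_functions_measurable)

text \<open>Mesh \<open>1 / fst q\<close> and rational heights \<open>snd q\<close>: the type of
  \<open>q\<close> is countable, so one sequence enumerates all these functions. For
  \<open>fst q = 0\<close> the index is always 0 and the support may be unbounded, whence the
  condition \<open>fst q > 0\<close> below.\<close>

definition step_fun :: "nat \<times> rat list \<Rightarrow> real \<Rightarrow> real" where
  "step_fun q t = (let i = nat \<lfloor>t * real (fst q)\<rfloor> in
     if 0 \<le> t \<and> i < length (snd q) then real_of_rat (snd q ! i) else 0)"

lemma step_fun_measurable [measurable]: "step_fun q \<in> borel_measurable borel"
proof -
  define h where "h i = (if i < length (snd q) then real_of_rat (snd q ! i) else 0)" for i
  have [measurable]: "(\<lambda>t::real. nat \<lfloor>t * real (fst q)\<rfloor>) \<in> borel \<rightarrow>\<^sub>M count_space UNIV"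
    by measurable
  have "(\<lambda>t. h (nat \<lfloor>t * real (fst q)\<rfloor>)) \<in> borel_measurable borel"
    by (rule measurable_compose[of _ _ "count_space UNIV"]) simp_all
  then have "(\<lambda>t. indicator {0..} t * h (nat \<lfloor>t * real (fst q)\<rfloor>)) \<in> borel_measurable borel"
    by (intro borel_measurable_times borel_measurable_indicator) simp_all
  moreover have "step_fun q = (\<lambda>t. indicator {0..} t * h (nat \<lfloor>t * real (fst q)\<rfloor>))"
    by (auto simp: step_fun_def h_def Let_def fun_eq_iff indicator_def)
  ultimately show ?thesis by simp
qed

lemma step_fun_measurable_half_line: "step_fun q \<in> borel_measurable half_line"
  by (rule borel_imp_half_line) simp

lemma step_fun_bounded: "\<exists>C. \<forall>t. \<bar>step_fun q t\<bar> \<le> C"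
proof -
  define C where "C = Max (insert 0 ((\<lambda>i. \<bar>real_of_rat (snd q ! i)\<bar>) ` {..<length (snd q)}))"
  have "\<bar>step_fun q t\<bar> \<le> C" for t
    unfolding C_def step_fun_def Let_def by (intro Max_ge) auto
  then show ?thesis by blast
qed

text \<open>The mesh is at most 1, so the number of heights bounds the support; this is crude, but
  easily compared with a level.\<close>

lemma step_fun_support:
  assumes "fst q > 0" "real (length (snd q)) \<le> t" shows "step_fun q t = 0"
proof -
  have "t * 1 \<le> t * real (fst q)" using assms by (intro mult_left_mono) auto
  then have "real (length (snd q)) \<le> t * real (fst q)" using assms by linarith
  then show ?thesis by (simp add: step_fun_def Let_def) linarith
qed

lemma approximate_test_function_by_step:
  assumes f: "f \<in> test_functions" and e: "0 < e"
  obtains q where "fst q > 0" "\<And>t. 0 \<le> t \<Longrightarrow> \<bar>f t - step_fun q t\<bar> \<le> e"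
proof -
  obtain m where m: "m > 0" "\<And>t. m \<le> t \<Longrightarrow> f t = 0"
    using test_functionsE[OF f] by metis
  obtain d where d: "d > 0" "\<And>s t. \<bar>s - t\<bar> < d \<Longrightarrow> \<bar>f s - f t\<bar> < e / 2"
    using test_functions_uniformly_continuous[OF f, of "e / 2"] e by auto
  obtain n :: nat where n: "n > 0" "1 / real n < d"
    using d(1) by (metis nat_approx_posE of_nat_0_less_iff zero_less_Suc)
  \<comment> \<open>The \<open>L\<close> cells of length \<open>1 / n\<close> cover
    \<open>[0, m)\<close>; further out both functions vanish.\<close>
  define L where "L = nat \<lceil>m * real n\<rceil>"
  have "\<exists>r. \<bar>f (real i / real n) - real_of_rat r\<bar> < e / 2" for i :: nat
  proof -
    obtain r where "f (real i / real n) - e / 2 < of_rat r" "of_rat r < f (real i / real n) + e / 2"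
      using of_rat_dense[of "f (real i / real n) - e / 2" "f (real i / real n) + e / 2"] e by auto
    then show ?thesis by (intro exI[of _ r]) linarith
  qed
  then obtain r where r: "\<And>i. \<bar>f (real i / real n) - real_of_rat (r i)\<bar> < e / 2" by metis
  define q where "q = (n, map r [0..<L])"
  show thesis
  proof (rule that)
    show "fst q > 0" using n by (simp add: q_def)
    fix t :: real assume t: "0 \<le> t"
    define i where "i = nat \<lfloor>t * real n\<rfloor>"
    have i: "real i \<le> t * real n" "t * real n < real i + 1" using t by (auto simp: i_def)
    show "\<bar>f t - step_fun q t\<bar> \<le> e"
    proof (cases "i < L")
      case True
      have st: "step_fun q t = of_rat (r i)" using True t by (simp add: step_fun_def q_def i_def Let_def)
      have "\<bar>t - real i / real n\<bar> \<le> 1 / real n"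
      proof -
        have "\<bar>t - real i / real n\<bar> = \<bar>t * real n - real i\<bar> / real n"
          using n(1) by (subst abs_div_pos) (simp_all add: field_simps)
        also have "\<dots> \<le> 1 / real n" using i by (intro divide_right_mono) auto
        finally show ?thesis .
      qed
      then have "\<bar>f t - f (real i / real n)\<bar> < e / 2" using n by (intro d(2)) simp
      then show ?thesis using r[of i] st by linarith
    next
      case False
      then have "m * real n \<le> real i" by (simp add: L_def) linarith
      then have "m * real n \<le> t * real n" using i by linarith
      then have "m \<le> t" using n by simp
      then show ?thesis using m(2) False e by (simp add: step_fun_def q_def i_def Let_def)
    qed
  qed
qed

section \<open>Density and strong continuity for an integrable weight\<close>

locale finite_weight_Lp = weighted_Lp +
  assumes finite_weight: "(\<integral>\<^sup>+t. ennreal (\<rho> t) \<partial>half_line) < \<infinity>"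
begin

text \<open>The norm of the constant function 1, the factor by which uniform estimates become norm
  estimates.\<close>

definition W :: real where "W = enn2real (\<integral>\<^sup>+t. ennreal (\<rho> t) \<partial>half_line) powr (1 / p)"

lemma W_nonneg: "0 \<le> W" by (simp add: W_def)

lemma W_powr: "ennreal (W powr p) = (\<integral>\<^sup>+t. ennreal (\<rho> t) \<partial>half_line)"
  using p finite_weight by (simp add: W_def powr_powr)

lemma bounded_in_X:
  assumes v [measurable]: "v \<in> borel_measurable half_line" and C: "\<And>t. 0 \<le> t \<Longrightarrow> \<bar>v t\<bar> \<le> C"
  shows "abs_fclass v \<in> X" and "N (abs_fclass v) \<le> C * W"
proof -
  have C0: "0 \<le> C" using C[of 0] by simp
  have "I (abs_fclass v) = (\<integral>\<^sup>+t. ennreal (\<bar>v t\<bar> powr p * \<rho> t) \<partial>half_line)"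
    by (rule Lp_integral_abs[OF v])
  also have "\<dots> \<le> (\<integral>\<^sup>+t. ennreal (C powr p) * ennreal (\<rho> t) \<partial>half_line)"
  proof (intro nn_integral_mono)
    fix t assume "t \<in> space half_line"
    then have t: "t \<ge> 0" by simp
    have "\<bar>v t\<bar> powr p * \<rho> t \<le> C powr p * \<rho> t"
      using C[OF t] p weight_nonneg[OF t] by (intro mult_right_mono powr_mono2) auto
    then show "ennreal (\<bar>v t\<bar> powr p * \<rho> t) \<le> ennreal (C powr p) * ennreal (\<rho> t)"
      by (simp add: ennreal_mult'[symmetric] ennreal_leI)
  qed
  also have "\<dots> = ennreal (C powr p) * ennreal (W powr p)"
    by (subst nn_integral_cmult) (simp_all add: W_powr)
  also have "\<dots> = ennreal ((C * W) powr p)"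
    using C0 W_nonneg by (simp add: powr_mult ennreal_mult')
  finally have le: "I (abs_fclass v) \<le> ennreal ((C * W) powr p)" .
  then show "abs_fclass v \<in> X" using le_less_trans by (fastforce simp: X_iff)
  then show "N (abs_fclass v) \<le> C * W" using le C0 W_nonneg by (subst N_le_iff) auto
qed

lemma dominated_convergence_X:
  assumes u: "\<And>n. u n \<in> borel_measurable half_line" and v: "v \<in> borel_measurable half_line"
    and g [measurable]: "g \<in> borel_measurable half_line"
    and X: "\<And>n. abs_fclass (u n) \<in> X" "abs_fclass v \<in> X"
    and lim: "AE t in half_line. (\<lambda>n. u n t) \<longlonglongrightarrow> v t"
    and dom: "\<And>n t. 0 \<le> t \<Longrightarrow> \<bar>u n t - v t\<bar> \<le> g t"
    and g_int: "(\<integral>\<^sup>+t. ennreal (g t powr p * \<rho> t) \<partial>half_line) < \<infinity>"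
    and e: "0 < e"
  shows "\<forall>\<^sub>F n in sequentially. N (abs_fclass (u n) - abs_fclass v) < e"
proof -
  note [measurable] = u v
  have "(\<lambda>n. \<integral>\<^sup>+t. ennreal (\<bar>u n t - v t\<bar> powr p * \<rho> t) \<partial>half_line) \<longlonglongrightarrow> (\<integral>\<^sup>+t. 0 \<partial>half_line)"
  proof (rule nn_integral_dominated_convergence[where w = "\<lambda>t. ennreal (g t powr p * \<rho> t)"])
    show "AE t in half_line. ennreal (\<bar>u n t - v t\<bar> powr p * \<rho> t) \<le> ennreal (g t powr p * \<rho> t)" for n
    proof (rule AE_I2)
      fix t assume "t \<in> space half_line"
      then have t: "t \<ge> 0" by simp
      then show "ennreal (\<bar>u n t - v t\<bar> powr p * \<rho> t) \<le> ennreal (g t powr p * \<rho> t)"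
        using dom[OF t] p weight_nonneg[OF t] by (intro ennreal_leI mult_right_mono powr_mono2) auto
    qed
    show "AE t in half_line. (\<lambda>n. ennreal (\<bar>u n t - v t\<bar> powr p * \<rho> t)) \<longlonglongrightarrow> 0"
      using lim
    proof eventually_elim
      case (elim t)
      then have "(\<lambda>n. \<bar>u n t - v t\<bar>) \<longlonglongrightarrow> 0"
        by (simp add: LIM_zero tendsto_rabs_zero)
      then have "(\<lambda>n. \<bar>u n t - v t\<bar> powr p * \<rho> t) \<longlonglongrightarrow> 0 powr p * \<rho> t"
        using p by (intro tendsto_mult tendsto_powr' tendsto_const) auto
      then show ?case using tendsto_ennrealI by fastforce
    qed
  qed (use g_int in measurable)
  then have "(\<lambda>n. I (abs_fclass (u n) - abs_fclass v)) \<longlonglongrightarrow> 0"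
    by (simp add: Lp_integral_diff_abs u v)
  then have "\<forall>\<^sub>F n in sequentially. I (abs_fclass (u n) - abs_fclass v) < ennreal (e powr p)"
    using e by (intro order_tendstoD(2)) auto
  then show ?thesis
    using X X_diff e by (subst N_less_iff) auto
qed

lemma const_integrable: "(\<integral>\<^sup>+t. ennreal (C powr p * \<rho> t) \<partial>half_line) < \<infinity>"
proof -
  have "(\<integral>\<^sup>+t. ennreal (C powr p * \<rho> t) \<partial>half_line) = (\<integral>\<^sup>+t. ennreal (C powr p) * ennreal (\<rho> t) \<partial>half_line)"
    by (simp add: ennreal_mult')
  also have "\<dots> = ennreal (C powr p) * (\<integral>\<^sup>+t. ennreal (\<rho> t) \<partial>half_line)"
    by (rule nn_integral_cmult) measurable
  finally show ?thesis using finite_weight by (simp add: ennreal_mult_less_top)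
qed

lemma test_functions_in_X: "f \<in> test_functions \<Longrightarrow> abs_fclass f \<in> X"
  using test_functionsE[of f] bounded_in_X(1)[OF test_functions_measurable_half_line, of f]
  by metis

text \<open>Truncation at height n; the error is dominated by \<open>\<bar>u\<bar>\<close> itself,
  whose p-th power is integrable against \<rho>.\<close>

lemma approximate_bounded:
  assumes x: "x \<in> X" and e: "0 < e"
  obtains w C where "w \<in> borel_measurable half_line" "\<And>t. \<bar>w t\<bar> \<le> C" "N (abs_fclass w - x) < e"
proof -
  obtain u where u [measurable]: "u \<in> borel_measurable half_line" and xu: "x = abs_fclass u"
    by (rule fclass_cases)
  define w where "w n t = max (- real n) (min (real n) (u t))" for n t
  have w: "w n \<in> borel_measurable half_line" for n unfolding w_def by measurable
  have bd: "\<bar>w n t\<bar> \<le> real n" for n t by (auto simp: w_def)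
  have "\<forall>\<^sub>F n in sequentially. N (abs_fclass (w n) - abs_fclass u) < e"
  proof (rule dominated_convergence_X[OF w u, where g = "\<lambda>t. \<bar>u t\<bar>"])
    show "AE t in half_line. (\<lambda>n. w n t) \<longlonglongrightarrow> u t"
    proof (rule AE_I2)
      fix t
      obtain n0 :: nat where "\<bar>u t\<bar> \<le> real n0" using real_arch_simple by blast
      then have "\<forall>\<^sub>F n in sequentially. u t = w n t"
        unfolding eventually_sequentially by (intro exI[of _ n0]) (auto simp: w_def min_def max_def)
      then show "(\<lambda>n. w n t) \<longlonglongrightarrow> u t" by (rule Lim_transform_eventually[OF tendsto_const])
    qed
    show "abs_fclass (w n) \<in> X" for n by (rule bounded_in_X(1)[OF w bd])
    show "(\<integral>\<^sup>+ t. ennreal (\<bar>u t\<bar> powr p * \<rho> t) \<partial>half_line) < \<infinity>"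
      using x by (simp add: xu X_iff Lp_integral_abs)
    show "\<bar>w n t - u t\<bar> \<le> \<bar>u t\<bar>" for n t by (auto simp: w_def)
  qed (use x e in \<open>auto simp: xu\<close>)
  then obtain n where "N (abs_fclass (w n) - x) < e"
    unfolding xu eventually_sequentially by blast
  then show thesis by (rule that[OF w bd])
qed

text \<open>A measurable function is almost everywhere a limit of continuous ones. Clamping these to
  \<open>[-C, C]\<close> and multiplying by a cutoff makes them test functions within a constant
  distance, and constants can serve as majorants because the weight is integrable.\<close>

lemma approximate_by_test_function:
  assumes x: "x \<in> X" and e: "0 < e"
  obtains f where "f \<in> test_functions" "N (x - abs_fclass f) < e"
proof -
  obtain w C where w [measurable]: "w \<in> borel_measurable half_line" and wC: "\<And>t. \<bar>w t\<bar> \<le> C"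
    and wx: "N (abs_fclass w - x) < e / 2"
    using approximate_bounded[OF x, of "e / 2"] e by auto
  have C0: "0 \<le> C" using wC[of 0] by simp
  have "w measurable_on {0..}"
    using w by (subst measurable_on_iff_borel_measurable) auto
  then obtain Z g where Z: "negligible Z" and g: "\<And>n. continuous_on UNIV (g n)"
    and gw: "\<And>t. t \<notin> Z \<Longrightarrow> (\<lambda>n. g n t) \<longlonglongrightarrow> (if t \<in> {0..} then w t else 0)"
    unfolding measurable_on_def by blast
  \<comment> \<open>A trapezoid vanishing outside \<open>(0, n)\<close>. At every
    \<open>t > 0\<close> it is eventually 1, so convergence can fail only at 0 and on
    \<open>Z\<close>.\<close>
  define \<kappa> where "\<kappa> n t = max 0 (min 1 (min (real n * t) (real n - t)))" for n and t :: real
  define f where "f n t = max (- C) (min C (g n t)) * \<kappa> n t" for n t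
  have \<kappa>01: "0 \<le> \<kappa> n t" "\<kappa> n t \<le> 1" for n t by (auto simp: \<kappa>_def)
  have f_test: "f n \<in> test_functions" for n
  proof -
    have "\<forall>t. t \<le> 0 \<or> real n \<le> t \<longrightarrow> f n t = 0"
    proof (intro allI impI)
      fix t assume "t \<le> 0 \<or> real n \<le> t"
      then have "min (real n * t) (real n - t) \<le> 0"
        by (auto simp: min_le_iff_disj mult_nonneg_nonpos)
      then have "\<kappa> n t = 0" unfolding \<kappa>_def by linarith
      then show "f n t = 0" by (simp add: f_def)
    qed
    moreover have "continuous_on UNIV (f n)"
      unfolding f_def \<kappa>_def by (intro continuous_intros g)
    ultimately show ?thesis unfolding test_functions_def by blast
  qed
  have f_bd: "\<bar>f n t\<bar> \<le> C" for n t
  proof -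
    have "\<bar>f n t\<bar> = \<bar>max (- C) (min C (g n t))\<bar> * \<kappa> n t" using \<kappa>01 by (simp add: f_def abs_mult)
    also have "\<dots> \<le> C * 1" using \<kappa>01 C0 by (intro mult_mono) auto
    finally show ?thesis by simp
  qed
  have "\<forall>\<^sub>F n in sequentially. N (abs_fclass (f n) - abs_fclass w) < e / 2"
  proof (rule dominated_convergence_X[OF _ w, where g = "\<lambda>t. 2 * C"])
    show "f n \<in> borel_measurable half_line" for n by (rule test_functions_measurable_half_line[OF f_test])
    show "abs_fclass (f n) \<in> X" for n by (rule test_functions_in_X[OF f_test])
    show "abs_fclass w \<in> X" by (rule bounded_in_X(1)[OF w wC])
    show "\<bar>f n t - w t\<bar> \<le> 2 * C" for n t using f_bd[of n t] wC[of t] by linarith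
    show "(\<integral>\<^sup>+ t. ennreal ((2 * C) powr p * \<rho> t) \<partial>half_line) < \<infinity>" by (rule const_integrable)
    have "negligible (insert 0 Z)" using Z by simp
    then have "AE t in lebesgue. t \<notin> insert 0 Z"
      by (intro AE_not_in) (simp add: negligible_iff_null_sets)
    then have "AE t in half_line. t \<notin> insert 0 Z"
      by (subst AE_restrict_space_iff) (auto elim!: eventually_mono simp del: insert_iff)
    then show "AE t in half_line. (\<lambda>n. f n t) \<longlonglongrightarrow> w t"
    proof (rule AE_mp, intro AE_I2 impI)
      fix t assume "t \<in> space half_line" and tZ: "t \<notin> insert 0 Z"
      then have t: "t > 0" by auto
      have "(\<lambda>n. max (- C) (min C (g n t))) \<longlonglongrightarrow> max (- C) (min C (w t))"
        using gw[of t] tZ t by (intro tendsto_max tendsto_min tendsto_const) auto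
      moreover have "max (- C) (min C (w t)) = w t" using wC[of t] by auto
      moreover have "(\<lambda>n. \<kappa> n t) \<longlonglongrightarrow> 1"
      proof -
        obtain n0 :: nat where n0: "max (t + 1) (1 / t) \<le> real n0" using real_arch_simple by blast
        have "\<forall>\<^sub>F n in sequentially. 1 = \<kappa> n t"
          unfolding eventually_sequentially
        proof (intro exI[of _ n0] allI impI)
          fix n assume "n0 \<le> n"
          then have "t + 1 \<le> real n" "1 / t \<le> real n" using n0 by auto
          then show "1 = \<kappa> n t" using t by (simp add: \<kappa>_def field_simps)
        qed
        then show ?thesis by (rule Lim_transform_eventually[OF tendsto_const])
      qed
      ultimately show "(\<lambda>n. f n t) \<longlonglongrightarrow> w t"
        unfolding f_def using tendsto_mult[of _ "w t" sequentially _ 1] by fastforce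
    qed
  qed (use e in auto)
  then obtain n where n: "N (abs_fclass (f n) - abs_fclass w) < e / 2"
    unfolding eventually_sequentially by blast
  have wX: "abs_fclass w \<in> X" by (rule bounded_in_X(1)[OF w wC])
  have "N (x - abs_fclass (f n)) \<le> N (x - abs_fclass w) + N (abs_fclass w - abs_fclass (f n))"
    by (rule triangle[OF x wX test_functions_in_X[OF f_test]])
  then have "N (x - abs_fclass (f n)) < e"
    using n wx N_minus_commute[of x "abs_fclass w"] N_minus_commute[of "abs_fclass w" "abs_fclass (f n)"] by simp
  with f_test show thesis by (rule that)
qed

lemma step_fun_in_X: "abs_fclass (step_fun q) \<in> X"
  using step_fun_bounded[of q] bounded_in_X(1)[OF step_fun_measurable_half_line] by blast

lemma approximate_by_step_fun:
  assumes x: "x \<in> X" and e: "0 < e"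
  obtains q where "fst q > 0" "N (x - abs_fclass (step_fun q)) < e"
proof -
  obtain f where f: "f \<in> test_functions" and fx: "N (x - abs_fclass f) < e / 2"
    using approximate_by_test_function[OF x, of "e / 2"] e by auto
  define e' where "e' = e / (2 * (W + 1))"
  have W1: "W + 1 > 0" using W_nonneg by simp
  have e': "e' > 0" using e W1 by (simp add: e'_def)
  obtain q where q: "fst q > 0" "\<And>t. 0 \<le> t \<Longrightarrow> \<bar>f t - step_fun q t\<bar> \<le> e'"
    using approximate_test_function_by_step[OF f e'] by blast
  note m = test_functions_measurable_half_line[OF f] step_fun_measurable_half_line[of q]
  have "N (abs_fclass f - abs_fclass (step_fun q)) \<le> e' * W"
    unfolding minus_abs[OF m] using m q(2) by (intro bounded_in_X) auto
  also have "\<dots> < e' * (W + 1)" using e' by simp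
  also have "\<dots> = e / 2" using W1 by (simp add: e'_def field_simps)
  finally have "N (abs_fclass f - abs_fclass (step_fun q)) < e / 2" .
  moreover have "N (x - abs_fclass (step_fun q)) \<le> N (x - abs_fclass f) + N (abs_fclass f - abs_fclass (step_fun q))"
    by (rule triangle[OF x test_functions_in_X[OF f] step_fun_in_X])
  ultimately have "N (x - abs_fclass (step_fun q)) < e" using fx by simp
  with q(1) show thesis by (rule that)
qed

text \<open>Uniform continuity settles test functions; density extends this, since the translations
  with \<open>s \<le> 1\<close> share a bound \<open>C\<close>. The approximation error enters
  twice, with factors \<open>C\<close> and 1, and \<open>(C + 1) * e1 = e / 2\<close>.\<close>

lemma translation_continuous_at_0:
  assumes x: "x \<in> X" and e: "0 < e"
  obtains \<eta> where "0 < \<eta>" "\<eta> \<le> 1" "\<And>s. 0 \<le> s \<Longrightarrow> s \<le> \<eta> \<Longrightarrow> N (translation s x - x) < e"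
proof -
  obtain C where C: "C > 0" and TC: "\<And>t x. 0 \<le> t \<Longrightarrow> t \<le> 1 \<Longrightarrow> x \<in> X \<Longrightarrow> translation t x \<in> X \<and> N (translation t x) \<le> C * N x"
    using translation_bounded[of 1] by auto
  define e1 where "e1 = e / (2 * (C + 1))"
  have e1: "e1 > 0" using e C by (simp add: e1_def)
  obtain f where f: "f \<in> test_functions" and fx: "N (x - abs_fclass f) < e1"
    using approximate_by_test_function[OF x e1] by auto
  define e2 where "e2 = e / (4 * (W + 1))"
  have W1: "W + 1 > 0" using W_nonneg by simp
  have e2: "e2 > 0" using e W1 by (simp add: e2_def)
  obtain d where d: "d > 0" "\<And>s t. \<bar>s - t\<bar> < d \<Longrightarrow> \<bar>f s - f t\<bar> < e2"
    using test_functions_uniformly_continuous[OF f e2] by blast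
  let ?f = "abs_fclass f"
  note fm = test_functions_measurable_half_line[OF f]
  have fX: "?f \<in> X" by (rule test_functions_in_X[OF f])
  show thesis
  proof (rule that[of "min 1 (d / 2)"])
    fix s assume s: "0 \<le> s" "s \<le> min 1 (d / 2)"
    have fsm: "(\<lambda>t. f (t + s)) \<in> borel_measurable half_line" using fm s by (intro shift_measurable) auto
    have "N (translation s ?f - ?f) \<le> e2 * W"
      unfolding translation_abs[OF fm s(1)] minus_abs[OF fsm fm]
      using fm fsm s d by (intro bounded_in_X) (auto intro!: less_imp_le)
    also have "\<dots> < e2 * (W + 1)" using e2 by simp
    also have "\<dots> = e / 4" using W1 by (simp add: e2_def field_simps)
    finally have 1: "N (translation s ?f - ?f) < e / 4" .
    have 2: "N (translation s (x - ?f)) \<le> C * e1"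
      using TC[of s "x - ?f"] s fx C X_diff[OF x fX] by (meson less_imp_le min.boundedE mult_left_mono order_trans)
    have "translation s x - x = (translation s (x - ?f) + (translation s ?f - ?f)) - (x - ?f)"
      using s by (simp add: translation_diff)
    have X': "translation s (x - ?f) \<in> X" "translation s ?f - ?f \<in> X" "?f - x \<in> X"
      using s x fX by (auto intro!: X_diff translation_in_X)
    have "translation s x - x = translation s (x - ?f) + (translation s ?f - ?f) + (?f - x)"
      using s by (simp add: translation_diff)
    then have "N (translation s x - x) \<le> N (translation s (x - ?f) + (translation s ?f - ?f)) + N (?f - x)"
      using N_triangle[OF X_add[OF X'(1,2)] X'(3)] by simp
    also have "\<dots> \<le> N (translation s (x - ?f)) + N (translation s ?f - ?f) + N (?f - x)"
      using N_triangle[OF X'(1,2)] by simp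
    also have "\<dots> < C * e1 + e / 4 + e1" using 1 2 fx by (simp add: N_minus_commute[of ?f x])
    also have "\<dots> = (C + 1) * e1 + e / 4" by (simp add: algebra_simps)
    also have "(C + 1) * e1 = e / 2" using C by (simp add: e1_def field_simps)
    finally show "N (translation s x - x) < e" using e by simp
  qed (use d in auto)
qed

text \<open>The orbit is continuous, so the set is relatively open in the half-line. Continuity at 0
  is carried to \<open>t\<close> by a common bound for the translations up to time
  \<open>t + 1\<close>; for \<open>r < t\<close> one writes \<open>t = r + (t - r)\<close> and
  translates by \<open>r\<close>, which gives continuity from the left.\<close>

lemma orbit_visits_measurable:
  assumes x: "x \<in> X" and U: "openin (norm_topology X N) U"
  shows "{t. 0 \<le> t \<and> translation t x \<in> U} \<in> sets lebesgue"
proof -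
  let ?A = "{t. 0 \<le> t \<and> translation t x \<in> U}"
  have "openin (top_of_set {0..}) ?A"
    unfolding openin_contains_ball
  proof (intro conjI ballI)
    fix t assume "t \<in> ?A"
    then have t: "0 \<le> t" "translation t x \<in> U" by auto
    obtain e where e: "e > 0" "\<And>y. y \<in> X \<Longrightarrow> N (translation t x - y) < e \<Longrightarrow> y \<in> U"
      using U t unfolding openin_X_iff by blast
    obtain C where C: "C > 0" and TC: "\<And>s x. 0 \<le> s \<Longrightarrow> s \<le> t + 1 \<Longrightarrow> x \<in> X \<Longrightarrow> translation s x \<in> X \<and> N (translation s x) \<le> C * N x"
      using translation_bounded[of "t + 1"] t by auto
    obtain \<eta> where \<eta>: "0 < \<eta>" "\<eta> \<le> 1" "\<And>s. 0 \<le> s \<Longrightarrow> s \<le> \<eta> \<Longrightarrow> N (translation s x - x) < e / C"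
      using translation_continuous_at_0[OF x, of "e / C"] e C by auto
    have close: "N (translation (r + s) x - translation r x) < e" if "0 \<le> r" "r \<le> t + 1" "0 \<le> s" "s \<le> \<eta>" for r s
    proof -
      have "translation (r + s) x - translation r x = translation r (translation s x - x)"
        using that by (simp add: translation_diff translation_translation)
      then have "N (translation (r + s) x - translation r x) \<le> C * N (translation s x - x)"
        using TC[of r "translation s x - x"] that x by (simp add: X_diff translation_in_X)
      also have "\<dots> < C * (e / C)" using C \<eta>(3) that by (intro mult_strict_left_mono) auto
      finally show ?thesis using C by simp
    qed
    have "ball t \<eta> \<inter> {0..} \<subseteq> ?A"
    proof
      fix r assume r: "r \<in> ball t \<eta> \<inter> {0..}"
      have "N (translation t x - translation r x) < e"
      proof (cases "r \<le> t")
        case True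
        then show ?thesis using close[of r "t - r"] r t by (simp add: dist_real_def)
      next
        case False
        then show ?thesis
          using close[of t "r - t"] r t N_minus_commute[of "translation r x" "translation t x"] by (simp add: dist_real_def)
      qed
      then show "r \<in> ?A" using e(2)[of "translation r x"] r x by (simp add: translation_in_X)
    qed
    then show "\<exists>e>0. ball t e \<inter> {0..} \<subseteq> ?A" using \<eta> by blast
  qed auto
  then obtain T where "open T" "?A = T \<inter> {0..}"
    by (auto simp: openin_open Int_commute)
  then show ?thesis by (metis borel_closed borel_open closed_atLeast lborelD sets.Int sets_completionI_sets sets_lborel)
qed

end

section \<open>Pettis integrals of translates\<close>

lemma test_functions_shift:
  assumes "f \<in> test_functions" "0 \<le> a" shows "(\<lambda>s. f (s - a)) \<in> test_functions"
proof -
  obtain m where m: "continuous_on UNIV f" "\<And>t. t \<le> 0 \<or> m \<le> t \<Longrightarrow> f t = 0"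
    using assms by (auto simp: test_functions_def)
  have "continuous_on UNIV (\<lambda>s. f (s - a))"
    by (rule continuous_on_compose2[OF m(1)]) (auto intro: continuous_intros)
  moreover have "\<forall>s. s \<le> 0 \<or> m + a \<le> s \<longrightarrow> f (s - a) = 0"
    using m(2) assms(2) by auto
  ultimately show ?thesis unfolding test_functions_def by blast
qed

text \<open>The hypothesis makes the derivative vanish everywhere. It is phrased for ordered pairs,
  the form in which increments of an integral over \<open>{r<..r'}\<close> are estimated.\<close>

lemma has_zero_derivative_imp_constant:
  fixes w :: "real \<Rightarrow> real"
  assumes "a \<le> b"
    and w: "\<And>e. 0 < e \<Longrightarrow> \<exists>d>0. \<forall>r r'. a \<le> r \<and> r \<le> r' \<and> r' \<le> b \<and> r' - r < d \<longrightarrow> \<bar>w r' - w r\<bar> \<le> e * (r' - r)"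
  shows "w b = w a"
proof -
  have "(w has_derivative (\<lambda>_. 0)) (at x within {a..b})" if x: "x \<in> {a..b}" for x
    unfolding has_derivative_within_alt
  proof (intro conjI allI impI)
    fix e :: real assume "0 < e"
    then obtain d where d: "d > 0" "\<And>r r'. a \<le> r \<Longrightarrow> r \<le> r' \<Longrightarrow> r' \<le> b \<Longrightarrow> r' - r < d \<Longrightarrow> \<bar>w r' - w r\<bar> \<le> e * (r' - r)"
      using w[OF \<open>0 < e\<close>] by metis
    have "norm (w y - w x - 0) \<le> e * norm (y - x)" if y: "y \<in> {a..b}" "norm (y - x) < d" for y
      using d(2)[of x y] d(2)[of y x] x y by (cases "x \<le> y") (auto simp: abs_minus_commute)
    then show "\<exists>d>0. \<forall>y\<in>{a..b}. norm (y - x) < d \<longrightarrow> norm (w y - w x - 0) \<le> e * norm (y - x)"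
      using d(1) by blast
  qed simp
  then obtain c where "\<And>x. x \<in> {a..b} \<Longrightarrow> w x = c"
    using has_derivative_zero_constant[of "{a..b}" w] by auto
  then show ?thesis using assms(1) by simp
qed

context finite_weight_Lp
begin

section \<open>Translates of a test function and their pointwise integrals\<close>

context
  fixes f :: "real \<Rightarrow> real" and \<sigma> :: real
  assumes f: "f \<in> test_functions" and \<sigma>: "\<sigma> = 1 \<or> \<sigma> = -1"
begin

text \<open>\<sigma> = 1 gives the semigroup and \<sigma> = -1 the right shifts, so both
  integrability conditions of the criterion are treated at once. All real \<open>t\<close> are
  allowed because \<open>f\<close> lives on the whole line.\<close>

definition translate :: "real \<Rightarrow> fclass" where
  "translate t = abs_fclass (\<lambda>s. f (s + \<sigma> * t))"

text \<open>The candidate for the Pettis integral over \<open>E\<close>, evaluated at the point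
  \<open>s\<close>.\<close>

definition avg :: "real set \<Rightarrow> real \<Rightarrow> real" where
  "avg E s = (LINT t:E|lebesgue. f (s + \<sigma> * t))"

definition translate_integral :: "real set \<Rightarrow> fclass" where
  "translate_integral E = abs_fclass (avg E)"

definition L1 :: real where "L1 = (\<integral>t. \<bar>f t\<bar> \<partial>lborel)"

lemma f_integrable: "integrable lborel f"
proof -
  obtain m C where m: "\<And>t. t \<le> 0 \<Longrightarrow> f t = 0" "\<And>t. m \<le> t \<Longrightarrow> f t = 0"
    using test_functionsE[OF f] by metis
  have "integrable lborel (\<lambda>x. indicator {0..m} x *\<^sub>R f x)"
    using f by (intro borel_integrable_compact) (auto simp: test_functions_def intro: continuous_on_subset)
  moreover have "f x = 0" if "x \<notin> {0..m}" for x
    using m(1)[of x] m(2)[of x] that by auto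
  then have "(\<lambda>x. indicator {0..m} x *\<^sub>R f x) = f"
    by (auto simp: fun_eq_iff indicator_def)
  ultimately show ?thesis by simp
qed

lemma shift_integrable: "integrable lebesgue (\<lambda>t. f (s + \<sigma> * t))"
  using lborel_integrable_real_affine[OF f_integrable, of \<sigma> s] \<sigma>
  by (subst integrable_completion) auto

lemma shift_set_integrable: "E \<in> sets lebesgue \<Longrightarrow> set_integrable lebesgue E (\<lambda>t. f (s + \<sigma> * t))"
  unfolding set_integrable_def using shift_integrable by (intro integrable_mult_indicator) auto

lemma L1_shift: "(\<integral>t. \<bar>f (s + \<sigma> * t)\<bar> \<partial>lebesgue) = L1"
proof -
  have "(\<integral>t. \<bar>f (s + \<sigma> * t)\<bar> \<partial>lebesgue) = (\<integral>t. \<bar>f (s + \<sigma> * t)\<bar> \<partial>lborel)"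
    using borel_measurable_integrable[OF lborel_integrable_real_affine[OF f_integrable, of \<sigma> s]] \<sigma>
    by (intro integral_completion) auto
  also have "\<dots> = L1"
    using \<sigma> lborel_integral_real_affine[of \<sigma> "\<lambda>t. \<bar>f t\<bar>" s] by (auto simp: L1_def)
  finally show ?thesis .
qed

lemma avg_bound: assumes "E \<in> sets lebesgue" shows "\<bar>avg E s\<bar> \<le> L1"
proof -
  have "\<bar>avg E s\<bar> \<le> (LINT t:E|lebesgue. \<bar>f (s + \<sigma> * t)\<bar>)"
    unfolding avg_def using set_integral_norm_bound[OF shift_set_integrable[OF assms]] by simp
  also have "\<dots> \<le> (\<integral>t. \<bar>f (s + \<sigma> * t)\<bar> \<partial>lebesgue)"
    unfolding set_lebesgue_integral_def
  proof (rule integral_mono)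
    show "integrable lebesgue (\<lambda>t. indicat_real E t *\<^sub>R \<bar>f (s + \<sigma> * t)\<bar>)"
      using set_integrable_abs[OF shift_set_integrable[OF assms]] unfolding set_integrable_def .
    show "integrable lebesgue (\<lambda>t. \<bar>f (s + \<sigma> * t)\<bar>)" using shift_integrable by simp
  qed (simp add: indicator_def)
  finally show ?thesis by (simp add: L1_shift)
qed

lemma avg_Un:
  "E \<in> sets lebesgue \<Longrightarrow> E' \<in> sets lebesgue \<Longrightarrow> E \<inter> E' = {} \<Longrightarrow> avg (E \<union> E') s = avg E s + avg E' s"
  unfolding avg_def by (intro set_integral_Un shift_set_integrable)

text \<open>Gives measurability in \<open>s\<close>. If \<open>s'\<close> is within 1 of
  \<open>s\<close>, both integrands vanish unless \<open>s + \<sigma> * t\<close> lies in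
  \<open>[-1, m + 1]\<close>, that is, \<open>t\<close> in the interval \<open>J\<close> of length
  \<open>m + 2\<close>. There the difference is below \<open>e / (m + 3)\<close>, the larger
  denominator making the final inequality strict.\<close>

lemma avg_continuous:
  assumes E: "E \<in> sets lebesgue" shows "continuous_on UNIV (avg E)"
proof -
  obtain m where m: "m > 0" "\<And>t. t \<le> 0 \<Longrightarrow> f t = 0" "\<And>t. m \<le> t \<Longrightarrow> f t = 0"
    using test_functionsE[OF f] by metis
  have "\<exists>d>0. \<forall>s'. dist s' s < d \<longrightarrow> dist (avg E s') (avg E s) < e" if e: "0 < e" for s e
  proof -
    obtain d where d: "d > 0" "\<And>s t. \<bar>s - t\<bar> < d \<Longrightarrow> \<bar>f s - f t\<bar> < e / (m + 3)"
      using test_functions_uniformly_continuous[OF f, of "e / (m + 3)"] e m(1) by auto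
    define J where "J = (if \<sigma> = 1 then {-1 - s..m + 1 - s} else {s - m - 1..s + 1})"
    have J: "J \<in> lmeasurable" "measure lebesgue J = m + 2" using m(1) by (auto simp: J_def)
    have "dist (avg E s') (avg E s) < e" if s': "dist s' s < min d 1" for s'
    proof -
      have "avg E s' - avg E s = (LINT t:E|lebesgue. f (s' + \<sigma> * t) - f (s + \<sigma> * t))"
        unfolding avg_def by (intro set_integral_diff(2)[symmetric] shift_set_integrable E)
      then have "\<bar>avg E s' - avg E s\<bar> \<le> (\<integral>t. \<bar>indicator E t * (f (s' + \<sigma> * t) - f (s + \<sigma> * t))\<bar> \<partial>lebesgue)"
        using integral_norm_bound[of lebesgue "\<lambda>t. indicator E t * (f (s' + \<sigma> * t) - f (s + \<sigma> * t))"]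
        by (simp add: set_lebesgue_integral_def)
      also have "\<dots> \<le> (\<integral>t. e / (m + 3) * indicator J t \<partial>lebesgue)"
      proof (rule integral_mono)
        have "integrable lebesgue (\<lambda>t. f (s' + \<sigma> * t) - f (s + \<sigma> * t))"
          by (intro Bochner_Integration.integrable_diff shift_integrable)
        then have "integrable lebesgue (\<lambda>t. indicator E t *\<^sub>R (f (s' + \<sigma> * t) - f (s + \<sigma> * t)))"
          by (rule integrable_mult_indicator[OF E])
        then show "integrable lebesgue (\<lambda>t. \<bar>indicator E t * (f (s' + \<sigma> * t) - f (s + \<sigma> * t))\<bar>)" by simp
        show "integrable lebesgue (\<lambda>t. e / (m + 3) * indicator J t)"
          using J(1) by (auto simp: fmeasurable_def intro!: integrable_mult_right integrable_real_indicator)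
        fix t
        have "\<bar>f (s' + \<sigma> * t) - f (s + \<sigma> * t)\<bar> \<le> e / (m + 3) * indicator J t"
        proof (cases "t \<in> J")
          case True
          then show ?thesis using d(2)[of "s' + \<sigma> * t" "s + \<sigma> * t"] s' by (simp add: dist_real_def)
        next
          case False
          then have "s + \<sigma> * t < -1 \<or> s + \<sigma> * t > m + 1" using \<sigma> by (auto simp: J_def split: if_splits)
          then have "(s' + \<sigma> * t \<le> 0 \<and> s + \<sigma> * t \<le> 0) \<or> (m \<le> s' + \<sigma> * t \<and> m \<le> s + \<sigma> * t)"
            using s' unfolding dist_real_def by linarith
          then have "f (s' + \<sigma> * t) = 0 \<and> f (s + \<sigma> * t) = 0"
            using m(2,3) by blast
          then show ?thesis using e m(1) by simp
        qed
        then show "\<bar>indicator E t * (f (s' + \<sigma> * t) - f (s + \<sigma> * t))\<bar> \<le> e / (m + 3) * indicator J t"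
          by (cases "t \<in> E") (auto simp: indicator_def intro: order_trans[OF abs_ge_zero])
      qed
      also have "\<dots> = e / (m + 3) * (m + 2)" using J by simp
      also have "\<dots> < e / (m + 3) * (m + 3)" using e m(1) by (intro mult_strict_left_mono) auto
      also have "\<dots> = e" using m(1) by simp
      finally show ?thesis by (simp add: dist_real_def)
    qed
    then show ?thesis using d(1) by (intro exI[of _ "min d 1"]) auto
  qed
  then show ?thesis unfolding continuous_on_iff by simp
qed

lemma avg_measurable: "E \<in> sets lebesgue \<Longrightarrow> avg E \<in> borel_measurable half_line"
  by (intro borel_imp_half_line borel_measurable_continuous_onI avg_continuous)

lemma shift_f_measurable: "(\<lambda>s. f (s + a)) \<in> borel_measurable half_line"
proof -
  have "(\<lambda>s. f (s + a)) \<in> borel_measurable borel"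
    using test_functions_measurable[OF f] by (rule measurable_compose[rotated]) simp
  then show ?thesis by (rule borel_imp_half_line)
qed

lemma translate_integral_X:
  assumes "E \<in> sets lebesgue"
  shows "translate_integral E \<in> X" "N (translate_integral E) \<le> L1 * W"
  unfolding translate_integral_def using avg_bound[OF assms] avg_measurable[OF assms]
  by (auto intro!: bounded_in_X)

lemma translate_X: "translate t \<in> X"
proof -
  obtain C where "\<And>t. \<bar>f t\<bar> \<le> C" using test_functionsE[OF f] by metis
  then show ?thesis unfolding translate_def by (intro bounded_in_X(1) shift_f_measurable) auto
qed

section \<open>Exchanging the integral with a continuous functional\<close>

context
  fixes \<phi> :: "fclass \<Rightarrow> real" and C :: real
  assumes \<phi>: "\<phi> \<in> dual_space X N" and C: "0 \<le> C" "\<And>x. x \<in> X \<Longrightarrow> \<bar>\<phi> x\<bar> \<le> C * N x"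
begin

lemma \<phi>_add: "x \<in> X \<Longrightarrow> y \<in> X \<Longrightarrow> \<phi> (x + y) = \<phi> x + \<phi> y"
  and \<phi>_scale: "x \<in> X \<Longrightarrow> \<phi> (c *\<^sub>R x) = c * \<phi> x"
  using \<phi> by (auto simp: dual_space_def)

lemma \<phi>_diff: assumes "x \<in> X" "y \<in> X" shows "\<phi> (x - y) = \<phi> x - \<phi> y"
  using \<phi>_add[OF X_diff[OF assms] assms(2)] by simp

lemma \<phi>_0: "\<phi> 0 = 0" using \<phi>_diff[of 0 0] by simp

lemma \<phi>_close:
  assumes "u \<in> borel_measurable half_line" "v \<in> borel_measurable half_line"
    and "abs_fclass u \<in> X" "abs_fclass v \<in> X" and "\<And>t. 0 \<le> t \<Longrightarrow> \<bar>u t - v t\<bar> \<le> e"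
  shows "\<bar>\<phi> (abs_fclass u) - \<phi> (abs_fclass v)\<bar> \<le> C * (e * W)"
proof -
  have "\<bar>\<phi> (abs_fclass u) - \<phi> (abs_fclass v)\<bar> \<le> C * N (abs_fclass u - abs_fclass v)"
    using \<phi>_diff[OF assms(3,4)] C(2)[OF X_diff[OF assms(3,4)]] by simp
  also have "\<dots> \<le> C * (e * W)"
    using assms by (intro mult_left_mono C) (auto simp: minus_abs intro!: bounded_in_X(2))
  finally show ?thesis .
qed

text \<open>One \<open>d\<close> serves both the functional values and the functions themselves,
  since both will be compared on the same short interval with the value at its left end.\<close>

lemma \<phi>_translate_modulus:
  assumes e: "0 < e"
  obtains d where "d > 0" "\<And>t t'. \<bar>t - t'\<bar> < d \<Longrightarrow> \<bar>\<phi> (translate t) - \<phi> (translate t')\<bar> \<le> C * (e * W)"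
    "\<And>s t t'. \<bar>t - t'\<bar> < d \<Longrightarrow> \<bar>f (s + \<sigma> * t) - f (s + \<sigma> * t')\<bar> \<le> e"
proof -
  obtain d where d: "d > 0" "\<And>s t. \<bar>s - t\<bar> < d \<Longrightarrow> \<bar>f s - f t\<bar> < e"
    using test_functions_uniformly_continuous[OF f e] by blast
  have fd: "\<bar>f (s + \<sigma> * t) - f (s + \<sigma> * t')\<bar> \<le> e" if "\<bar>t - t'\<bar> < d" for s t t'
    using d(2)[of "s + \<sigma> * t" "s + \<sigma> * t'"] that \<sigma> by (auto simp: abs_minus_commute)
  show thesis
  proof (rule that[OF d(1) _ fd])
    fix t t' :: real assume "\<bar>t - t'\<bar> < d"
    then show "\<bar>\<phi> (translate t) - \<phi> (translate t')\<bar> \<le> C * (e * W)"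
      unfolding translate_def
      by (intro \<phi>_close shift_f_measurable translate_X[unfolded translate_def] fd)
  qed
qed

lemma \<phi>_translate_continuous: "continuous_on UNIV (\<lambda>t. \<phi> (translate t))"
  unfolding continuous_on_iff
proof (intro ballI allI impI)
  fix t e :: real assume e: "0 < e"
  have CW: "0 \<le> C * W" using C(1) W_nonneg by simp
  define e' where "e' = e / (C * W + 1)"
  have e': "e' > 0" using e CW by (simp add: e'_def)
  have "C * (e' * W) < (C * W + 1) * e'" using e' by (simp add: algebra_simps)
  also have "\<dots> = e" using CW by (simp add: e'_def)
  finally have lt: "C * (e' * W) < e" .
  obtain d where "d > 0" "\<And>t t'. \<bar>t - t'\<bar> < d \<Longrightarrow> \<bar>\<phi> (translate t) - \<phi> (translate t')\<bar> \<le> C * (e' * W)"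
    using \<phi>_translate_modulus[OF e'] by metis
  then show "\<exists>d>0. \<forall>t'\<in>UNIV. dist t' t < d \<longrightarrow> dist (\<phi> (translate t')) (\<phi> (translate t)) < e"
    using lt unfolding dist_real_def by (meson le_less_trans)
qed

lemma \<phi>_translate_measurable [measurable]: "(\<lambda>t. \<phi> (translate t)) \<in> borel_measurable lebesgue"
  by (rule measurable_completion) (simp add: borel_measurable_continuous_onI \<phi>_translate_continuous)

lemma \<phi>_translate_set_integrable:
  assumes "E \<in> sets lebesgue" "E \<subseteq> {a..b}"
  shows "set_integrable lebesgue E (\<lambda>t. \<phi> (translate t))"
proof -
  have "integrable lborel (\<lambda>t. indicator {a..b} t *\<^sub>R \<phi> (translate t))"
    by (intro borel_integrable_compact) (auto intro: continuous_on_subset[OF \<phi>_translate_continuous])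
  then have "set_integrable lebesgue {a..b} (\<lambda>t. \<phi> (translate t))"
    unfolding set_integrable_def by (subst integrable_completion) auto
  then show ?thesis using assms by (rule set_integrable_subset)
qed

lemma translate_integral_Un:
  assumes "E \<in> sets lebesgue" "E' \<in> sets lebesgue" "E \<inter> E' = {}"
  shows "translate_integral (E \<union> E') = translate_integral E + translate_integral E'"
proof -
  have "avg (E \<union> E') = (\<lambda>s. avg E s + avg E' s)" by (rule ext) (rule avg_Un[OF assms])
  then show ?thesis using assms by (simp add: translate_integral_def plus_abs avg_measurable)
qed

text \<open>\<open>w r\<close> is the defect of the exchange over \<open>E \<inter> {a<..r}\<close>.
  On a short interval \<open>{r<..r'}\<close>, with \<mu> the measure of its part in
  \<open>E\<close>, both the functional of the integral and the integral of the functional differ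
  from \<open>\<mu> * \<phi> (translate r)\<close> by at most \<open>C * (e' * W) * \<mu>\<close>.
  The defect thus changes by at most \<open>e * (r' - r)\<close>, and it is 0 for
  \<open>r = a\<close>.\<close>

lemma \<phi>_translate_integral_bounded:
  assumes E: "E \<in> sets lebesgue" and ab: "a \<le> b"
  shows "\<phi> (translate_integral (E \<inter> {a<..b})) = (LINT t:E \<inter> {a<..b}|lebesgue. \<phi> (translate t))"
proof -
  define w where "w r = \<phi> (translate_integral (E \<inter> {a<..r})) - (LINT t:E \<inter> {a<..r}|lebesgue. \<phi> (translate t))" for r
  have Em: "E \<inter> {r<..r'} \<in> sets lebesgue" for r r' using E by (intro sets.Int) auto
  have "w b = w a"
  proof (rule has_zero_derivative_imp_constant[OF ab])
    fix e :: real assume e: "0 < e"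
    have CW: "0 \<le> C * W" using C(1) W_nonneg by simp
    \<comment> \<open>Two errors of size \<open>C * (e' * W)\<close> add up to at most
      \<open>e\<close>; the summand 1 keeps the denominator positive when
      \<open>C * W = 0\<close>.\<close>
    define e' where "e' = e / (2 * (C * W + 1))"
    have e': "e' > 0" using e CW by (simp add: e'_def)
    have "2 * (C * (e' * W)) \<le> 2 * (C * W + 1) * e'" using e' by (simp add: algebra_simps)
    also have "\<dots> = e" using CW by (simp add: e'_def)
    finally have lt: "2 * (C * (e' * W)) \<le> e" .
    obtain d where d: "d > 0" and gd: "\<And>t t'. \<bar>t - t'\<bar> < d \<Longrightarrow> \<bar>\<phi> (translate t) - \<phi> (translate t')\<bar> \<le> C * (e' * W)"
      and fd: "\<And>s t t'. \<bar>t - t'\<bar> < d \<Longrightarrow> \<bar>f (s + \<sigma> * t) - f (s + \<sigma> * t')\<bar> \<le> e'"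
      using \<phi>_translate_modulus[OF e'] by metis
    have "\<bar>w r' - w r\<bar> \<le> e * (r' - r)" if r: "a \<le> r" "r \<le> r'" "r' \<le> b" "r' - r < d" for r r'
    proof -
      let ?E = "E \<inter> {r<..r'}"
      have un: "E \<inter> {a<..r'} = (E \<inter> {a<..r}) \<union> ?E" "(E \<inter> {a<..r}) \<inter> ?E = {}" using r by auto
      have fm: "?E \<in> lmeasurable"
        by (rule fmeasurableI2[of "{r..r'}"]) (use Em in auto)
      define \<mu> where "\<mu> = measure lebesgue ?E"
      have \<mu>: "\<mu> \<le> r' - r"
      proof -
        have "\<mu> \<le> measure lebesgue {r..r'}"
          unfolding \<mu>_def using Em by (intro measure_mono_fmeasurable) auto
        then show ?thesis using r by simp
      qed
      have \<mu>0: "0 \<le> \<mu>" by (simp add: \<mu>_def)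
      have const_int: "set_integrable lebesgue ?E (\<lambda>_. c)" "(LINT t:?E|lebesgue. c) = c * \<mu>" for c :: real
        using fm by (auto simp: set_integrable_def set_lebesgue_integral_def \<mu>_def fmeasurable_def intro!: integrable_mult_left integrable_real_indicator)
      have dev: "\<bar>(LINT t:?E|lebesgue. h t) - c * \<mu>\<bar> \<le> k * \<mu>"
        if h: "set_integrable lebesgue ?E h" and k: "\<And>t. t \<in> ?E \<Longrightarrow> \<bar>h t - c\<bar> \<le> k" for h c k
      proof -
        have "(LINT t:?E|lebesgue. h t) - c * \<mu> = (LINT t:?E|lebesgue. h t - c)"
          by (subst set_integral_diff(2)[OF h const_int(1)]) (simp add: const_int(2))
        also have "\<bar>\<dots>\<bar> \<le> (LINT t:?E|lebesgue. \<bar>h t - c\<bar>)"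
          using set_integral_norm_bound[OF set_integral_diff(1)[OF h const_int(1)]] by simp
        also have "\<dots> \<le> (LINT t:?E|lebesgue. k)"
          using k by (intro set_integral_mono set_integrable_abs set_integral_diff h const_int) auto
        also have "\<dots> = k * \<mu>" by (rule const_int(2))
        finally show ?thesis .
      qed
      have 1: "\<bar>(LINT t:?E|lebesgue. \<phi> (translate t)) - \<phi> (translate r) * \<mu>\<bar> \<le> C * (e' * W) * \<mu>"
        using r by (intro dev \<phi>_translate_set_integrable[of _ a b] gd Em) auto
      have 2: "\<bar>\<phi> (translate_integral ?E) - \<phi> (\<mu> *\<^sub>R translate r)\<bar> \<le> C * ((e' * \<mu>) * W)"
        unfolding translate_integral_def translate_def scaleR_abs[OF shift_f_measurable]
      proof (rule \<phi>_close)
        show "abs_fclass (\<lambda>x. \<mu> * f (x + \<sigma> * r)) \<in> X"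
          using X_scale[OF translate_X[of r], of \<mu>] by (simp add: translate_def scaleR_abs shift_f_measurable)
        show "\<bar>avg ?E s - \<mu> * f (s + \<sigma> * r)\<bar> \<le> e' * \<mu>" for s
          unfolding avg_def mult.commute[of \<mu>] using r by (intro dev shift_set_integrable Em fd) auto
      qed (use translate_integral_X[OF Em] Em in \<open>auto simp: translate_integral_def intro!: avg_measurable borel_measurable_times shift_f_measurable\<close>)
      have "w r' - w r = \<phi> (translate_integral ?E) - (LINT t:?E|lebesgue. \<phi> (translate t))"
        unfolding w_def un(1)
        using r un(2) Em
        by (simp add: translate_integral_Un \<phi>_add translate_integral_X set_integral_Un \<phi>_translate_set_integrable[of _ a b] subset_iff)
      also have "\<dots> = (\<phi> (translate_integral ?E) - \<phi> (\<mu> *\<^sub>R translate r)) - ((LINT t:?E|lebesgue. \<phi> (translate t)) - \<phi> (translate r) * \<mu>)"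
        by (simp add: \<phi>_scale translate_X mult.commute)
      also have "\<bar>\<dots>\<bar> \<le> C * ((e' * \<mu>) * W) + C * (e' * W) * \<mu>"
        using 1 2 by linarith
      also have "\<dots> = 2 * (C * (e' * W)) * \<mu>" by (simp add: algebra_simps)
      also have "\<dots> \<le> e * (r' - r)" using lt \<mu> \<mu>0 e by (intro mult_mono) auto
      finally show ?thesis .
    qed
    then show "\<exists>d>0. \<forall>r r'. a \<le> r \<and> r \<le> r' \<and> r' \<le> b \<and> r' - r < d \<longrightarrow> \<bar>w r' - w r\<bar> \<le> e * (r' - r)"
      using d by blast
  qed
  also have "w a = 0"
    by (simp add: w_def translate_integral_def avg_def[abs_def] set_lebesgue_integral_def zero_abs[symmetric] \<phi>_0)
  finally show ?thesis by (simp add: w_def)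
qed

text \<open>The integrals of \<open>\<phi> (translate t)\<close> over the parts of measurable sets
  in bounded intervals are values of \<phi> at elements of norm at most \<open>L1 * W\<close>, hence
  at most \<open>B\<close> in absolute value. Using the set where the function is positive and its
  complement bounds the integral of the absolute value by \<open>2 * B\<close> on every interval
  \<open>{-n<..n}\<close>; monotone convergence does the rest.\<close>

lemma \<phi>_translate_integrable: "integrable lebesgue (\<lambda>t. \<phi> (translate t))"
proof -
  let ?g = "\<lambda>t. \<phi> (translate t)" and ?J = "\<lambda>n::nat. {- real n<..real n}"
  define B where "B = C * (L1 * W)"
  have bd: "(LINT t:E \<inter> {a<..b}|lebesgue. ?g t) \<in> {-B..B}" if E: "E \<in> sets lebesgue" and ab: "a \<le> b" for E a b
  proof -
    have Em: "E \<inter> {a<..b} \<in> sets lebesgue" using E by (intro sets.Int) auto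
    have "\<bar>\<phi> (translate_integral (E \<inter> {a<..b}))\<bar> \<le> C * N (translate_integral (E \<inter> {a<..b}))"
      by (rule C(2)[OF translate_integral_X(1)[OF Em]])
    also have "\<dots> \<le> B" unfolding B_def by (rule mult_left_mono[OF translate_integral_X(2)[OF Em] C(1)])
    finally show ?thesis using \<phi>_translate_integral_bounded[OF E ab] by (auto simp: abs_le_iff)
  qed
  define Pos where "Pos = {t. ?g t > 0}"
  have Pos: "Pos \<in> sets lebesgue" "- Pos \<in> sets lebesgue"
  proof -
    have "Pos = {t \<in> space lebesgue. ?g t > 0}" by (simp add: Pos_def)
    also have "\<dots> \<in> sets lebesgue" by measurable
    finally show "Pos \<in> sets lebesgue" .
    then show "- Pos \<in> sets lebesgue" using sets.compl_sets[of Pos lebesgue] by (simp add: Compl_eq_Diff_UNIV)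
  qed
  have fin: "(\<integral>\<^sup>+t. ennreal \<bar>?g t\<bar> * indicator (?J n) t \<partial>lebesgue) \<le> ennreal (2 * B)" for n
  proof -
    have i: "set_integrable lebesgue (E \<inter> ?J n) ?g" if "E \<in> sets lebesgue" for E
      using that by (intro \<phi>_translate_set_integrable[of _ "- real n" "real n"] sets.Int) auto
    have a: "integrable lebesgue (\<lambda>t. indicator (?J n) t * \<bar>?g t\<bar>)"
      using set_integrable_abs[OF i[of UNIV]] by (simp add: set_integrable_def)
    have "(\<integral>\<^sup>+t. ennreal \<bar>?g t\<bar> * indicator (?J n) t \<partial>lebesgue) = (\<integral>\<^sup>+t. ennreal (indicator (?J n) t * \<bar>?g t\<bar>) \<partial>lebesgue)"
      by (intro nn_integral_cong) (simp add: indicator_def)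
    also have "\<dots> = ennreal (\<integral>t. indicator (?J n) t * \<bar>?g t\<bar> \<partial>lebesgue)"
      by (rule nn_integral_eq_integral[OF a]) auto
    also have "(\<integral>t. indicator (?J n) t * \<bar>?g t\<bar> \<partial>lebesgue) =
        (\<integral>t. indicator (Pos \<inter> ?J n) t *\<^sub>R ?g t - indicator (- Pos \<inter> ?J n) t *\<^sub>R ?g t \<partial>lebesgue)"
      by (intro Bochner_Integration.integral_cong refl) (auto simp: indicator_def Pos_def)
    also have "\<dots> = (LINT t:Pos \<inter> ?J n|lebesgue. ?g t) - (LINT t:- Pos \<inter> ?J n|lebesgue. ?g t)"
      unfolding set_lebesgue_integral_def using i[OF Pos(1)] i[OF Pos(2)]
      by (intro Bochner_Integration.integral_diff) (auto simp: set_integrable_def)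
    also have "\<dots> \<le> 2 * B" using bd[OF Pos(1), of "- real n" "real n"] bd[OF Pos(2), of "- real n" "real n"] by auto
    finally show ?thesis by (simp add: ennreal_leI)
  qed
  have "(\<integral>\<^sup>+t. ennreal (norm (?g t)) \<partial>lebesgue) = (\<integral>\<^sup>+t. (SUP n. ennreal \<bar>?g t\<bar> * indicator (?J n) t) \<partial>lebesgue)"
  proof (intro nn_integral_cong)
    fix t
    obtain n0 :: nat where n0: "\<bar>t\<bar> + 1 \<le> real n0" using real_arch_simple by blast
    have "(SUP n. ennreal \<bar>?g t\<bar> * indicator (?J n) t) = ennreal \<bar>?g t\<bar>"
    proof (rule antisym)
      show "(SUP n. ennreal \<bar>?g t\<bar> * indicator (?J n) t) \<le> ennreal \<bar>?g t\<bar>"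
        by (intro SUP_least) (simp add: indicator_def)
      have "ennreal \<bar>?g t\<bar> = ennreal \<bar>?g t\<bar> * indicator (?J n0) t" using n0 by (auto simp: indicator_def)
      also have "\<dots> \<le> (SUP n. ennreal \<bar>?g t\<bar> * indicator (?J n) t)" by (rule SUP_upper) simp
      finally show "ennreal \<bar>?g t\<bar> \<le> (SUP n. ennreal \<bar>?g t\<bar> * indicator (?J n) t)" .
    qed
    then show "ennreal (norm (?g t)) = (SUP n. ennreal \<bar>?g t\<bar> * indicator (?J n) t)" by simp
  qed
  also have "\<dots> = (SUP n. \<integral>\<^sup>+t. ennreal \<bar>?g t\<bar> * indicator (?J n) t \<partial>lebesgue)"
    by (intro nn_integral_monotone_convergence_SUP)
      (auto simp: incseq_def le_fun_def indicator_def)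
  also have "\<dots> \<le> ennreal (2 * B)" by (intro SUP_least fin)
  finally show ?thesis by (intro integrableI_bounded) (auto simp: le_less_trans)
qed

text \<open>Both sides pass to the limit along \<open>E \<inter> {-n<..n}\<close>. On the left the
  pointwise integrals at a fixed \<open>s\<close> are constant as soon as
  \<open>n \<ge> s + m\<close>, by compact support, and \<open>L1\<close> bounds their distance from
  the limit; on the right the integrand is dominated by its integrable absolute value.\<close>

lemma \<phi>_translate_integral:
  assumes E: "E \<in> sets lebesgue"
  shows "\<phi> (translate_integral E) = (LINT t:E|lebesgue. \<phi> (translate t))"
proof -
  let ?g = "\<lambda>t. \<phi> (translate t)" and ?J = "\<lambda>n::nat. {- real n<..real n}"
  obtain m where m: "m > 0" "\<And>t. t \<le> 0 \<Longrightarrow> f t = 0" "\<And>t. m \<le> t \<Longrightarrow> f t = 0"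
    using test_functionsE[OF f] by metis
  have Em: "E \<inter> ?J n \<in> sets lebesgue" "E - ?J n \<in> sets lebesgue" for n using E by auto
  have split: "avg E s = avg (E \<inter> ?J n) s + avg (E - ?J n) s" for n s
    using avg_Un[OF Em(1)[of n] Em(2)[of n], of s] by (simp add: Int_Diff_Un Int_Diff_disjoint)
  have conv: "(\<lambda>n. \<phi> (translate_integral (E \<inter> ?J n))) \<longlonglongrightarrow> \<phi> (translate_integral E)"
  proof (rule tendstoI)
    fix e :: real assume e: "0 < e"
    have "\<forall>\<^sub>F n in sequentially. N (abs_fclass (avg (E \<inter> ?J n)) - abs_fclass (avg E)) < e / (C + 1)"
    proof (rule dominated_convergence_X[where g = "\<lambda>_. L1"])
      show "AE s in half_line. (\<lambda>n. avg (E \<inter> ?J n) s) \<longlonglongrightarrow> avg E s"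
      proof (rule AE_I2)
        fix s assume "s \<in> space half_line"
        then have s: "0 \<le> s" by simp
        obtain n0 :: nat where n0: "s + m \<le> real n0" using real_arch_simple by blast
        have "avg E s = avg (E \<inter> ?J n) s" if "n0 \<le> n" for n
        proof -
          have n: "s + m \<le> real n" using n0 that by linarith
          have "f (s + \<sigma> * t) = 0" if "t \<notin> ?J n" for t
          proof -
            have "t \<le> - real n \<or> real n < t" using that by auto
            then have "s + \<sigma> * t \<le> 0 \<or> m \<le> s + \<sigma> * t" using \<sigma> n s m(1) by auto
            then show ?thesis using m by blast
          qed
          then have "avg (E - ?J n) s = (LINT t:E - ?J n|lebesgue. 0)"
            unfolding avg_def using Em by (intro set_lebesgue_integral_cong) auto
          then show ?thesis using split[of s n] by (simp add: set_lebesgue_integral_def)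
        qed
        then have "\<forall>\<^sub>F n in sequentially. avg E s = avg (E \<inter> ?J n) s"
          unfolding eventually_sequentially by blast
        then show "(\<lambda>n. avg (E \<inter> ?J n) s) \<longlonglongrightarrow> avg E s" by (rule Lim_transform_eventually[OF tendsto_const])
      qed
      show "\<bar>avg (E \<inter> ?J n) s - avg E s\<bar> \<le> L1" for n and s :: real
        using split[of s n] avg_bound[OF Em(2)[of n], of s] by simp
    qed (use e C(1) Em E translate_integral_X in \<open>auto simp: translate_integral_def[symmetric] const_integrable[simplified] intro!: avg_measurable\<close>)
    then show "\<forall>\<^sub>F n in sequentially. dist (\<phi> (translate_integral (E \<inter> ?J n))) (\<phi> (translate_integral E)) < e"
    proof eventually_elim
      case (elim n)
      have "dist (\<phi> (translate_integral (E \<inter> ?J n))) (\<phi> (translate_integral E)) \<le> C * N (translate_integral (E \<inter> ?J n) - translate_integral E)"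
        using \<phi>_diff[of "translate_integral (E \<inter> ?J n)" "translate_integral E"] Em E
          C(2)[of "translate_integral (E \<inter> ?J n) - translate_integral E"]
        by (simp add: dist_real_def translate_integral_X X_diff)
      also have "\<dots> \<le> C * (e / (C + 1))"
        using elim C(1) by (intro mult_left_mono) (auto simp: translate_integral_def)
      also have "\<dots> < (C + 1) * (e / (C + 1))" using e C(1) by (intro mult_strict_right_mono) auto
      also have "\<dots> = e" using C(1) by simp
      finally show ?case .
    qed
  qed
  have "(\<lambda>n. \<integral>t. indicator (E \<inter> ?J n) t *\<^sub>R ?g t \<partial>lebesgue) \<longlonglongrightarrow> (\<integral>t. indicator E t *\<^sub>R ?g t \<partial>lebesgue)"
  proof (rule integral_dominated_convergence[where w = "\<lambda>t. \<bar>?g t\<bar>"])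
    show "AE t in lebesgue. (\<lambda>n. indicator (E \<inter> ?J n) t *\<^sub>R ?g t) \<longlonglongrightarrow> indicator E t *\<^sub>R ?g t"
    proof (rule AE_I2)
      fix t
      obtain n0 :: nat where n0: "\<bar>t\<bar> + 1 \<le> real n0" using real_arch_simple by blast
      have "\<forall>\<^sub>F n in sequentially. indicator E t *\<^sub>R ?g t = indicator (E \<inter> ?J n) t *\<^sub>R ?g t"
        unfolding eventually_sequentially using n0 by (intro exI[of _ n0]) (auto simp: indicator_def)
      then show "(\<lambda>n. indicator (E \<inter> ?J n) t *\<^sub>R ?g t) \<longlonglongrightarrow> indicator E t *\<^sub>R ?g t"
        by (rule Lim_transform_eventually[OF tendsto_const])
    qed
    show "integrable lebesgue (\<lambda>t. \<bar>?g t\<bar>)" using \<phi>_translate_integrable by simp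
    show "(\<lambda>t. indicator E t *\<^sub>R ?g t) \<in> borel_measurable lebesgue"
      using E by (intro borel_measurable_scaleR borel_measurable_indicator) auto
    show "(\<lambda>t. indicator (E \<inter> ?J n) t *\<^sub>R ?g t) \<in> borel_measurable lebesgue" for n
      using Em by (intro borel_measurable_scaleR borel_measurable_indicator) auto
  qed (auto simp: indicator_def)
  then have "(\<lambda>n. \<phi> (translate_integral (E \<inter> ?J n))) \<longlonglongrightarrow> (LINT t:E|lebesgue. ?g t)"
    using \<phi>_translate_integral_bounded[OF E, of "- real n" "real n" for n] by (simp add: set_lebesgue_integral_def)
  with conv show ?thesis by (rule LIMSEQ_unique)
qed

end

text \<open>Agreement on \<open>A\<close> is all that can be asked, because
  \<open>translation t\<close> is a left shift only for \<open>t \<ge> 0\<close>. The bound of a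
  functional is replaced by its absolute value to make it nonnegative.\<close>

lemma Pettis_integrable_translate:
  assumes A: "A \<in> sets lebesgue" and G: "\<And>t. t \<in> A \<Longrightarrow> G t = translate t"
  shows "Pettis_integrable_on X N G A"
proof -
  have bound: "\<exists>C\<ge>0. \<forall>x\<in>X. \<bar>\<phi> x\<bar> \<le> C * N x" if \<phi>: "\<phi> \<in> dual_space X N" for \<phi>
  proof -
    obtain C where C: "\<forall>x\<in>X. \<bar>\<phi> x\<bar> \<le> C * N x" using \<phi> unfolding dual_space_def by blast
    have "\<bar>\<phi> x\<bar> \<le> \<bar>C\<bar> * N x" if "x \<in> X" for x
      using bspec[OF C that] mult_right_mono[OF abs_ge_self N_nonneg, of C x] by linarith
    then show ?thesis by (intro exI[of _ "\<bar>C\<bar>"]) auto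
  qed
  show ?thesis
    unfolding Pettis_integrable_on_def
  proof (intro conjI ballI impI)
    show "G ` A \<subseteq> X" using G translate_X by auto
  next
    fix \<phi> assume \<phi>: "\<phi> \<in> dual_space X N"
    obtain C where "0 \<le> C" "\<And>x. x \<in> X \<Longrightarrow> \<bar>\<phi> x\<bar> \<le> C * N x" using bound[OF \<phi>] by blast
    then have "integrable lebesgue (\<lambda>t. \<phi> (translate t))" by (rule \<phi>_translate_integrable[OF \<phi>])
    then have "integrable (lebesgue_on A) (\<lambda>t. \<phi> (translate t))"
      using A by (subst integrable_restrict_space) (auto simp del: real_scaleR_def intro: integrable_mult_indicator)
    then show "integrable (lebesgue_on A) (\<lambda>t. \<phi> (G t))"
      by (rule Bochner_Integration.integrable_cong[THEN iffD1, rotated -1]) (auto simp: G)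
  next
    fix E assume E: "E \<in> sets lebesgue" "E \<subseteq> A"
    show "\<exists>z\<in>X. \<forall>\<phi>\<in>dual_space X N. \<phi> z = (\<integral>t. \<phi> (G t) \<partial>lebesgue_on E)"
    proof (intro bexI[of _ "translate_integral E"] ballI translate_integral_X E)
      fix \<phi> assume \<phi>: "\<phi> \<in> dual_space X N"
      obtain C where "0 \<le> C" "\<And>x. x \<in> X \<Longrightarrow> \<bar>\<phi> x\<bar> \<le> C * N x" using bound[OF \<phi>] by blast
      then have "\<phi> (translate_integral E) = (LINT t:E|lebesgue. \<phi> (translate t))"
        by (rule \<phi>_translate_integral[OF \<phi> _ _ E(1)])
      also have "\<dots> = (\<integral>t. \<phi> (translate t) \<partial>lebesgue_on E)"
        unfolding set_lebesgue_integral_def using E by (subst integral_restrict_space) auto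
      also have "\<dots> = (\<integral>t. \<phi> (G t) \<partial>lebesgue_on E)"
        using E by (intro Bochner_Integration.integral_cong) (auto simp: G)
      finally show "\<phi> (translate_integral E) = (\<integral>t. \<phi> (G t) \<partial>lebesgue_on E)" .
    qed
  qed
qed

end

text \<open>\<open>S t\<close> shifts a chosen representative \<open>r x\<close> to the right. The
  identities hold because both sides of \<open>translation t (S q x) = S (q - t) x\<close> shift the
  same representative; for \<open>q = t\<close> it is \<open>r x\<close> itself.\<close>

lemma frequent_hypercyclicity_criterion_holds:
  "frequent_hypercyclicity_criterion X N translation"
proof -
  define X0 where "X0 = abs_fclass ` test_functions"
  define r where "r x = (SOME f. f \<in> test_functions \<and> x = abs_fclass f)" for x
  define S where "S t x = abs_fclass (\<lambda>s. r x (s - t))" for t :: real and x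
  have r: "r x \<in> test_functions" "x = abs_fclass (r x)" if "x \<in> X0" for x
    using someI_ex[of "\<lambda>f. f \<in> test_functions \<and> x = abs_fclass f"] that by (auto simp: X0_def r_def)
  have m: "(\<lambda>s. r x (s - t)) \<in> borel_measurable half_line" if "x \<in> X0" "0 \<le> t" for x t
    by (intro test_functions_measurable_half_line test_functions_shift r that)
  have TS: "translation t (S q x) = S (q - t) x" if "x \<in> X0" "0 \<le> t" "0 \<le> q" for x t q
    using that m[OF that(1,3)] by (simp add: S_def translation_abs algebra_simps)
  show ?thesis
    unfolding frequent_hypercyclicity_criterion_def
  proof (intro exI[of _ X0] exI[of _ S] conjI allI ballI impI)
    show "dense_in_space X N X0"
      unfolding dense_iff
    proof (intro conjI ballI allI impI)
      show "X0 \<subseteq> X" using test_functions_in_X by (auto simp: X0_def)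
      fix x e assume "x \<in> X" "(0::real) < e"
      then show "\<exists>y\<in>X0. N (x - y) < e"
        using approximate_by_test_function by (metis X0_def imageI)
    qed
    show "S t x \<in> X0" if "0 < t" "x \<in> X0" for t x
      unfolding S_def X0_def using that by (intro imageI test_functions_shift r) auto
    show "translation t (S t x) = x" if "x \<in> X0" "0 < t" for x t
      using TS[of x t t] r(2)[of x] that by (simp add: S_def)
    show "translation t (S q x) = S (q - t) x" if "x \<in> X0" "0 < t" "t < q" for x t q
      using TS[of x t q] that by simp
    show "Pettis_integrable_on X N (\<lambda>t. translation t x) {0..}" if x: "x \<in> X0" for x
    proof (rule Pettis_integrable_translate[OF r(1)[OF x], of 1])
      fix t :: real assume "t \<in> {0..}"
      then show "translation t x = translate (r x) 1 t"
        using translation_abs[OF test_functions_measurable_half_line[OF r(1)[OF x]], of t] r(2)[OF x, symmetric]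
        by (simp add: translate_def[OF r(1)[OF x]])
    qed auto
    show "Pettis_integrable_on X N (\<lambda>t. S t x) {0<..}" if x: "x \<in> X0" for x
      by (rule Pettis_integrable_translate[OF r(1)[OF x], of "-1"])
        (auto simp: S_def translate_def r(1)[OF x])
  qed
qed

end

section \<open>The criterion forces integrability\<close>

text \<open>On classes that are not integrable over \<open>{a..b}\<close> the value is the default
  0; on the weighted space the integral exists. Lebesgue measure is taken without the weight, so
  that translation simply moves the interval.\<close>

lift_definition interval_functional :: "real \<Rightarrow> real \<Rightarrow> fclass \<Rightarrow> real"
  is "\<lambda>a b f. \<integral>t. indicator {a..b} t *\<^sub>R f t \<partial>half_line"
proof -
  fix a b f g assume "ae_eq f g"
  then have [measurable]: "f \<in> borel_measurable half_line" "g \<in> borel_measurable half_line"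
    and ae: "AE x in half_line. f x = g x" by (auto simp: ae_eq_def)
  show "(\<integral>t. indicator {a..b} t *\<^sub>R f t \<partial>half_line) = (\<integral>t. indicator {a..b} t *\<^sub>R g t \<partial>half_line)"
    by (rule integral_cong_AE) (measurable, use ae in auto)
qed

lemma interval_functional_abs:
  assumes "u \<in> borel_measurable half_line" "0 \<le> a"
  shows "interval_functional a b (abs_fclass u) = (LINT t:{a..b}|lebesgue. u t)"
proof -
  have "interval_functional a b (abs_fclass u) = (\<integral>t. indicator {a..b} t *\<^sub>R u t \<partial>half_line)"
    using assms by (simp add: interval_functional.abs_eq ae_eq_refl_iff)
  also have "\<dots> = (\<integral>t. indicator {0..} t *\<^sub>R indicator {a..b} t *\<^sub>R u t \<partial>lebesgue)"
    by (subst integral_restrict_space) auto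
  also have "\<dots> = (LINT t:{a..b}|lebesgue. u t)"
    unfolding set_lebesgue_integral_def using assms(2)
    by (intro Bochner_Integration.integral_cong refl) (auto simp: indicator_def)
  finally show ?thesis .
qed

lemma interval_functional_translation:
  assumes "0 \<le> a" "0 \<le> t"
  shows "interval_functional a b (translation t x) = interval_functional (a + t) (b + t) x"
proof -
  obtain u where u: "u \<in> borel_measurable half_line" "x = abs_fclass u" by (rule fclass_cases)
  have "interval_functional a b (translation t x) = (\<integral>s. indicator {a..b} s *\<^sub>R u (s + t) \<partial>lebesgue)"
    using u assms by (simp add: translation_abs interval_functional_abs shift_measurable set_lebesgue_integral_def)
  also have "\<dots> = (\<integral>s. indicator {a + t..b + t} (t + 1 * s) *\<^sub>R u (t + 1 * s) \<partial>lebesgue)"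
    by (intro Bochner_Integration.integral_cong refl) (auto simp: indicator_def add.commute)
  also have "\<dots> = (\<integral>s. indicator {a + t..b + t} s *\<^sub>R u s \<partial>lebesgue)"
    using lebesgue_integral_real_affine[of 1 "\<lambda>s. indicator {a + t..b + t} s *\<^sub>R u s" t] by simp
  also have "\<dots> = interval_functional (a + t) (b + t) x"
    using u assms by (simp add: interval_functional_abs set_lebesgue_integral_def)
  finally show ?thesis .
qed

text \<open>The sets \<open>{..a}\<close> generate the Borel sets and are stable under intersection,
  so by a Dynkin argument the integral vanishes over all Borel sets, in particular over those where
  \<open>g\<close> is positive or negative.\<close>

lemma AE_zero_if_integrals_zero:
  fixes g :: "real \<Rightarrow> real"
  assumes g: "integrable lborel g" and 0: "\<And>a. (LINT t:{..a}|lborel. g t) = 0"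
  shows "AE t in lborel. g t = 0"
proof -
  have si: "set_integrable lborel A g" if "A \<in> sets borel" for A
    unfolding set_integrable_def using g that by (intro integrable_mult_indicator) auto
  have UNIV: "(LINT t:UNIV|lborel. g t) = 0"
  proof -
    have "(\<lambda>n. LINT t:{..real n}|lborel. g t) \<longlonglongrightarrow> (LINT t:(\<Union>n. {..real n})|lborel. g t)"
      by (intro set_integral_cont_up si) (auto simp: incseq_def)
    moreover have "(\<Union>n. {..real n}) = UNIV" using real_arch_simple by auto
    ultimately show ?thesis by (simp add: 0 LIMSEQ_const_iff)
  qed
  have borel0: "(LINT t:A|lborel. g t) = 0" if A: "A \<in> sets borel" for A
  proof -
    have A': "A \<in> sigma_sets UNIV (range (\<lambda>a::real. {..a}))"
      using A by (simp add: borel_eq_atMost)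
    have "Int_stable (range (\<lambda>a::real. {..a}))" by (auto simp: Int_stable_def)
    moreover have "range (\<lambda>a::real. {..a}) \<subseteq> Pow UNIV" by simp
    ultimately show ?thesis using A'
    proof (induction rule: sigma_sets_induct_disjoint)
      case (compl A)
      then have A: "A \<in> sets borel" by (simp add: borel_eq_atMost)
      have "(LINT t:A \<union> (UNIV - A)|lborel. g t) = (LINT t:A|lborel. g t) + (LINT t:UNIV - A|lborel. g t)"
        using A by (intro set_integral_Un si) auto
      then show ?case using compl UNIV by simp
    next
      case (union A)
      then have A: "A i \<in> sets borel" for i by (auto simp: borel_eq_atMost)
      have "(LINT t:(\<Union>i. A i)|lborel. g t) = (\<Sum>i. LINT t:A i|lborel. g t)"
        using A union(1) by (intro lebesgue_integral_countable_add si) (auto simp: disjoint_family_on_def)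
      then show ?case using union by simp
    qed (use 0 in \<open>auto simp: set_lebesgue_integral_def\<close>)
  qed
  have [measurable]: "g \<in> borel_measurable borel" using borel_measurable_integrable[OF g] by simp
  have P: "{t. g t > 0} \<in> sets borel" "{t. g t < 0} \<in> sets borel" by measurable
  have "AE t in lborel. indicator {t. g t > 0} t *\<^sub>R g t = 0"
  proof (subst integral_nonneg_eq_0_iff_AE[symmetric])
    show "integrable lborel (\<lambda>t. indicator {t. g t > 0} t *\<^sub>R g t)"
      using si[OF P(1)] by (simp add: set_integrable_def)
  qed (use borel0[OF P(1)] in \<open>auto simp: set_lebesgue_integral_def indicator_def\<close>)
  moreover have "AE t in lborel. - (indicator {t. g t < 0} t *\<^sub>R g t) = 0"
  proof (subst integral_nonneg_eq_0_iff_AE[symmetric])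
    show "integrable lborel (\<lambda>t. - (indicator {t. g t < 0} t *\<^sub>R g t))"
      using si[OF P(2)] by (simp add: set_integrable_def)
  qed (use borel0[OF P(2)] in \<open>auto simp: set_lebesgue_integral_def indicator_def\<close>)
  ultimately show ?thesis by eventually_elim (auto simp: indicator_def split: if_splits)
qed

text \<open>\<open>G 0\<close> is the one-sided derivative at 0 of the indefinite integral, which is
  constantly 0.\<close>

lemma continuous_zero_if_integrals_zero:
  fixes G :: "real \<Rightarrow> real"
  assumes G: "continuous_on {0..1} G" and 0: "\<And>\<beta>. 0 \<le> \<beta> \<Longrightarrow> \<beta> \<le> 1 \<Longrightarrow> integral {0..\<beta>} G = 0"
  shows "G 0 = 0"
proof -
  have "((\<lambda>x. integral {0..x} G) has_vector_derivative G 0) (at 0 within {0..1})"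
    by (rule integral_has_vector_derivative[OF G]) simp
  then have "((\<lambda>x. 0) has_vector_derivative G 0) (at 0 within {0..1})"
    by (rule has_vector_derivative_transform_within[where d = 1]) (auto simp: 0)
  then show ?thesis
    using vector_derivative_unique_within_closed_interval[of 0 1 0 "\<lambda>x. 0" "G 0" 0] by auto
qed

section \<open>Interval functionals on the weighted space, and the criterion\<close>

context weighted_Lp
begin

text \<open>The pointwise inequality \<open>\<bar>u\<bar> \<le> A + A powr (1 - p) * \<bar>u\<bar>
  powr p\<close>, clear if \<open>\<bar>u\<bar> \<le> A\<close> and otherwise due to
  \<open>\<bar>u\<bar> powr (1 - p) \<le> A powr (1 - p)\<close>, takes the place of Hoelder's
  inequality and covers \<open>p = 1\<close>. With \<rho> at least \<open>c\<close> on
  \<open>[0, b]\<close>, integration gives \<open>A * (b - a) + A / c\<close> for every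
  \<open>A\<close> above the norm. Such an \<open>A\<close> is positive even when the norm is 0; in
  the limit it becomes the norm.\<close>

lemma interval_functional_bound:
  assumes ab: "0 \<le> a" "a \<le> b"
  obtains C where "0 \<le> C" "\<And>u. u \<in> borel_measurable half_line \<Longrightarrow> abs_fclass u \<in> X \<Longrightarrow>
      set_integrable lebesgue {a..b} u \<and> \<bar>interval_functional a b (abs_fclass u)\<bar> \<le> C * N (abs_fclass u)"
proof -
  obtain K where K: "K > 0" "\<And>\<tau> t. 0 \<le> \<tau> \<Longrightarrow> 0 \<le> t \<Longrightarrow> t \<le> b \<Longrightarrow> \<rho> \<tau> \<le> K * \<rho> (\<tau> + t)"
    using weight_step[of b] ab by auto
  define c where "c = \<rho> 0 / K"
  have c: "c > 0" using K weight_pos by (simp add: c_def)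
  have c_le: "c \<le> \<rho> s" if "0 \<le> s" "s \<le> b" for s
    using K(2)[of 0 s] K(1) that by (simp add: c_def field_simps)
  define C where "C = (b - a) + 1 / c"
  have C0: "0 \<le> C" using ab c by (simp add: C_def)
  show thesis
  proof (rule that[OF C0])
    fix u assume u [measurable]: "u \<in> borel_measurable half_line" and x: "abs_fclass u \<in> X"
    let ?x = "abs_fclass u"
    have um: "(\<lambda>t. indicator {a..b} t *\<^sub>R u t) \<in> borel_measurable lebesgue"
    proof -
      have "(\<lambda>t. indicator {0..} t *\<^sub>R u t) \<in> borel_measurable lebesgue"
        using u by (subst (asm) borel_measurable_restrict_space_iff) auto
      then have "(\<lambda>t. indicator {a..b} t *\<^sub>R (indicator {0..} t *\<^sub>R u t)) \<in> borel_measurable lebesgue"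
        by measurable
      moreover have "(\<lambda>t. indicator {a..b} t *\<^sub>R (indicator {0..} t *\<^sub>R u t)) = (\<lambda>t. indicator {a..b} t *\<^sub>R u t)"
        using ab by (auto simp: fun_eq_iff indicator_def)
      ultimately show ?thesis by simp
    qed
    have "(\<lambda>t. ennreal (\<bar>u t\<bar> powr p * \<rho> t)) \<in> borel_measurable half_line" by measurable
    then have Im: "(\<lambda>t. ennreal (\<bar>u t\<bar> powr p * \<rho> t) * indicator {0..} t) \<in> borel_measurable lebesgue"
      by (subst (asm) borel_measurable_restrict_space_iff_ennreal) auto
    have bound: "(\<integral>\<^sup>+t. ennreal (norm (indicator {a..b} t *\<^sub>R u t)) \<partial>lebesgue) \<le> ennreal (A * C)" if A: "N ?x < A" for A
    proof -
      have A0: "A > 0" using A N_nonneg[of ?x] by linarith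
      have "(\<integral>\<^sup>+t. ennreal (norm (indicator {a..b} t *\<^sub>R u t)) \<partial>lebesgue) \<le>
          (\<integral>\<^sup>+t. ennreal A * indicator {a..b} t + ennreal (A powr (1 - p) / c) * (ennreal (\<bar>u t\<bar> powr p * \<rho> t) * indicator {0..} t) \<partial>lebesgue)"
      proof (intro nn_integral_mono)
        fix t
        show "ennreal (norm (indicator {a..b} t *\<^sub>R u t)) \<le> ennreal A * indicator {a..b} t + ennreal (A powr (1 - p) / c) * (ennreal (\<bar>u t\<bar> powr p * \<rho> t) * indicator {0..} t)"
        proof (cases "t \<in> {a..b}")
          case True
          then have t: "0 \<le> t" "t \<le> b" using ab by auto
          have "\<bar>u t\<bar> \<le> A + A powr (1 - p) * \<bar>u t\<bar> powr p"
          proof (cases "\<bar>u t\<bar> \<le> A")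
            case False
            then have "\<bar>u t\<bar> = \<bar>u t\<bar> powr (1 - p) * \<bar>u t\<bar> powr p" using A0 by (simp add: powr_add[symmetric])
            also have "\<dots> \<le> A powr (1 - p) * \<bar>u t\<bar> powr p"
              using False A0 p by (intro mult_right_mono powr_mono2') auto
            finally show ?thesis using A0 by simp
          qed (simp add: add_increasing2)
          also have "A powr (1 - p) * \<bar>u t\<bar> powr p \<le> A powr (1 - p) / c * (\<bar>u t\<bar> powr p * \<rho> t)"
          proof -
            have "A powr (1 - p) * \<bar>u t\<bar> powr p = A powr (1 - p) / c * (\<bar>u t\<bar> powr p * c)" using c by simp
            also have "\<dots> \<le> A powr (1 - p) / c * (\<bar>u t\<bar> powr p * \<rho> t)"
              using c c_le[OF t] by (intro mult_left_mono) auto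
            finally show ?thesis .
          qed
          finally show ?thesis
            using True t A0 c weight_nonneg[OF t(1)]
            by (simp add: ennreal_mult'[symmetric] ennreal_plus[symmetric] ennreal_leI del: ennreal_plus)
        qed simp
      qed
      also have "\<dots> = (\<integral>\<^sup>+t. ennreal A * indicator {a..b} t \<partial>lebesgue) + (\<integral>\<^sup>+t. ennreal (A powr (1 - p) / c) * (ennreal (\<bar>u t\<bar> powr p * \<rho> t) * indicator {0..} t) \<partial>lebesgue)"
        by (rule nn_integral_add) (use Im in measurable)
      also have "(\<integral>\<^sup>+t. ennreal A * indicator {a..b} t \<partial>lebesgue) = ennreal (A * (b - a))"
        using ab A0 by (subst nn_integral_cmult_indicator) (auto simp: ennreal_mult')
      also have "(\<integral>\<^sup>+t. ennreal (A powr (1 - p) / c) * (ennreal (\<bar>u t\<bar> powr p * \<rho> t) * indicator {0..} t) \<partial>lebesgue) = ennreal (A powr (1 - p) / c) * I ?x"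
        unfolding Lp_integral_abs[OF u] by (subst nn_integral_cmult[OF Im]) (simp add: nn_integral_restrict_space)
      also have "\<dots> \<le> ennreal (A powr (1 - p) / c) * ennreal (A powr p)"
        unfolding I_eq_N[OF x] using A p by (intro mult_left_mono ennreal_leI powr_mono2) auto
      also have "\<dots> = ennreal (A / c)"
        using A0 c by (simp add: ennreal_mult'[symmetric] powr_add[symmetric])
      also have "ennreal (A * (b - a)) + ennreal (A / c) = ennreal (A * C)"
        using A0 c ab by (simp add: C_def ennreal_plus[symmetric] algebra_simps del: ennreal_plus)
      finally show ?thesis by (simp add: add_left_mono)
    qed
    have int: "integrable lebesgue (\<lambda>t. indicator {a..b} t *\<^sub>R u t)"
      using bound[of "N ?x + 1"] by (intro integrableI_bounded um) (auto simp: le_less_trans)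
    have le_A: "\<bar>LINT t:{a..b}|lebesgue. u t\<bar> \<le> A * C" if A: "N ?x < A" for A
    proof -
      have "ennreal (norm (\<integral>t. indicator {a..b} t *\<^sub>R u t \<partial>lebesgue)) \<le> (\<integral>\<^sup>+t. ennreal (norm (indicator {a..b} t *\<^sub>R u t)) \<partial>lebesgue)"
        by (rule integral_norm_bound_ennreal[OF int])
      also have "\<dots> \<le> ennreal (A * C)" by (rule bound[OF A])
      finally show ?thesis
        using A N_nonneg[of ?x] C0 by (simp add: set_lebesgue_integral_def)
    qed
    have le: "\<bar>LINT t:{a..b}|lebesgue. u t\<bar> \<le> C * (N ?x + e)" if "0 < e" for e
      using le_A[of "N ?x + e"] that by (simp add: mult.commute)
    have "\<bar>LINT t:{a..b}|lebesgue. u t\<bar> \<le> C * N ?x"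
    proof (rule field_le_epsilon)
      fix e :: real assume e: "0 < e"
      have "\<bar>LINT t:{a..b}|lebesgue. u t\<bar> \<le> C * (N ?x + e / (C + 1))" using e C0 by (intro le) simp
      also have "\<dots> \<le> C * N ?x + e" using e C0 by (simp add: field_simps)
      finally show "\<bar>LINT t:{a..b}|lebesgue. u t\<bar> \<le> C * N ?x + e" .
    qed
    then show "set_integrable lebesgue {a..b} u \<and> \<bar>interval_functional a b ?x\<bar> \<le> C * N ?x"
      using int ab by (simp add: set_integrable_def interval_functional_abs[OF u])
  qed
qed

lemma interval_integrable:
  assumes "u \<in> borel_measurable half_line" "abs_fclass u \<in> X" "0 \<le> a" "a \<le> b"
  shows "set_integrable lebesgue {a..b} u"
  using interval_functional_bound[OF assms(3,4)] assms(1,2) by metis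

lemma interval_functional_dual:
  assumes ab: "0 \<le> a" "a \<le> b"
  shows "interval_functional a b \<in> dual_space X N"
  unfolding dual_space_def
proof (intro CollectI conjI ballI allI)
  fix x y assume xy: "x \<in> X" "y \<in> X"
  obtain u v where u: "u \<in> borel_measurable half_line" "x = abs_fclass u"
    and v: "v \<in> borel_measurable half_line" "y = abs_fclass v"
    by (metis fclass_cases)
  have "(\<lambda>t. u t + v t) \<in> borel_measurable half_line" using u v by measurable
  then show "interval_functional a b (x + y) = interval_functional a b x + interval_functional a b y"
    using u v xy ab by (simp add: plus_abs interval_functional_abs set_integral_add interval_integrable)
next
  fix c x assume x: "x \<in> X"
  obtain u where u: "u \<in> borel_measurable half_line" "x = abs_fclass u"
    by (metis fclass_cases)
  have "(\<lambda>t. c * u t) \<in> borel_measurable half_line" using u by measurable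
  then show "interval_functional a b (c *\<^sub>R x) = c * interval_functional a b x"
    using u x ab by (simp add: scaleR_abs interval_functional_abs)
next
  obtain C where "\<And>u. u \<in> borel_measurable half_line \<Longrightarrow> abs_fclass u \<in> X \<Longrightarrow>
      \<bar>interval_functional a b (abs_fclass u)\<bar> \<le> C * N (abs_fclass u)"
    using interval_functional_bound[OF ab] by metis
  then have "\<forall>x\<in>X. \<bar>interval_functional a b x\<bar> \<le> C * N x"
    by (metis fclass_cases)
  then show "\<exists>C. \<forall>x\<in>X. \<bar>interval_functional a b x\<bar> \<le> C * N x" ..
qed

text \<open>Restricted to \<open>[0, n]\<close> the function is integrable, and its integrals over
  the sets \<open>{..a}\<close> are among the values assumed to vanish. A Borel version
  \<open>g\<close> of the restriction allows the passage between the two forms of Lebesgue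
  measure.\<close>

lemma zero_if_interval_functionals_zero:
  assumes x: "x \<in> X" and 0: "\<And>a b. 0 \<le> a \<Longrightarrow> a \<le> b \<Longrightarrow> interval_functional a b x = 0"
  shows "x = 0"
proof -
  obtain u where u: "u \<in> borel_measurable half_line" "x = abs_fclass u" by (rule fclass_cases)
  have "AE t in lebesgue. t \<in> {0..real n} \<longrightarrow> u t = 0" for n
  proof -
    have i: "integrable lebesgue (\<lambda>t. indicator {0..real n} t *\<^sub>R u t)"
      using interval_integrable[of u 0 "real n"] u x by (simp add: set_integrable_def)
    then obtain g where g: "g \<in> borel_measurable lborel" and ug: "AE t in lborel. indicator {0..real n} t *\<^sub>R u t = g t"
      using completion_ex_borel_measurable_real[OF borel_measurable_integrable[OF i]] by blast
    have ug': "AE t in lebesgue. indicator {0..real n} t *\<^sub>R u t = g t" by (rule AE_completion[OF ug])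
    have gm: "g \<in> borel_measurable lebesgue" using g by (rule measurable_completion)
    have gi: "integrable lborel g"
      using integrable_cong_AE[OF borel_measurable_integrable[OF i] gm ug'] i g by (simp add: integrable_completion)
    have "(LINT t:{..a}|lborel. g t) = 0" for a
    proof -
      have "(LINT t:{..a}|lborel. g t) = (LINT t:{..a}|lebesgue. g t)"
        unfolding set_lebesgue_integral_def using g
        by (intro integral_completion[symmetric] borel_measurable_scaleR borel_measurable_indicator) auto
      also have "\<dots> = (\<integral>t. indicator {..a} t *\<^sub>R (indicator {0..real n} t *\<^sub>R u t) \<partial>lebesgue)"
        unfolding set_lebesgue_integral_def using ug' gm borel_measurable_integrable[OF i]
        by (intro integral_cong_AE) (auto intro!: borel_measurable_scaleR borel_measurable_indicator elim: eventually_mono)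
      also have "\<dots> = (\<integral>t. indicator {0..min a (real n)} t *\<^sub>R u t \<partial>lebesgue)"
        by (intro Bochner_Integration.integral_cong refl) (auto simp: indicator_def)
      also have "\<dots> = 0"
      proof (cases "0 \<le> min a (real n)")
        case True
        then show ?thesis using 0[of 0 "min a (real n)"] u by (simp add: interval_functional_abs set_lebesgue_integral_def)
      next
        case False
        then have "{0..min a (real n)} = {}" by auto
        then show ?thesis by simp
      qed
      finally show ?thesis .
    qed
    then have "AE t in lborel. g t = 0" by (rule AE_zero_if_integrals_zero[OF gi])
    then have "AE t in lebesgue. g t = 0" by (rule AE_completion)
    with ug' show ?thesis by eventually_elim auto
  qed
  then have "AE t in lebesgue. \<forall>n. t \<in> {0..real n} \<longrightarrow> u t = 0" unfolding AE_all_countable by blast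
  then have "AE t in lebesgue. t \<in> {0..} \<longrightarrow> u t = 0"
  proof eventually_elim
    case (elim t)
    then show ?case using real_arch_simple[of t] by auto
  qed
  then have "AE t in half_line. u t = 0" by (subst AE_restrict_space_iff) auto
  then show ?thesis using u by (simp add: zero_abs abs_fclass_eq_iff)
qed

lemma nonzero_element: obtains y where "y \<in> X" "y \<noteq> 0"
proof -
  define w :: "real \<Rightarrow> real" where "w = indicator {0..1}"
  have w [measurable]: "w \<in> borel_measurable half_line" unfolding w_def by measurable
  have wX: "abs_fclass w \<in> X"
    using w by (rule bounded_support_in_X[of _ 1 2]) (auto simp: w_def indicator_def)
  have "interval_functional 0 1 (abs_fclass w) = 1"
    using w by (simp add: interval_functional_abs set_lebesgue_integral_def w_def indicator_inter_arith[symmetric])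
  moreover have "interval_functional 0 1 0 = 0"
    by (simp add: zero_abs interval_functional_abs set_lebesgue_integral_def)
  ultimately have "abs_fclass w \<noteq> 0" by auto
  then show thesis by (rule that[OF wX])
qed

text \<open>An element closer to some y \<noteq> 0 than \<open>N y\<close> cannot be 0.\<close>

lemma dense_imp_nonzero_element:
  assumes "dense_in_space X N D" obtains x where "x \<in> D" "x \<noteq> 0"
proof -
  obtain y where y: "y \<in> X" "y \<noteq> 0" by (rule nonzero_element)
  have "N y > 0" using y Lp_norm_eq_0[OF p \<rho> y(1)] N_nonneg[of y] by linarith
  then obtain x where x: "x \<in> D" "N (y - x) < N y" using assms y(1) unfolding dense_iff by blast
  have "x \<noteq> 0" using x(2) by auto
  with x(1) show thesis by (rule that)
qed

text \<open>By contraposition: if the weight is not integrable, 0 is the only periodic point, and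
  every element of \<open>X0\<close> turns out to be 0, against density. The functional along the
  orbit, \<open>G t\<close>, is integrable on the line and has integral 0 over each periodic set of
  times; passing to a single interval and then to its left end gives \<open>G 0 = 0\<close>, the
  value of the functional at \<open>x\<close>.\<close>

lemma criterion_imp_integrable_weight:
  assumes crit: "frequent_hypercyclicity_criterion X N translation"
  shows "(\<integral>\<^sup>+t. ennreal (\<rho> t) \<partial>half_line) < \<infinity>"
proof (rule ccontr)
  assume "\<not> ?thesis"
  then have no_per: "z = 0" if "z \<in> X" "0 < P" "translation P z = z" for z P
    using nontrivial_periodic_imp_integrable_weight[of z P] that by blast
  obtain X0 S where XS: "dense_in_space X N X0 \<and>
        (\<forall>t>0. \<forall>x\<in>X0. S t x \<in> X0) \<and>
        (\<forall>x\<in>X0. \<forall>t>0. translation t (S t x) = x) \<and>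
        (\<forall>x\<in>X0. \<forall>t>0. \<forall>r>t. translation t (S r x) = S (r - t) x) \<and>
        (\<forall>x\<in>X0. Pettis_integrable_on X N (\<lambda>t. translation t x) {0..}) \<and>
        (\<forall>x\<in>X0. Pettis_integrable_on X N (\<lambda>t. S t x) {0<..})"
    using crit unfolding frequent_hypercyclicity_criterion_def by (elim exE)
  then have dense: "dense_in_space X N X0" by simp
  have TS: "translation t (S t x) = x" if "0 < t" "x \<in> X0" for t x
    using XS that by simp
  have TS': "translation t (S r x) = S (r - t) x" if "0 < t" "t < r" "x \<in> X0" for t r x
    using XS that by simp
  have PT: "Pettis_integrable_on X N (\<lambda>t. translation t x) {0..}"
    and PS: "Pettis_integrable_on X N (\<lambda>t. S t x) {0<..}" if "x \<in> X0" for x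
    using XS that by simp_all
  have X0_zero: "x = 0" if x: "x \<in> X0" for x
  proof -
    have xX: "x \<in> X" using dense x by (auto simp: dense_iff)
    define F where "F t = (if 0 \<le> t then translation t x else S (- t) x)" for t
    have TF: "translation P (F t) = F (t + P)" if P: "0 < P" for P t
    proof -
      consider "0 \<le> t" | "t < 0" "P < - t" | "t < 0" "P = - t" | "t < 0" "- t < P" by linarith
      then show ?thesis
      proof cases
        case 1
        then show ?thesis using P by (simp add: F_def translation_translation add.commute)
      next
        case 2
        then show ?thesis using TS'[OF P 2(2) x] by (simp add: F_def)
      next
        case 3
        then show ?thesis using TS[OF P x] by (simp add: F_def)
      next
        case 4
        \<comment> \<open>The orbit passes through \<open>x\<close> at time 0: translation by
          \<open>- t\<close> leads from \<open>S (- t) x\<close> to \<open>x\<close>, and the time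
          \<open>P + t\<close> remains.\<close>
        have "translation P (S (- t) x) = translation (P + t) (translation (- t) (S (- t) x))"
          using 4 by (simp add: translation_translation)
        then show ?thesis using TS[of "- t" x] x 4 by (simp add: F_def add.commute)
      qed
    qed
    have G_int: "integrable lebesgue (\<lambda>t. \<phi> (F t))" if \<phi>: "\<phi> \<in> dual_space X N" for \<phi>
    proof -
      have "integrable (lebesgue_on {0..}) (\<lambda>t. \<phi> (translation t x))"
        using PT[OF x] \<phi> by (simp add: Pettis_integrable_on_def)
      then have 1: "integrable lebesgue (\<lambda>t. indicator {0..} t *\<^sub>R \<phi> (translation t x))"
        by (subst (asm) integrable_restrict_space) auto
      have "integrable (lebesgue_on {0<..}) (\<lambda>t. \<phi> (S t x))"
        using PS[OF x] \<phi> by (simp add: Pettis_integrable_on_def)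
      then have "integrable lebesgue (\<lambda>t. indicator {0<..} t *\<^sub>R \<phi> (S t x))"
        by (subst (asm) integrable_restrict_space) auto
      then have 2: "integrable lebesgue (\<lambda>t. indicator {0<..} (0 + - 1 * t) *\<^sub>R \<phi> (S (0 + - 1 * t) x))"
        by (subst lebesgue_integrable_real_affine_iff[where f = "\<lambda>t. indicator {0<..} t *\<^sub>R \<phi> (S t x)"]) auto
      have "(\<lambda>t. \<phi> (F t)) = (\<lambda>t. indicator {0..} t *\<^sub>R \<phi> (translation t x) + indicator {0<..} (0 + - 1 * t) *\<^sub>R \<phi> (S (0 + - 1 * t) x))"
        by (auto simp: F_def fun_eq_iff indicator_def)
      then show ?thesis using Bochner_Integration.integrable_add[OF 1 2] by simp
    qed
    have Pettis: "\<exists>z\<in>X. \<forall>\<phi>\<in>dual_space X N. \<phi> z = (LINT t:E|lebesgue. \<phi> (F t))" if E: "E \<in> sets lebesgue" for E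
    proof -
      have E1: "E \<inter> {0..} \<in> sets lebesgue" using E by auto
      then obtain z1 where z1: "z1 \<in> X" "\<And>\<phi>. \<phi> \<in> dual_space X N \<Longrightarrow> \<phi> z1 = (\<integral>t. \<phi> (translation t x) \<partial>lebesgue_on (E \<inter> {0..}))"
        using PT[OF x] unfolding Pettis_integrable_on_def by (metis Int_lower2)
      define E2 where "E2 = {t. - t \<in> E \<and> 0 < t}"
      have E2: "E2 \<in> sets lebesgue"
      proof -
        have "(\<lambda>t::real. - t) \<in> lebesgue \<rightarrow>\<^sub>M lebesgue"
          using lebesgue_affine_measurable[of "\<lambda>_. -1" "0::real"] by simp
        then have "(\<lambda>t. - t) -` E \<inter> space lebesgue \<in> sets lebesgue" using E by (rule measurable_sets)
        then have "(\<lambda>t. - t) -` E \<inter> {0<..} \<in> sets lebesgue" by auto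
        moreover have "(\<lambda>t. - t) -` E \<inter> {0<..} = E2" by (auto simp: E2_def)
        ultimately show ?thesis by simp
      qed
      moreover have "E2 \<subseteq> {0<..}" by (auto simp: E2_def)
      ultimately obtain z2 where z2: "z2 \<in> X" "\<And>\<phi>. \<phi> \<in> dual_space X N \<Longrightarrow> \<phi> z2 = (\<integral>t. \<phi> (S t x) \<partial>lebesgue_on E2)"
        using PS[OF x] unfolding Pettis_integrable_on_def by metis
      have "\<phi> (z1 + z2) = (LINT t:E|lebesgue. \<phi> (F t))" if \<phi>: "\<phi> \<in> dual_space X N" for \<phi>
      proof -
        have si: "set_integrable lebesgue A (\<lambda>t. \<phi> (F t))" if "A \<in> sets lebesgue" for A
          unfolding set_integrable_def by (rule integrable_mult_indicator[OF that G_int[OF \<phi>]])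
        have "\<phi> z2 = (\<integral>t. indicator E2 t *\<^sub>R \<phi> (S t x) \<partial>lebesgue)"
          using z2(2)[OF \<phi>] E2 by (simp add: integral_restrict_space)
        also have "\<dots> = (\<integral>t. indicator E2 (0 + - 1 * t) *\<^sub>R \<phi> (S (0 + - 1 * t) x) \<partial>lebesgue)"
          using lebesgue_integral_real_affine[of "- 1" "\<lambda>t. indicator E2 t *\<^sub>R \<phi> (S t x)" 0] by simp
        also have "\<dots> = (LINT t:E \<inter> {..<0}|lebesgue. \<phi> (F t))"
          unfolding set_lebesgue_integral_def
          by (intro Bochner_Integration.integral_cong refl) (auto simp: F_def E2_def indicator_def)
        finally have 2: "\<phi> z2 = (LINT t:E \<inter> {..<0}|lebesgue. \<phi> (F t))" .
        have "\<phi> z1 = (\<integral>t. indicator (E \<inter> {0..}) t *\<^sub>R \<phi> (translation t x) \<partial>lebesgue)"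
          using z1(2)[OF \<phi>] E1 by (simp add: integral_restrict_space)
        also have "\<dots> = (LINT t:E \<inter> {0..}|lebesgue. \<phi> (F t))"
          unfolding set_lebesgue_integral_def
          by (intro Bochner_Integration.integral_cong refl) (auto simp: F_def indicator_def)
        finally have 1: "\<phi> z1 = (LINT t:E \<inter> {0..}|lebesgue. \<phi> (F t))" .
        have "\<phi> (z1 + z2) = \<phi> z1 + \<phi> z2" using \<phi> z1 z2 by (simp add: dual_space_def)
        also have "\<dots> = (LINT t:(E \<inter> {0..}) \<union> (E \<inter> {..<0})|lebesgue. \<phi> (F t))"
          unfolding 1 2 using E by (intro set_integral_Un[symmetric] si) auto
        also have "(E \<inter> {0..}) \<union> (E \<inter> {..<0}) = E" by auto
        finally show ?thesis .
      qed
      then show ?thesis using X_add[OF z1(1) z2(1)] by blast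
    qed
    have zero: "interval_functional a b x = 0" if ab: "0 \<le> a" "a \<le> b" for a b
    proof -
      define G where "G t = interval_functional a b (F t)" for t
      have Gi: "integrable lebesgue G" unfolding G_def by (rule G_int[OF interval_functional_dual[OF ab]])
      have [measurable]: "G \<in> borel_measurable lebesgue" using Gi by simp
      have G_interval: "(LINT t:{0..\<beta>}|lebesgue. G t) = 0" if \<beta>: "0 \<le> \<beta>" for \<beta>
      proof -
        \<comment> \<open>A union of intervals of length \<beta> repeated with period
          \<open>P\<close>. Once \<open>P\<close> exceeds \<open>\<bar>t\<bar> + \<beta>\<close>, it
          contains \<open>t\<close> exactly if \<open>{0..\<beta>}\<close> does, so these sets
          converge to one interval as \<open>P\<close> grows.\<close>
        define E where "E P = (\<Union>n::int. {of_int n * P..of_int n * P + \<beta>})" for P :: real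
        have Em: "E P \<in> sets lebesgue" for P unfolding E_def by (intro sets.countable_UN') auto
        have E_per: "t + P \<in> E P \<longleftrightarrow> t \<in> E P" for t P
        proof
          assume "t + P \<in> E P"
          then obtain n where "t + P \<in> {of_int n * P..of_int n * P + \<beta>}" by (auto simp: E_def)
          then have "t \<in> {of_int (n - 1) * P..of_int (n - 1) * P + \<beta>}" by (auto simp: algebra_simps)
          then show "t \<in> E P" unfolding E_def by blast
        next
          assume "t \<in> E P"
          then obtain n where "t \<in> {of_int n * P..of_int n * P + \<beta>}" by (auto simp: E_def)
          then have "t + P \<in> {of_int (n + 1) * P..of_int (n + 1) * P + \<beta>}" by (auto simp: algebra_simps)
          then show "t + P \<in> E P" unfolding E_def by blast
        qed
        have EP0: "(LINT t:E P|lebesgue. G t) = 0" if P: "0 < P" for P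
        proof -
          obtain z where z: "z \<in> X" and zE: "\<And>\<phi>. \<phi> \<in> dual_space X N \<Longrightarrow> \<phi> z = (LINT t:E P|lebesgue. \<phi> (F t))"
            using Pettis[OF Em] by blast
          have Tz: "translation P z \<in> X" using z P by (simp add: translation_in_X)
          \<comment> \<open>Periodicity of \<open>z\<close> is tested on interval functionals.
            Composed with the translation, such a functional becomes the one of the shifted
            interval, so the Pettis property applies to it; the shift to \<open>t + P\<close> is
            then absorbed by the periodicity of \<open>E P\<close>.\<close>
          have "translation P z - z = 0"
          proof (rule zero_if_interval_functionals_zero)
            show "translation P z - z \<in> X" using z Tz by (intro X_diff)
            fix c d :: real assume cd: "0 \<le> c" "c \<le> d"
            let ?J = "interval_functional c d"
            have dual: "?J \<in> dual_space X N" by (rule interval_functional_dual[OF cd])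
            have "?J (translation P z) = interval_functional (c + P) (d + P) z"
              using cd P by (simp add: interval_functional_translation)
            also have "\<dots> = (LINT t:E P|lebesgue. interval_functional (c + P) (d + P) (F t))"
              using cd P by (intro zE interval_functional_dual) auto
            also have "\<dots> = (LINT t:E P|lebesgue. ?J (F (t + P)))"
              using cd P by (simp add: interval_functional_translation[symmetric] TF)
            also have "\<dots> = (\<integral>t. indicator (E P) (P + 1 * t) *\<^sub>R ?J (F (P + 1 * t)) \<partial>lebesgue)"
              unfolding set_lebesgue_integral_def
              by (intro Bochner_Integration.integral_cong refl) (simp add: E_per indicator_def add.commute[of P])
            also have "\<dots> = (LINT t:E P|lebesgue. ?J (F t))"
              unfolding set_lebesgue_integral_def
              using lebesgue_integral_real_affine[of 1 "\<lambda>t. indicator (E P) t *\<^sub>R ?J (F t)" P] by simp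
            also have "\<dots> = ?J z" by (rule zE[OF dual, symmetric])
            finally have eq: "?J (translation P z) = ?J z" .
            have "?J ((translation P z - z) + z) = ?J (translation P z - z) + ?J z"
              using dual z Tz X_diff unfolding dual_space_def by blast
            then show "?J (translation P z - z) = 0" using eq by simp
          qed
          then have "z = 0" using no_per[OF z P] by simp
          moreover have "interval_functional a b 0 = 0"
            using ab by (simp add: zero_abs interval_functional_abs set_lebesgue_integral_def)
          ultimately show ?thesis
            using zE[OF interval_functional_dual[OF ab]] by (simp add: G_def)
        qed
        have "(\<lambda>n. \<integral>t. indicator (E (real (Suc n))) t *\<^sub>R G t \<partial>lebesgue) \<longlonglongrightarrow> (\<integral>t. indicator {0..\<beta>} t *\<^sub>R G t \<partial>lebesgue)"
        proof (rule integral_dominated_convergence[where w = "\<lambda>t. \<bar>G t\<bar>"])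
          show "AE t in lebesgue. (\<lambda>n. indicator (E (real (Suc n))) t *\<^sub>R G t) \<longlonglongrightarrow> indicator {0..\<beta>} t *\<^sub>R G t"
          proof (rule AE_I2)
            fix t
            obtain n0 :: nat where n0: "\<bar>t\<bar> + \<beta> < real n0" using reals_Archimedean2 by blast
            have "t \<in> E P \<longleftrightarrow> t \<in> {0..\<beta>}" if P: "\<bar>t\<bar> + \<beta> < P" for P
            proof
              assume "t \<in> E P"
              then obtain n :: int where n: "of_int n * P \<le> t" "t \<le> of_int n * P + \<beta>" by (auto simp: E_def)
              have P0: "P > 0" using P \<beta> by linarith
              have "n = 0"
              proof (rule ccontr)
                assume "n \<noteq> 0"
                then consider "n \<ge> 1" | "n \<le> -1" by linarith
                then show False
                proof cases
                  case 1
                  then have "1 * P \<le> of_int n * P" using P0 by (intro mult_right_mono) auto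
                  then show False using n P \<beta> by linarith
                next
                  case 2
                  then have "of_int n * P \<le> of_int (- 1) * P" using P0 by (intro mult_right_mono) auto
                  then show False using n P by simp
                qed
              qed
              then show "t \<in> {0..\<beta>}" using n by simp
            next
              assume "t \<in> {0..\<beta>}"
              then show "t \<in> E P" unfolding E_def by (intro UN_I[of 0]) auto
            qed
            then have "\<forall>\<^sub>F n in sequentially. indicator {0..\<beta>} t *\<^sub>R G t = indicator (E (real (Suc n))) t *\<^sub>R G t"
              unfolding eventually_sequentially using n0 by (intro exI[of _ n0]) (auto simp: indicator_def)
            then show "(\<lambda>n. indicator (E (real (Suc n))) t *\<^sub>R G t) \<longlonglongrightarrow> indicator {0..\<beta>} t *\<^sub>R G t"
              by (rule Lim_transform_eventually[OF tendsto_const])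
          qed
          show "integrable lebesgue (\<lambda>t. \<bar>G t\<bar>)" using Gi by simp
          show "(\<lambda>t. indicator (E (real (Suc n))) t *\<^sub>R G t) \<in> borel_measurable lebesgue" for n
            using Em by (intro borel_measurable_scaleR borel_measurable_indicator) auto
        qed (auto simp: indicator_def)
        then show ?thesis
          using EP0 by (simp add: set_lebesgue_integral_def LIMSEQ_const_iff)
      qed
      obtain u where u: "u \<in> borel_measurable half_line" "x = abs_fclass u" by (rule fclass_cases)
      have int0: "interval_functional c d x = integral {0..d} u - integral {0..c} u" if "0 \<le> c" "c \<le> d" for c d
      proof -
        have i: "set_integrable lebesgue {0..d} u" "set_integrable lebesgue {c..d} u"
          using interval_integrable[of u] u xX that by auto
        have "interval_functional c d x = integral {c..d} u"
          using set_lebesgue_integral_eq_integral(2)[OF i(2)] u that by (simp add: interval_functional_abs)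
        also have "\<dots> = integral {0..d} u - integral {0..c} u"
          using Henstock_Kurzweil_Integration.integral_combine[of 0 c d u] set_lebesgue_integral_eq_integral(1)[OF i(1)] that by simp
        finally show ?thesis .
      qed
      \<comment> \<open>For \<open>t \<ge> 0\<close>, \<open>G t\<close> is a difference of two
        values of a primitive of \<open>u\<close>, hence continuous on
        \<open>[0, 1]\<close>.\<close>
      have G_eq: "G t = integral {0..b + t} u - integral {0..a + t} u" if "0 \<le> t" for t
        using ab that int0[of "a + t" "b + t"] by (simp add: G_def F_def interval_functional_translation)
      have u_int: "u integrable_on {0..b + 1}"
        using interval_integrable[of u 0 "b + 1"] u xX ab by (intro set_lebesgue_integral_eq_integral(1)) auto
      have cont: "continuous_on {0..b + 1} (\<lambda>t. integral {0..t} u)"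
        by (rule indefinite_integral_continuous_1[OF u_int])
      have "continuous_on {0..1} (\<lambda>t. integral {0..b + t} u - integral {0..a + t} u)"
        using ab by (intro continuous_on_diff continuous_on_compose2[OF cont] continuous_intros) auto
      then have Gc: "continuous_on {0..1} G" by (rule continuous_on_eq) (simp add: G_eq)
      have int_G: "integral {0..\<beta>} G = 0" if "0 \<le> \<beta>" for \<beta>
      proof -
        have "set_integrable lebesgue {0..\<beta>} G"
          unfolding set_integrable_def using Gi by (intro integrable_mult_indicator) auto
        then show ?thesis using G_interval[OF that] by (simp add: set_lebesgue_integral_eq_integral(2)[symmetric])
      qed
      have "G 0 = 0" by (rule continuous_zero_if_integrals_zero[OF Gc int_G])
      then show ?thesis by (simp add: G_def F_def)
    qed
    show "x = 0" using xX zero by (rule zero_if_interval_functionals_zero)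
  qed
  obtain x where x: "x \<in> X0" "x \<noteq> 0" by (rule dense_imp_nonzero_element[OF dense])
  then show False using X0_zero by blast
qed

end

section \<open>A frequently hypercyclic function\<close>

text \<open>The interval with index \<open>q\<close> ends by \<open>D * (q + 1)\<close>, so the
  first \<open>n\<close> of these disjoint intervals lie in \<open>[0, r]\<close> for
  \<open>n\<close> the floor of \<open>r / D\<close>, and this floor is at least
  \<open>r / (2 * D)\<close> once \<open>r \<ge> 2 * D\<close>.\<close>

lemma lower_density_pos:
  fixes b :: "nat \<Rightarrow> real"
  assumes A: "A \<in> sets lebesgue" and \<eta>: "0 < \<eta>" and D: "0 < D"
    and sub: "\<And>q. {b q..b q + \<eta>} \<subseteq> A" and b0: "\<And>q. 0 \<le> b q"
    and bD: "\<And>q. b q + \<eta> \<le> D * real (Suc q)" and gap: "\<And>q q'. q < q' \<Longrightarrow> b q + \<eta> < b q'"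
  shows "lower_density A > 0"
proof -
  have disj: "{b q..b q + \<eta>} \<inter> {b q'..b q' + \<eta>} = {}" if "q \<noteq> q'" for q q'
    using gap[of q q'] gap[of q' q] that by (cases "q < q'") auto
  have lower: "\<eta> / (2 * D) \<le> measure lebesgue (A \<inter> {0..r}) / r" if r: "2 * D \<le> r" for r
  proof -
    have r0: "0 < r" using r D by linarith
    define n where "n = nat \<lfloor>r / D\<rfloor>"
    have n: "real n \<le> r / D" "r / D < real n + 1" using r0 D by (auto simp: n_def)
    have "2 \<le> r / D" using r D by (simp add: field_simps)
    then have n2: "r / (2 * D) \<le> real n" using n(2) by (simp add: field_simps)
    have "real n * \<eta> = (\<Sum>q<n. measure lebesgue {b q..b q + \<eta>})" using \<eta> by simp
    also have "\<dots> = measure lebesgue (\<Union>q<n. {b q..b q + \<eta>})"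
      using disj by (intro measure_UNION'[symmetric]) (auto simp: pairwise_def disjnt_def)
    also have "\<dots> \<le> measure lebesgue (A \<inter> {0..r})"
    proof (rule measure_mono_fmeasurable)
      show "(\<Union>q<n. {b q..b q + \<eta>}) \<subseteq> A \<inter> {0..r}"
      proof safe
        fix q t assume q: "q < n" and t: "t \<in> {b q..b q + \<eta>}"
        show "t \<in> A" using sub t by blast
        have "D * real (Suc q) \<le> D * real n" using q D by (intro mult_left_mono) auto
        also have "\<dots> \<le> r" using n(1) D by (simp add: field_simps)
        finally show "t \<in> {0..r}" using t b0[of q] bD[of q] by auto
      qed
      show "A \<inter> {0..r} \<in> lmeasurable"
        by (rule fmeasurableI2[of "{0..r}"]) (use A in auto)
    qed auto
    finally have "real n * \<eta> \<le> measure lebesgue (A \<inter> {0..r})" .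
    moreover have "r / (2 * D) * \<eta> \<le> real n * \<eta>" using n2 \<eta> by (intro mult_right_mono) auto
    ultimately have "r / (2 * D) * \<eta> \<le> measure lebesgue (A \<inter> {0..r})" by linarith
    then show ?thesis using r0 D by (simp add: field_simps)
  qed
  have "ereal (\<eta> / (2 * D)) \<le> lower_density A"
    unfolding lower_density_def
  proof (rule Liminf_bounded)
    show "\<forall>\<^sub>F r in at_top. ereal (\<eta> / (2 * D)) \<le> ereal (measure lebesgue (A \<inter> {0..r}) / r)"
      unfolding eventually_at_top_linorder by (intro exI[of _ "2 * D"] allI impI) (simp only: ereal_less_eq lower)
  qed
  moreover have "0 < ereal (\<eta> / (2 * D))" using \<eta> D by simp
  ultimately show ?thesis by (rule less_le_trans[rotated])
qed

text \<open>With the tails \<open>R n\<close> of the series, \<open>h n = 1 / sqrt (R n)\<close>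
  tends to infinity, while \<open>h n * a n\<close> is at most
  \<open>2 * (sqrt (R n) - sqrt (R (Suc n)))\<close>, which telescopes.\<close>

lemma summable_with_unbounded_factor:
  fixes a :: "nat \<Rightarrow> real"
  assumes a: "summable a" "\<And>n. 0 \<le> a n"
  obtains h :: "nat \<Rightarrow> real" where "mono h" "\<And>n. 0 \<le> h n" "filterlim h at_top sequentially" "summable (\<lambda>n. h n * a n)"
proof -
  \<comment> \<open>The geometric term keeps all tails positive, even if \<open>a\<close> is
    eventually 0.\<close>
  define a' where "a' n = a n + (1/2) ^ n" for n
  have a': "summable a'" "\<And>n. 0 < a' n"
    using a unfolding a'_def[abs_def] by (auto intro!: summable_add summable_geometric add_nonneg_pos)
  define R where "R n = (\<Sum>k. a' (k + n))" for n
  have sR: "summable (\<lambda>k. a' (k + n))" for n using a'(1) by (simp add: summable_iff_shift)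
  have Rpos: "0 < R n" for n unfolding R_def using a'(2) by (intro suminf_pos sR)
  have R_Suc: "R n = a' n + R (Suc n)" for n
    unfolding R_def using suminf_split_head[OF sR[of n]] by simp
  have R_le: "R (Suc n) \<le> R n" for n using R_Suc[of n] a'(2)[of n] by simp
  have R0: "R \<longlonglongrightarrow> 0" unfolding R_def using a'(1) by (rule suminf_exist_split2)
  define h where "h n = 1 / sqrt (R n)" for n
  show thesis
  proof (rule that)
    show "mono h"
    proof (rule incseq_SucI)
      show "h n \<le> h (Suc n)" for n
        using R_le[of n] Rpos[of n] Rpos[of "Suc n"] unfolding h_def by (intro divide_left_mono) auto
    qed
    show h0: "0 \<le> h n" for n using Rpos[of n] by (simp add: h_def)
    have "(\<lambda>n. sqrt (R n)) \<longlonglongrightarrow> sqrt 0" by (intro tendsto_real_sqrt R0)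
    then have "filterlim (\<lambda>n. inverse (sqrt (R n))) at_top sequentially"
      using Rpos by (intro filterlim_inverse_at_top) auto
    then show "filterlim h at_top sequentially" by (simp add: h_def[abs_def] inverse_eq_divide)
    have step: "h n * a n \<le> 2 * (sqrt (R n) - sqrt (R (Suc n)))" for n
    proof -
      have "h n * a n \<le> h n * a' n" using h0 by (intro mult_left_mono) (auto simp: a'_def)
      also have "a' n = (sqrt (R n) - sqrt (R (Suc n))) * (sqrt (R n) + sqrt (R (Suc n)))"
        using R_Suc[of n] Rpos[of n] Rpos[of "Suc n"] by (simp add: algebra_simps less_imp_le)
      also have "h n * \<dots> \<le> h n * ((sqrt (R n) - sqrt (R (Suc n))) * (2 * sqrt (R n)))"
        using R_le[of n] h0 by (intro mult_left_mono) auto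
      also have "\<dots> = 2 * (sqrt (R n) - sqrt (R (Suc n)))"
        using Rpos[of n] by (simp add: h_def)
      finally show ?thesis .
    qed
    show "summable (\<lambda>n. h n * a n)"
    proof (rule summableI_nonneg_bounded)
      show "0 \<le> h n * a n" for n using h0 a(2) by simp
      show "(\<Sum>i<n. h i * a i) \<le> 2 * sqrt (R 0)" for n
      proof -
        have "(\<Sum>i<n. h i * a i) \<le> (\<Sum>i<n. 2 * (sqrt (R i) - sqrt (R (Suc i))))" by (intro sum_mono step)
        also have "\<dots> = 2 * (sqrt (R 0) - sqrt (R n))"
          by (induction n) simp_all
        also have "\<dots> \<le> 2 * sqrt (R 0)" using Rpos[of n] by (simp add: less_imp_le)
        finally show ?thesis .
      qed
    qed
  qed
qed

section \<open>The ruler sequence and the layout of the copies\<close>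

fun ruler :: "nat \<Rightarrow> nat" where
  "ruler n = (if n = 0 \<or> odd n then 0 else Suc (ruler (n div 2)))"

declare ruler.simps [simp del]

lemma ruler_odd: "ruler (2 * n + 1) = 0" and ruler_even: "0 < n \<Longrightarrow> ruler (2 * n) = Suc (ruler n)"
  by (subst ruler.simps, simp)+

text \<open>\<open>ruler\<close> is the 2-adic valuation, with value 0 at 0. The numbers of
  valuation v form an arithmetic progression of step \<open>2 ^ (v + 1)\<close>, so each level
  recurs regularly.\<close>

lemma ruler_pow2: "ruler (2 ^ v * (2 * q + 1)) = v"
proof (induction v)
  case (Suc v)
  then show ?case using ruler_even[of "2 ^ v * (2 * q + 1)"] by (simp add: mult.assoc)
qed (simp add: ruler_odd[of q, simplified])

text \<open>Among 1, ..., 2 m the odd numbers contribute 0, and 2 j contributes one more than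
  j.\<close>

lemma sum_ruler_double: "(\<Sum>i<2 * m. ruler (Suc i)) = (\<Sum>i<m. ruler (Suc i)) + m"
proof (induction m)
  case (Suc m)
  have "(\<Sum>i<2 * Suc m. ruler (Suc i)) = (\<Sum>i<2 * m. ruler (Suc i)) + ruler (2 * m + 1) + ruler (2 * Suc m)"
    by simp
  also have "\<dots> = (\<Sum>i<Suc m. ruler (Suc i)) + Suc m"
    unfolding ruler_odd using ruler_even[of "Suc m"] Suc by simp
  finally show ?case .
qed simp

text \<open>The sum is the exponent of 2 in n!. Halving \<open>n\<close> gives the induction; the
  bound says that levels are at most 1 on average.\<close>

lemma sum_ruler_le: "(\<Sum>i<n. ruler (Suc i)) \<le> n"
proof (induction n rule: less_induct)
  case (less n)
  show ?case
  proof (cases "n = 0")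
    case False
    define m where "m = n div 2"
    have m: "(\<Sum>i<m. ruler (Suc i)) \<le> m" using False by (intro less) (simp add: m_def)
    show ?thesis
    proof (cases "even n")
      case True
      then have "n = 2 * m" by (simp add: m_def)
      then show ?thesis using m sum_ruler_double[of m] by simp
    next
      case False
      then have n: "n = Suc (2 * m)" by (simp add: m_def)
      have "(\<Sum>i<n. ruler (Suc i)) = (\<Sum>i<2 * m. ruler (Suc i)) + ruler (2 * m + 1)" by (simp add: n)
      then show ?thesis using m sum_ruler_double[of m] n ruler_odd[of m] by simp
    qed
  qed simp
qed

definition level :: "nat \<Rightarrow> nat" where "level k = ruler (Suc k)"

text \<open>Block \<open>i\<close> has length \<open>2 * (level i + 1)\<close>: a gap of
  \<open>level i + 1\<close> followed by room for a copy of the same length.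
  \<open>position k\<close> is the start of the copy.\<close>

definition position :: "nat \<Rightarrow> nat" where
  "position k = (\<Sum>i<k. 2 * (level i + 1)) + (level k + 1)"

lemma position_gap: "j < k \<Longrightarrow> position j + (level j + 1) + (level k + 1) \<le> position k"
proof (induction k)
  case (Suc k)
  then show ?case by (cases "j = k") (auto simp: position_def)
qed simp

text \<open>Linear growth of the positions, a consequence of the average of the levels, is what will
  give the copies of a fixed level positive lower density.\<close>

lemma position_le: "position k \<le> 4 * Suc k"
proof -
  have "position k \<le> (\<Sum>i<Suc k. 2 * (level i + 1))" by (simp add: position_def)
  also have "\<dots> = 2 * (\<Sum>i<Suc k. ruler (Suc i)) + 2 * Suc k"
  proof -
    have "(\<Sum>i<n. 2 * (level i + 1)) = 2 * (\<Sum>i<n. ruler (Suc i)) + 2 * n" for n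
      by (induction n) (simp_all add: level_def)
    then show ?thesis by blast
  qed
  also have "\<dots> \<le> 2 * Suc k + 2 * Suc k" using sum_ruler_le[of "Suc k"] by simp
  finally show ?thesis by simp
qed

lemma position_ge: "level k + 1 \<le> position k"
  by (simp add: position_def)

text \<open>
  Meant for \<open>g v\<close> supported in \<open>[0, v + 1)\<close>: then the copies are disjoint, a copy of level \<open>v\<close> is
  preceded by a gap of length at least \<open>v + 1\<close>, and each level has copies of positive density.
\<close>

definition concatenation :: "(nat \<Rightarrow> real \<Rightarrow> real) \<Rightarrow> real \<Rightarrow> real" where
  "concatenation g t = (\<Sum>k. g (level k) (t - real (position k)))"

lemma concatenation_block:
  assumes supp: "\<And>v t. g v t \<noteq> 0 \<Longrightarrow> 0 \<le> t \<and> t < real v + 1"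
    and t: "real (position k) \<le> t" "t < real (position k) + real (level k) + 1"
  shows "concatenation g t = g (level k) (t - real (position k))"
proof -
  have "g (level j) (t - real (position j)) = 0" if jk: "j \<noteq> k" for j
  proof (rule ccontr)
    assume "\<not> ?thesis"
    then have j: "real (position j) \<le> t" "t < real (position j) + real (level j) + 1"
      using supp by force+
    consider "j < k" | "k < j" using jk by linarith
    then show False
    proof cases
      case 1
      then have "real (position j) + real (level j) + 1 \<le> real (position k)"
        using position_gap[OF 1] by linarith
      then show False using j t by linarith
    next
      case 2
      then have "real (position k) + real (level k) + 1 \<le> real (position j)"
        using position_gap[OF 2] by linarith
      then show False using j t by linarith
    qed
  qed
  then have "concatenation g t = (\<Sum>j\<in>{k}. g (level j) (t - real (position j)))"
    unfolding concatenation_def by (intro suminf_finite) auto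
  then show ?thesis by simp
qed

lemma concatenation_cases:
  assumes supp: "\<And>v t. g v t \<noteq> 0 \<Longrightarrow> 0 \<le> t \<and> t < real v + 1" and "concatenation g t \<noteq> 0"
  obtains k where "real (position k) \<le> t" "t < real (position k) + real (level k) + 1"
    "concatenation g t = g (level k) (t - real (position k))"
proof -
  obtain k where "g (level k) (t - real (position k)) \<noteq> 0"
    using assms(2) unfolding concatenation_def by force
  then have k: "real (position k) \<le> t" "t < real (position k) + real (level k) + 1"
    using supp by force+
  show thesis by (rule that[OF k concatenation_block[OF supp k]])
qed

text \<open>A copy of level v starts after a gap of length v + 1, so its points are at distance at
  least v + 1 from the origin, and monotonicity of \<open>h\<close> applies. Measured from the start
  of copy \<open>k\<close> the same holds beyond its end, because the gap before a later copy lies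
  entirely to the right of copy \<open>k\<close>.\<close>

lemma concatenation_dominated:
  assumes supp: "\<And>v t. g v t \<noteq> 0 \<Longrightarrow> 0 \<le> t \<and> t < real v + 1"
    and h: "mono h" "\<And>n. 0 \<le> h n" and gh: "\<And>v t. \<bar>g v t\<bar> powr p \<le> h v" and t: "0 \<le> t"
  shows "\<bar>concatenation g t\<bar> powr p \<le> h (nat \<lfloor>t\<rfloor>)"
    and "real (level k) + 1 \<le> t \<Longrightarrow> \<bar>concatenation g (t + real (position k))\<bar> powr p \<le> h (nat \<lfloor>t\<rfloor>)"
proof -
  have mono_h: "\<bar>g v s\<bar> powr p \<le> h (nat \<lfloor>t\<rfloor>)" if "real v + 1 \<le> t" for v s
  proof -
    have "v \<le> nat \<lfloor>t\<rfloor>" using that by linarith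
    then show ?thesis using gh[of v s] monoD[OF h(1)] order_trans by blast
  qed
  show "\<bar>concatenation g t\<bar> powr p \<le> h (nat \<lfloor>t\<rfloor>)"
  proof (cases "concatenation g t = 0")
    case False
    then obtain j where j: "real (position j) \<le> t" "concatenation g t = g (level j) (t - real (position j))"
      using concatenation_cases[OF supp] by metis
    have "real (level j) + 1 \<le> t" using j position_ge[of j] by linarith
    then show ?thesis using mono_h j(2) by simp
  qed (simp add: h)
  assume tk: "real (level k) + 1 \<le> t"
  let ?s = "t + real (position k)"
  show "\<bar>concatenation g ?s\<bar> powr p \<le> h (nat \<lfloor>t\<rfloor>)"
  proof (cases "concatenation g ?s = 0")
    case False
    then obtain j where j: "real (position j) \<le> ?s" "?s < real (position j) + real (level j) + 1"
        "concatenation g ?s = g (level j) (?s - real (position j))"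
      using concatenation_cases[OF supp] by metis
    have "k < j"
    proof (rule ccontr)
      assume "\<not> k < j"
      then consider "j = k" | "j < k" by linarith
      then show False
      proof cases
        case 1
        then show False using j(2) tk by simp
      next
        case 2
        then have "real (position j) + real (level j) + 1 \<le> real (position k)"
          using position_gap[OF 2] by linarith
        then show False using j(2) t by linarith
      qed
    qed
    from position_gap[OF this] have "real (position k) + real (level j) + 1 \<le> real (position j)" by linarith
    then have "real (level j) + 1 \<le> t" using j(1) by linarith
    then show ?thesis using mono_h j(3) by simp
  qed (simp add: h)
qed

section \<open>The concatenation of step functions is frequently hypercyclic\<close>

context finite_weight_Lp
begin

text \<open>The factor for series is applied to the integrals of \<rho> over unit slices; as a step
  function, \<open>h\<close> is constant on each slice and factors out.\<close>

lemma unbounded_integrable_factor: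
  obtains h :: "nat \<Rightarrow> real" where "mono h" "\<And>n. 0 \<le> h n" "filterlim h at_top sequentially"
    "(\<integral>\<^sup>+t. ennreal (h (nat \<lfloor>t\<rfloor>) * \<rho> t) \<partial>half_line) < \<infinity>"
proof -
  define sl where "sl n = (\<integral>\<^sup>+t. ennreal (\<rho> (t + real n * 1)) * indicator {0..<1} t \<partial>half_line)" for n
  have slsum: "(\<Sum>n. sl n) = (\<integral>\<^sup>+t. ennreal (\<rho> t) \<partial>half_line)"
    unfolding sl_def by (rule nn_integral_half_line_slices[symmetric]) simp_all
  then have sl_fin: "(\<Sum>n. sl n) \<noteq> top" using finite_weight by simp
  have sl_n: "sl n < top" for n
    using ennreal_suminf_lessD[of sl top n] sl_fin by (simp add: less_top)
  define a where "a n = enn2real (sl n)" for n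
  have sl_a: "sl n = ennreal (a n)" for n using sl_n[of n] by (simp add: a_def)
  have "summable a" using sl_fin unfolding sl_a by (intro summable_suminf_not_top) (auto simp: a_def)
  moreover have a0: "0 \<le> a n" for n by (simp add: a_def)
  ultimately obtain h where h: "mono h" "\<And>n. 0 \<le> h n" "filterlim h at_top sequentially" "summable (\<lambda>n. h n * a n)"
    by (rule summable_with_unbounded_factor) blast
  note floor_fun_measurable [of h, measurable]
  have "(\<integral>\<^sup>+t. ennreal (h (nat \<lfloor>t\<rfloor>) * \<rho> t) \<partial>half_line) =
      (\<Sum>n. \<integral>\<^sup>+t. ennreal (h (nat \<lfloor>t + real n * 1\<rfloor>) * \<rho> (t + real n * 1)) * indicator {0..<1} t \<partial>half_line)"
    by (rule nn_integral_half_line_slices) simp_all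
  also have "\<dots> = (\<Sum>n. ennreal (h n * a n))"
  proof (intro suminf_cong)
    fix n
    have "(\<integral>\<^sup>+t. ennreal (h (nat \<lfloor>t + real n * 1\<rfloor>) * \<rho> (t + real n * 1)) * indicator {0..<1} t \<partial>half_line) =
        (\<integral>\<^sup>+t. ennreal (h n) * (ennreal (\<rho> (t + real n * 1)) * indicator {0..<1} t) \<partial>half_line)"
    proof (intro nn_integral_cong)
      fix t
      show "ennreal (h (nat \<lfloor>t + real n * 1\<rfloor>) * \<rho> (t + real n * 1)) * indicator {0..<1} t =
          ennreal (h n) * (ennreal (\<rho> (t + real n * 1)) * indicator {0..<1} t)"
      proof (cases "t \<in> {0..<1}")
        case True
        then have "nat \<lfloor>t + real n * 1\<rfloor> = n" by auto linarith
        then show ?thesis using True h(2) by (simp add: ennreal_mult')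
      qed simp
    qed
    also have "\<dots> = ennreal (h n) * sl n"
      unfolding sl_def
      by (intro nn_integral_cmult borel_measurable_times_ennreal measurable_compose[OF shift_measurable[OF weight_measurable] measurable_ennreal]) simp_all
    also have "\<dots> = ennreal (h n * a n)" using h(2) by (simp add: sl_a ennreal_mult')
    finally show "(\<integral>\<^sup>+t. ennreal (h (nat \<lfloor>t + real n * 1\<rfloor>) * \<rho> (t + real n * 1)) * indicator {0..<1} t \<partial>half_line) = ennreal (h n * a n)" .
  qed
  also have "\<dots> < \<infinity>" using h by (subst suminf_ennreal2) (auto simp: a_def)
  finally show thesis using that[OF h(1-3)] by blast
qed

lemma frequently_hypercyclic:
  "frequently_hypercyclic X N translation"
proof -
  obtain h :: "nat \<Rightarrow> real" where h: "mono h" "\<And>n. 0 \<le> h n" "filterlim h at_top sequentially"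
    and h_int: "(\<integral>\<^sup>+t. ennreal (h (nat \<lfloor>t\<rfloor>) * \<rho> t) \<partial>half_line) < \<infinity>"
    by (rule unbounded_integrable_factor) (rule that)
  \<comment> \<open>The first component of the decoded pair names a step function, the second is
    free, so each step function occurs at arbitrarily large \<open>v\<close>.\<close>
  define q where "q v = (from_nat (fst (prod_decode v)) :: nat \<times> rat list)" for v
  define ok where "ok v \<longleftrightarrow> fst (q v) > 0 \<and> length (snd (q v)) \<le> v + 1 \<and> (\<forall>t. \<bar>step_fun (q v) t\<bar> powr p \<le> h v)" for v
  define g where "g v = (if ok v then step_fun (q v) else (\<lambda>_. 0))" for v
  have supp: "0 \<le> t \<and> t < real v + 1" if "g v t \<noteq> 0" for v t
  proof -
    have o: "ok v" and s: "step_fun (q v) t \<noteq> 0" using that by (auto simp: g_def split: if_splits)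
    have "0 \<le> t" using s by (auto simp: step_fun_def Let_def split: if_splits)
    moreover have "\<not> real (length (snd (q v))) \<le> t" using step_fun_support[of "q v" t] o s by (auto simp: ok_def)
    ultimately show ?thesis using o by (auto simp: ok_def)
  qed
  have gh: "\<bar>g v t\<bar> powr p \<le> h v" for v t using h(2) by (auto simp: g_def ok_def)
  have gm: "g v \<in> borel_measurable borel" for v by (simp add: g_def)
  have gm': "g v \<in> borel_measurable half_line" for v
    by (rule borel_imp_half_line) (rule gm)
  have g_all: "\<exists>v\<ge>M. g v = step_fun r" if r: "fst r > 0" for r M
  proof -
    obtain C where C: "\<And>t. \<bar>step_fun r t\<bar> \<le> C" using step_fun_bounded[of r] by blast
    have "\<forall>\<^sub>F n in sequentially. C powr p \<le> h n" using h(3) by (simp add: filterlim_at_top)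
    then obtain n0 where n0: "\<And>n. n0 \<le> n \<Longrightarrow> C powr p \<le> h n" by (auto simp: eventually_sequentially)
    define v where "v = prod_encode (to_nat r, M + n0 + length (snd r))"
    have v: "M + n0 + length (snd r) \<le> v" unfolding v_def by (rule le_prod_encode_2)
    have qv: "q v = r" by (simp add: q_def v_def)
    have "\<bar>step_fun r t\<bar> powr p \<le> h v" for t
      using powr_mono2[OF _ _ C[of t], of p] n0[of v] v p by force
    then have "ok v" using r v by (simp add: ok_def qv)
    then show ?thesis using v by (intro exI[of _ v]) (simp add: g_def qv)
  qed
  define u where "u = concatenation g"
  have um: "u \<in> borel_measurable half_line"
  proof -
    have "(\<lambda>t. g (level k) (t - real (position k))) \<in> borel_measurable borel" for k
      by (rule measurable_compose[OF _ gm]) simp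
    then have "u \<in> borel_measurable borel"
      unfolding u_def concatenation_def[abs_def] by (rule borel_measurable_suminf)
    then show ?thesis by (rule borel_imp_half_line)
  qed
  have u_dom: "\<bar>u t\<bar> powr p \<le> h (nat \<lfloor>t\<rfloor>)" if "0 \<le> t" for t
    unfolding u_def by (rule concatenation_dominated(1)[OF supp h(1,2) gh that])
  have u_dom': "\<bar>u (t + real (position k))\<bar> powr p \<le> h (nat \<lfloor>t\<rfloor>)" if "0 \<le> t" "real (level k) + 1 \<le> t" for t k
    unfolding u_def by (rule concatenation_dominated(2)[OF supp h(1,2) gh that])
  have u_block: "u (t + real (position k)) = g (level k) t" if "0 \<le> t" "t < real (level k) + 1" for t k
    unfolding u_def using concatenation_block[of g k "t + real (position k)", OF supp] that by simp
  define x where "x = abs_fclass u"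
  have x: "x \<in> X"
  proof -
    have "I x \<le> (\<integral>\<^sup>+t. ennreal (h (nat \<lfloor>t\<rfloor>) * \<rho> t) \<partial>half_line)"
      unfolding x_def Lp_integral_abs[OF um]
      using u_dom weight_nonneg by (intro nn_integral_mono ennreal_leI mult_right_mono) auto
    then show ?thesis using h_int le_less_trans by (auto simp: X_iff)
  qed
  have hm: "(\<lambda>t. ennreal (h (nat \<lfloor>t\<rfloor>) * \<rho> t)) \<in> borel_measurable half_line"
  proof -
    note floor_fun_measurable [of h, measurable]
    show ?thesis by measurable
  qed
  define tail where "tail M = (\<integral>\<^sup>+t. ennreal (h (nat \<lfloor>t\<rfloor>) * \<rho> t) * indicator {real M..} t \<partial>half_line)" for M
  have tail0: "tail \<longlonglongrightarrow> 0"
  proof -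
    have "tail \<longlonglongrightarrow> (\<integral>\<^sup>+t. 0 \<partial>half_line)"
      unfolding tail_def
    proof (rule nn_integral_dominated_convergence[where w = "\<lambda>t. ennreal (h (nat \<lfloor>t\<rfloor>) * \<rho> t)"])
      show "AE t in half_line. (\<lambda>M. ennreal (h (nat \<lfloor>t\<rfloor>) * \<rho> t) * indicator {real M..} t) \<longlonglongrightarrow> 0"
      proof (rule AE_I2)
        fix t
        obtain n0 :: nat where n0: "t < real n0" using reals_Archimedean2 by blast
        have "\<forall>\<^sub>F M in sequentially. 0 = ennreal (h (nat \<lfloor>t\<rfloor>) * \<rho> t) * indicator {real M..} t"
          unfolding eventually_sequentially using n0 by (intro exI[of _ n0]) (auto simp: indicator_def)
        then show "(\<lambda>M. ennreal (h (nat \<lfloor>t\<rfloor>) * \<rho> t) * indicator {real M..} t) \<longlonglongrightarrow> 0"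
          by (rule Lim_transform_eventually[OF tendsto_const])
      qed
      show "(\<lambda>t. ennreal (h (nat \<lfloor>t\<rfloor>) * \<rho> t) * indicator {real M..} t) \<in> borel_measurable half_line" for M
        by (intro borel_measurable_times_ennreal hm borel_measurable_indicator) (simp add: sets_restrict_space_iff)
    qed (use h_int hm in \<open>auto simp: indicator_def\<close>)
    then show ?thesis by simp
  qed
  \<comment> \<open>After translation to copy \<open>k\<close> the error is 0 up to
    \<open>level k + 1\<close>, and beyond that \<open>u\<close> is controlled by \<open>h\<close>.
    \<open>tail\<close> starts one unit earlier, which only enlarges it.\<close>
  have tail_bound: "I (translation (real (position k)) x - abs_fclass (g (level k))) \<le> tail (level k)" for k
  proof -
    have sm: "(\<lambda>t. u (t + real (position k))) \<in> borel_measurable half_line" by (intro shift_measurable um) simp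
    show ?thesis
      unfolding x_def translation_abs[OF um of_nat_0_le_iff] Lp_integral_diff_abs[OF sm gm'] tail_def
    proof (intro nn_integral_mono)
      fix t assume "t \<in> space half_line"
      then have t: "0 \<le> t" by simp
      show "ennreal (\<bar>u (t + real (position k)) - g (level k) t\<bar> powr p * \<rho> t) \<le> ennreal (h (nat \<lfloor>t\<rfloor>) * \<rho> t) * indicator {real (level k)..} t"
      proof (cases "t < real (level k) + 1")
        case True
        then show ?thesis using u_block[OF t True] by simp
      next
        case False
        then have "g (level k) t = 0" using supp[of "level k" t] by blast
        then show ?thesis
          using False u_dom'[OF t, of k] weight_nonneg[OF t] by (auto intro!: ennreal_leI mult_right_mono)
      qed
    qed
  qed
  have approx: "\<exists>M. \<forall>k. M \<le> level k \<longrightarrow> N (translation (real (position k)) x - abs_fclass (g (level k))) < e" if e: "0 < e" for e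
  proof -
    have "\<forall>\<^sub>F M in sequentially. tail M < ennreal (e powr p)"
      using e by (intro order_tendstoD(2)[OF tail0]) auto
    then obtain M where M: "\<And>m. M \<le> m \<Longrightarrow> tail m < ennreal (e powr p)" by (auto simp: eventually_sequentially)
    have "N (translation (real (position k)) x - abs_fclass (g (level k))) < e" if k: "M \<le> level k" for k
    proof -
      have lt: "I (translation (real (position k)) x - abs_fclass (g (level k))) < ennreal (e powr p)"
        using tail_bound[of k] M[OF k] by (rule le_less_trans)
      then have "translation (real (position k)) x - abs_fclass (g (level k)) \<in> X"
        using less_trans[OF lt] by (simp add: X_iff)
      then show ?thesis using lt e by (subst N_less_iff) auto
    qed
    then show ?thesis by blast
  qed
  show ?thesis
    unfolding frequently_hypercyclic_def
  proof (intro bexI[OF _ x] allI impI)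
    fix U assume U: "openin (norm_topology X N) U \<and> U \<noteq> {}"
    then obtain y where yU: "y \<in> U" by blast
    obtain e where e: "e > 0" and ball: "\<And>z. z \<in> X \<Longrightarrow> N (y - z) < e \<Longrightarrow> z \<in> U"
      using U yU unfolding openin_X_iff by blast
    have y: "y \<in> X" using U yU unfolding openin_X_iff by blast
    obtain r where r: "fst r > 0" and yr: "N (y - abs_fclass (step_fun r)) < e / 4"
      using approximate_by_step_fun[OF y, of "e / 4"] e by auto
    let ?f = "abs_fclass (step_fun r)"
    note fX = step_fun_in_X[of r]
    obtain \<eta> where \<eta>: "0 < \<eta>" "\<eta> \<le> 1" and f\<eta>: "\<And>s. 0 \<le> s \<Longrightarrow> s \<le> \<eta> \<Longrightarrow> N (translation s ?f - ?f) < e / 4"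
      using translation_continuous_at_0[OF fX, of "e / 4"] e by auto
    obtain C where C: "C > 0" and TC: "\<And>t x. 0 \<le> t \<Longrightarrow> t \<le> 1 \<Longrightarrow> x \<in> X \<Longrightarrow> translation t x \<in> X \<and> N (translation t x) \<le> C * N x"
      using translation_bounded[of 1] by auto
    \<comment> \<open>The factor \<open>C\<close> absorbs the further translation by
      \<open>s \<le> \<eta> \<le> 1\<close>. With the modulus of \<open>?f\<close> and its distance
      from \<open>y\<close>, three quarters of \<open>e\<close> are used.\<close>
    obtain M where M: "\<And>k. M \<le> level k \<Longrightarrow> N (translation (real (position k)) x - abs_fclass (g (level k))) < e / (4 * C)"
      using approx[of "e / (4 * C)"] e C by auto
    obtain v where v: "M \<le> v" "g v = step_fun r" using g_all[OF r] by blast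
    have visit: "translation (real (position k) + s) x \<in> U" if k: "level k = v" and s: "0 \<le> s" "s \<le> \<eta>" for k s
    proof -
      let ?d = "translation (real (position k)) x - ?f"
      have tX: "translation (real (position k)) x \<in> X" by (rule translation_in_X[OF _ x]) simp
      have dX: "?d \<in> X" by (rule X_diff[OF tX fX])
      have "N ?d \<le> e / (4 * C)" using M[of k] k v by simp
      then have "N (translation s ?d) \<le> C * (e / (4 * C))"
        using TC[OF s(1) _ dX] s \<eta> C by (meson less_imp_le mult_left_mono order_trans)
      also have "\<dots> = e / 4" using C by simp
      finally have 1: "N (translation s ?d) \<le> e / 4" .
      have X1: "translation s ?d \<in> X" "translation s ?f - ?f \<in> X" "?f - y \<in> X"
        using s fX dX y by (auto intro!: X_diff translation_in_X)
      have "translation (real (position k) + s) x - y = translation s ?d + (translation s ?f - ?f) + (?f - y)"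
        using s by (simp add: translation_diff translation_translation add.commute)
      then have "N (translation (real (position k) + s) x - y) \<le> N (translation s ?d + (translation s ?f - ?f)) + N (?f - y)"
        using N_triangle[OF X_add[OF X1(1,2)] X1(3)] by simp
      also have "\<dots> \<le> N (translation s ?d) + N (translation s ?f - ?f) + N (?f - y)"
        using N_triangle[OF X1(1,2)] by simp
      also have "\<dots> < e / 4 + e / 4 + e / 4"
        using 1 f\<eta>[OF s] yr N_minus_commute[of ?f y] by simp
      also have "\<dots> < e" using e by simp
      finally have "N (y - translation (real (position k) + s) x) < e"
        by (simp add: N_minus_commute[of y])
      then show ?thesis using s x by (intro ball translation_in_X) auto
    qed
    \<comment> \<open>The level is the valuation of the successor, so the indices of level
      \<open>v\<close> are the predecessors of the odd multiples of \<open>2 ^ v\<close>.\<close>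
    define kk where "kk n = 2 ^ v * (2 * n + 1) - 1" for n :: nat
    have Suc_kk: "Suc (kk n) = 2 ^ v * (2 * n + 1)" for n by (simp add: kk_def)
    have level_kk: "level (kk n) = v" for n unfolding level_def Suc_kk by (rule ruler_pow2)
    show "lower_density {t. 0 \<le> t \<and> translation t x \<in> U} > 0"
    \<comment> \<open>\<open>position (kk n)\<close> is at most \<open>4 * Suc (kk n)\<close>, hence
      at most \<open>8 * 2 ^ v * Suc n\<close>; the summand 1 in \<open>D\<close> accounts for
      \<open>\<eta> \<le> 1\<close>.\<close>
    proof (rule lower_density_pos[where b = "\<lambda>n. real (position (kk n))" and \<eta> = \<eta> and D = "8 * 2 ^ v + 1"])
      show "{t. 0 \<le> t \<and> translation t x \<in> U} \<in> sets lebesgue"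
        using U x by (intro orbit_visits_measurable) auto
      show "{real (position (kk n))..real (position (kk n)) + \<eta>} \<subseteq> {t. 0 \<le> t \<and> translation t x \<in> U}" for n
      proof
        fix t assume t: "t \<in> {real (position (kk n))..real (position (kk n)) + \<eta>}"
        then show "t \<in> {t. 0 \<le> t \<and> translation t x \<in> U}"
          using visit[OF level_kk[of n], of "t - real (position (kk n))"] by auto
      qed
      show "real (position (kk n)) + \<eta> \<le> (8 * 2 ^ v + 1) * real (Suc n)" for n
      proof -
        have "real (position (kk n)) \<le> real (4 * Suc (kk n))" by (intro of_nat_mono position_le)
        also have "\<dots> = 4 * 2 ^ v * (2 * real n + 1)" unfolding Suc_kk by (simp add: algebra_simps)
        also have "\<dots> \<le> 4 * 2 ^ v * (2 * real n + 2)" by (intro mult_left_mono) auto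
        also have "\<dots> = 8 * 2 ^ v * real (Suc n)" by (simp add: algebra_simps)
        finally show ?thesis using \<eta>(2) by (simp add: algebra_simps)
      qed
      show "real (position (kk n)) + \<eta> < real (position (kk n'))" if "n < n'" for n n'
      proof -
        have "Suc (kk n) < Suc (kk n')" unfolding Suc_kk using that by simp
        then have "position (kk n) + (level (kk n) + 1) + (level (kk n') + 1) \<le> position (kk n')"
          by (intro position_gap) simp
        then show ?thesis using \<eta>(2) by linarith
      qed
    qed (use \<eta> in \<open>auto intro: add_pos_pos\<close>)
  qed
qed

end

section \<open>Chaos\<close>

lemma lower_density_empty: "lower_density {} = 0"
  by (simp add: lower_density_def Liminf_const zero_ereal_def[symmetric])

context weighted_Lp
begin

text \<open>The set of visits to a ball has positive lower density and so cannot be empty.\<close>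

lemma frequently_hypercyclic_imp_hypercyclic:
  assumes "frequently_hypercyclic X N translation"
  shows "hypercyclic X N translation"
proof -
  obtain x where x: "x \<in> X" and fhc: "\<And>U. openin (norm_topology X N) U \<Longrightarrow> U \<noteq> {} \<Longrightarrow>
      lower_density {t. 0 \<le> t \<and> translation t x \<in> U} > 0"
    using assms unfolding frequently_hypercyclic_def by blast
  have "dense_in_space X N {translation t x | t. 0 \<le> t}"
    unfolding dense_iff
  proof (intro conjI ballI allI impI)
    show "{translation t x | t. 0 \<le> t} \<subseteq> X" using x translation_in_X by auto
    fix y and e :: real assume y: "y \<in> X" and e: "0 < e"
    have "y \<in> {z\<in>X. N (y - z) < e}" using y e Lp_norm_eq_0[OF p \<rho> X_0] by simp
    then have "lower_density {t. 0 \<le> t \<and> translation t x \<in> {z\<in>X. N (y - z) < e}} > 0"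
      by (intro fhc openin_ball y) blast
    then have "{t. 0 \<le> t \<and> translation t x \<in> {z\<in>X. N (y - z) < e}} \<noteq> {}"
      by (metis less_irrefl lower_density_empty)
    then show "\<exists>z\<in>{translation t x | t. 0 \<le> t}. N (y - z) < e" by blast
  qed
  with x show ?thesis unfolding hypercyclic_def by blast
qed

lemma chaotic_imp_integrable_weight:
  assumes "chaotic X N translation"
  shows "(\<integral>\<^sup>+t. ennreal (\<rho> t) \<partial>half_line) < \<infinity>"
proof -
  have "dense_in_space X N (periodic_points X translation)" using assms by (simp add: chaotic_def)
  then obtain x where "x \<in> periodic_points X translation" "x \<noteq> 0" by (rule dense_imp_nonzero_element)
  then show ?thesis
    using nontrivial_periodic_imp_integrable_weight[of x] unfolding periodic_points_def by blast
qed

end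

context finite_weight_Lp
begin

text \<open>The periodization of \<open>f\<close> with period \<open>m + n\<close> agrees with
  \<open>f\<close> on \<open>[0, m + n)\<close> and is bounded by the same constant. Since constants
  are integrable against \<rho>, dominated convergence gives norm convergence as the period
  grows.\<close>

lemma dense_periodic_points: "dense_in_space X N (periodic_points X translation)"
  unfolding dense_iff
proof (intro conjI ballI allI impI)
  show "periodic_points X translation \<subseteq> X" by (auto simp: periodic_points_def)
  fix x and e :: real assume x: "x \<in> X" and e: "0 < e"
  obtain f where f: "f \<in> test_functions" and xf: "N (x - abs_fclass f) < e / 2"
    using approximate_by_test_function[OF x, of "e / 2"] e by auto
  obtain m C where m: "m > 0" "\<And>t. m \<le> t \<Longrightarrow> f t = 0" and C: "\<And>t. \<bar>f t\<bar> \<le> C"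
    using test_functionsE[OF f] by metis
  define P where "P n = m + real n" for n
  have P: "0 < P n" for n using m(1) by (simp add: P_def add_pos_nonneg)
  define g where "g n t = f (t - P n * real_of_int \<lfloor>t / P n\<rfloor>)" for n t
  have gm: "g n \<in> borel_measurable half_line" for n
  proof -
    have "(\<lambda>t. t - P n * real_of_int \<lfloor>t / P n\<rfloor>) \<in> borel_measurable borel" by measurable
    then have "g n \<in> borel_measurable borel"
      unfolding g_def by (rule measurable_compose[OF _ test_functions_measurable[OF f]])
    then show ?thesis by (rule borel_imp_half_line)
  qed
  have gC: "\<bar>g n t\<bar> \<le> C" for n t unfolding g_def by (rule C)
  have gX: "abs_fclass (g n) \<in> X" for n by (rule bounded_in_X(1)[OF gm gC])
  have g_per: "g n (t + P n) = g n t" for n t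
  proof -
    have "(t + P n) / P n = t / P n + 1" using P[of n] by (simp add: add_divide_distrib)
    then have "\<lfloor>(t + P n) / P n\<rfloor> = \<lfloor>t / P n\<rfloor> + 1" by simp
    then show ?thesis by (simp add: g_def algebra_simps)
  qed
  have "abs_fclass (g n) \<in> periodic_points X translation" for n
    using gX[of n] P[of n] gm[of n] g_per[of n]
    by (auto simp: periodic_points_def translation_abs intro!: exI[of _ "P n"])
  moreover have "\<forall>\<^sub>F n in sequentially. N (abs_fclass (g n) - abs_fclass f) < e / 2"
  proof (rule dominated_convergence_X[where g = "\<lambda>_. 2 * C"])
    show "AE t in half_line. (\<lambda>n. g n t) \<longlonglongrightarrow> f t"
    proof (rule AE_I2)
      fix t assume "t \<in> space half_line"
      then have t: "0 \<le> t" by simp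
      obtain n0 :: nat where n0: "t < real n0" using reals_Archimedean2 by blast
      have "f t = g n t" if "n0 \<le> n" for n
      proof -
        have "t < P n" using n0 that m(1) by (simp add: P_def)
        then have "\<lfloor>t / P n\<rfloor> = 0" using t P[of n] by (simp add: floor_eq_iff)
        then show ?thesis by (simp add: g_def)
      qed
      then have "\<forall>\<^sub>F n in sequentially. f t = g n t" unfolding eventually_sequentially by blast
      then show "(\<lambda>n. g n t) \<longlonglongrightarrow> f t" by (rule Lim_transform_eventually[OF tendsto_const])
    qed
    show "\<bar>g n t - f t\<bar> \<le> 2 * C" for n t using gC[of n t] C[of t] by linarith
    show "(\<integral>\<^sup>+ t. ennreal ((2 * C) powr p * \<rho> t) \<partial>half_line) < \<infinity>" by (rule const_integrable)
  qed (use e gm gX test_functions_measurable_half_line[OF f] test_functions_in_X[OF f] in auto)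
  then obtain n where n: "N (abs_fclass (g n) - abs_fclass f) < e / 2"
    unfolding eventually_sequentially by blast
  have "N (x - abs_fclass (g n)) \<le> N (x - abs_fclass f) + N (abs_fclass f - abs_fclass (g n))"
    by (rule triangle[OF x test_functions_in_X[OF f] gX])
  then have "N (x - abs_fclass (g n)) < e"
    using n xf N_minus_commute[of "abs_fclass f" "abs_fclass (g n)"] by simp
  ultimately show "\<exists>y\<in>periodic_points X translation. N (x - y) < e" by blast
qed

lemma chaotic: "chaotic X N translation"
  unfolding chaotic_def
  using frequently_hypercyclic_imp_hypercyclic[OF frequently_hypercyclic] dense_periodic_points by blast

end

theorem theorem3p10:
  fixes p :: real and \<rho> :: "real \<Rightarrow> real"
  assumes "1 \<le> p" and "admissible_weight \<rho>"
  shows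
    "(frequently_hypercyclic (Lp_space p \<rho>) (Lp_norm p \<rho>) translation
        \<longleftrightarrow> summable (\<lambda>k::nat. \<rho> (real k))) \<and>
     (summable (\<lambda>k::nat. \<rho> (real k))
        \<longleftrightarrow> (\<integral>\<^sup>+t. ennreal (\<rho> t) \<partial>lebesgue_on {0..}) < \<infinity>) \<and>
     ((\<integral>\<^sup>+t. ennreal (\<rho> t) \<partial>lebesgue_on {0..}) < \<infinity>
        \<longleftrightarrow> chaotic (Lp_space p \<rho>) (Lp_norm p \<rho>) translation) \<and>
     (chaotic (Lp_space p \<rho>) (Lp_norm p \<rho>) translation
        \<longleftrightarrow> frequent_hypercyclicity_criterion (Lp_space p \<rho>) (Lp_norm p \<rho>) translation)"
proof -
  interpret weighted_Lp p \<rho> by (rule weighted_Lp.intro[OF assms])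
  have fin: "finite_weight_Lp p \<rho>" if "(\<integral>\<^sup>+t. ennreal (\<rho> t) \<partial>half_line) < \<infinity>"
    using that by unfold_locales
  have sum: "summable (\<lambda>k::nat. \<rho> (real k)) \<longleftrightarrow> (\<integral>\<^sup>+t. ennreal (\<rho> t) \<partial>half_line) < \<infinity>"
    using summable_weight_iff[of 1] by simp
  have fhc: "frequently_hypercyclic X N translation \<longleftrightarrow> summable (\<lambda>k::nat. \<rho> (real k))"
    using frequently_hypercyclic_imp_summable finite_weight_Lp.frequently_hypercyclic[OF fin] sum by blast
  have cha: "(\<integral>\<^sup>+t. ennreal (\<rho> t) \<partial>half_line) < \<infinity> \<longleftrightarrow> chaotic X N translation"
    using chaotic_imp_integrable_weight finite_weight_Lp.chaotic[OF fin] by blast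
  have crit: "(\<integral>\<^sup>+t. ennreal (\<rho> t) \<partial>half_line) < \<infinity> \<longleftrightarrow> frequent_hypercyclicity_criterion X N translation"
    using criterion_imp_integrable_weight finite_weight_Lp.frequent_hypercyclicity_criterion_holds[OF fin] by blast
  show ?thesis using fhc sum cha crit by simp
qed

end
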